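(* Assume that $\liminf_{n\to\infty}S_n=-\infty$ a.s. and $\limsup_{n\to\infty}S_n'=+\infty$ a.s. If every point in $\operatorname{supp}\mu$ is topologically recurrent for $Y$, then $\mu$ is ergodic for $Y$.
   Context: Setting. $X_1,X_1'$ are real random variables, neither a.s. equal to $0$, and $\alpha\in[0,1]$. $(X_n)_{n\ge1}$ and $(X_n')_{n\ge1}$ are sequences of i.i.d. random variables, jointly independent; $S_n:=X_1+\dots+X_n$, $S_n':=X_1'+\dots+X_n'$. The switching random walk $Y=(Y_n)_{n\ge0}$ is the time-homogeneous Markov chain with transition kernel $P$: $P(x,dy)=\mathbb P(x+X_1\in dy)$ if $x>0$; $P(x,dy)=\mathbb P(x+X_1'\in dy)$ if $x<0$; $P(0,dy)=\alpha\,\mathbb P(X_1\in dy)+(1-\alpha)\,\mathbb P(X_1'\in dy)$. $\mathbb P_x$ means $Y_0=x$. State space. $\mathcal Z_0:=\mathbb R$, $\mathcal Z_u:=u\mathbb Z$ for $u>0$; $d:=\max\{u\ge0:\mathbb P(X_1\in\mathcal Z_u)\,\mathbb P(X_1'\in\mathcal Z_u)=1\}$; $\mathcal Z:=\mathcal Z_d$ is the state space of $Y$. $\lambda$ is the Haar measure on $\mathcal Z$ normalized so that $\lambda([0,x)\cap\mathcal Z)=x$ for positive $x\in\mathcal Z$. Measures are Borel; $\operatorname{supp}$ is the topological support; $*$ is convolution. Ladder heights. $D:=S_{\gamma_-}$ with $\gamma_-:=\inf\{k\ge1:S_k\le0\}$ (first weak descending ladder height of $S$); $A':=S'_{\gamma_+'}$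 with $\gamma_+':=\inf\{k\ge1:S_k'\ge0\}$ (first weak ascending ladder height of $S'$); $A_s$ is the first strict ascending ladder height of $S$ (the value of $S$ at the first $k\ge1$ with $S_k>0$) and $D_s'$ is the first strict descending ladder height of $S'$ (the value of $S'$ at the first $k\ge1$ with $S_k'<0$), both possibly defective; $\mathcal L(\cdot)$ denotes (sub-probability) distribution. $U_+:=\delta_0+\sum_{n\ge1}\mathcal L(A_s)^{*n}$, $U_-':=\delta_0+\sum_{n\ge1}\mathcal L(D_s')^{*n}$. For a measure $\varphi$ on $\mathcal Z$: $\varphi_\alpha^+(dx):=[\mathbf 1(x>0)+\alpha\mathbf 1(x=0)]\varphi(dx)$, $\varphi_\alpha^-(dx):=[\mathbf 1(x<0)+(1-\alpha)\mathbf 1(x=0)]\varphi(dx)$. With $p:=\mathbb P(D<0)$, $p':=\mathbb P(A'>0)$, $a:=\frac{p\alpha}{p\alpha+p'(1-\alpha)}$, $$\nu(dx):=\big[\mathbb P(D<x)+\mathbb P(A'>x)-1+a\mathbb P(D=x)+(1-a)\mathbb P(A'=x)\big]\lambda(dx),\qquad \mu:=U_+*\nu_\alpha^++U_-'*\nu_\alpha^-$$ (the measure $\mu$ is invariant for $Y$). A point $x\in\mathcal Z$ is topologically recurrent for $Y$ if $\mathbb P_x(Y_n\in G\text{ for some }n\ge1)=1$ for every open $G\subset\mathcal Z$ containing $x$. An invariant measure $\varphi$ of $Y$ is ergodic for $Y$ if for every shift-invariant $B\in\mathcal B(\mathcal Z)^{\otimes\mathbb N_0}$, i.e. $B=\{(x_0,x_1,\ldots)\in\mathcal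 Z^{\mathbb N_0}:(x_1,x_2,\ldots)\in B\}$, either $\mathbb P_x(Y\in B)=0$ for $\varphi$-a.e. $x$ or $\mathbb P_x(Y\in B^c)=0$ for $\varphi$-a.e. $x$. *)

theory Defs
  imports "HOL-Probability.Probability"
begin

section \<open>Sums of measures\<close>

definition plus_measure :: "'a measure \<Rightarrow> 'a measure \<Rightarrow> 'a measure" where
  "plus_measure M N = measure_of (space M) (sets M) (\<lambda>A. emeasure M A + emeasure N A)"

definition series_measure :: "(nat \<Rightarrow> 'a measure) \<Rightarrow> 'a measure" where
  "series_measure F = measure_of (space (F 0)) (sets (F 0)) (\<lambda>A. \<Sum>n. emeasure (F n) A)"

lemma space_plus_measure [simp]: "space (plus_measure M N) = space M"
  and sets_plus_measure [simp, measurable_cong]: "sets (plus_measure M N) = sets M"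
  by (simp_all add: plus_measure_def)

lemma space_series_measure [simp]: "space (series_measure F) = space (F 0)"
  and sets_series_measure [simp, measurable_cong]: "sets (series_measure F) = sets (F 0)"
  by (simp_all add: series_measure_def)

lemma emeasure_plus_measure:
  assumes "sets N = sets M" "A \<in> sets M"
  shows "emeasure (plus_measure M N) A = emeasure M A + emeasure N A"
proof (rule emeasure_measure_of[OF plus_measure_def])
  show "countably_additive (sets (plus_measure M N)) (\<lambda>A. emeasure M A + emeasure N A)"
  proof (rule countably_additiveI)
    fix B :: "nat \<Rightarrow> 'a set"
    assume "range B \<subseteq> sets (plus_measure M N)" "disjoint_family B"
    then show "(\<Sum>i. emeasure M (B i) + emeasure N (B i)) = emeasure M (\<Union>i. B i) + emeasure N (\<Union>i. B i)"
      using assms by (simp add: suminf_add[symmetric] suminf_emeasure)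
  qed
  show "sets M \<subseteq> Pow (space M)"
    by (rule sets.space_closed)
  show "A \<in> sets (plus_measure M N)"
    by (simp add: assms)
  show "positive (sets (plus_measure M N)) (\<lambda>A. emeasure M A + emeasure N A)"
    by (simp add: positive_def)
qed

lemma emeasure_series_measure:
  assumes "\<And>n. sets (F n) = sets N" "A \<in> sets N"
  shows "emeasure (series_measure F) A = (\<Sum>n. emeasure (F n) A)"
proof (rule emeasure_measure_of[OF series_measure_def])
  show "sets (F 0) \<subseteq> Pow (space (F 0))"
    by (rule sets.space_closed)
  show "A \<in> sets (series_measure F)"
    by (simp add: assms)
  show "positive (sets (series_measure F)) (\<lambda>A. \<Sum>n. emeasure (F n) A)"
    by (simp add: positive_def)
  show "countably_additive (sets (series_measure F)) (\<lambda>A. \<Sum>n. emeasure (F n) A)"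
  proof (rule countably_additiveI)
    fix B :: "nat \<Rightarrow> 'a set"
    assume B: "range B \<subseteq> sets (series_measure F)" "disjoint_family B"
    have "(\<Sum>i. \<Sum>n. emeasure (F n) (B i)) = (\<integral>\<^sup>+i. (\<Sum>n. emeasure (F n) (B i)) \<partial>count_space UNIV)"
      by (rule nn_integral_count_space_nat[symmetric])
    also have "\<dots> = (\<Sum>n. \<integral>\<^sup>+i. emeasure (F n) (B i) \<partial>count_space UNIV)"
      by (rule nn_integral_suminf) simp
    also have "\<dots> = (\<Sum>n. \<Sum>i. emeasure (F n) (B i))"
      by (simp only: nn_integral_count_space_nat)
    also have "\<dots> = (\<Sum>n. emeasure (F n) (\<Union>i. B i))"
      using B by (intro suminf_cong suminf_emeasure) (simp_all add: assms(1))
    finally show "(\<Sum>i. \<Sum>n. emeasure (F n) (B i)) = (\<Sum>n. emeasure (F n) (\<Union>i. B i))" .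
  qed
qed


section \<open>Lattices, walks, ladder heights, renewal measures\<close>

definition lattice_set :: "real \<Rightarrow> real set" where
  "lattice_set u = (if u = 0 then UNIV else range (\<lambda>k::int. u * of_int k))"

definition lattice_haar :: "real \<Rightarrow> real measure" where
  "lattice_haar u = (if u = 0 then lborel
     else scale_measure (ennreal u) (distr (count_space UNIV) borel (\<lambda>k::int. u * of_int k)))"

lemma lattice_set_borel [measurable]: "lattice_set u \<in> sets borel"
proof -
  have "countable (range (\<lambda>k::int. u * of_int k))"
    by (intro countable_image countableI_type)
  then have "range (\<lambda>k::int. u * of_int k) \<in> sets borel"
    by (rule sets.countable[rotated]) (rule borel_singleton, rule sets.empty_sets)
  moreover have "UNIV \<in> sets (borel :: real measure)"
    by (rule space_in_borel)
  ultimately show ?thesis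
    unfolding lattice_set_def by presburger
qed

lemma emeasure_lattice_haar:
  assumes "0 \<le> u" "0 < x" "x \<in> lattice_set u"
  shows "emeasure (lattice_haar u) ({0..<x} \<inter> lattice_set u) = ennreal x"
proof (cases "u = 0")
  case True
  then have "{0..<x} \<inter> lattice_set u = {0..<x}"
    by (simp add: lattice_set_def)
  with True show ?thesis
    using assms(2) emeasure_lborel_Ico[of 0 x] by (simp only: lattice_haar_def if_True) simp
next
  case False
  with assms obtain k :: int where k: "x = u * of_int k" "0 < u"
    by (auto simp: lattice_set_def)
  have "0 < k"
    using assms(2) k by (simp add: zero_less_mult_iff)
  have "(\<lambda>j::int. u * of_int j) -` ({0..<x} \<inter> lattice_set u) = {0..<k}"
    using k by (auto simp: lattice_set_def zero_le_mult_iff)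
  then have "emeasure (lattice_haar u) ({0..<x} \<inter> lattice_set u) = ennreal u * of_nat (nat k)"
    using False by (simp add: lattice_haar_def emeasure_distr)
  also have "\<dots> = ennreal (u * of_nat (nat k))"
    using k by (simp add: ennreal_mult ennreal_of_nat_eq_real_of_nat)
  finally show ?thesis
    using k \<open>0 < k\<close> by simp
qed

definition walk :: "(nat \<Rightarrow> 'a \<Rightarrow> real) \<Rightarrow> nat \<Rightarrow> 'a \<Rightarrow> real" where
  "walk X n \<omega> = (\<Sum>k=1..n. X k \<omega>)"

text \<open>The possibly defective law of the value of the walk at its first visit to \<open>C\<close> at a positive time:
  paths that never visit \<open>C\<close> contribute no mass.\<close>

definition ladder_law :: "'a measure \<Rightarrow> (nat \<Rightarrow> 'a \<Rightarrow> real) \<Rightarrow> real set \<Rightarrow> real measure" where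
  "ladder_law M X C =
     distr (restrict_space M {\<omega> \<in> space M. \<exists>k\<ge>1. walk X k \<omega> \<in> C}) borel
       (\<lambda>\<omega>. walk X (LEAST k. 1 \<le> k \<and> walk X k \<omega> \<in> C) \<omega>)"

definition renewal_measure :: "real measure \<Rightarrow> real measure" where
  "renewal_measure L = series_measure (\<lambda>n. ((\<lambda>N. L \<star> N) ^^ n) (return borel 0))"

definition part_pos :: "real \<Rightarrow> real measure \<Rightarrow> real measure" where
  "part_pos \<alpha> \<phi> = density \<phi> (\<lambda>x. ennreal (indicator {0<..} x + \<alpha> * indicator {0} x))"

definition part_neg :: "real \<Rightarrow> real measure \<Rightarrow> real measure" where
  "part_neg \<alpha> \<phi> = density \<phi> (\<lambda>x. ennreal (indicator {..<0} x + (1 - \<alpha>) * indicator {0} x))"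


section \<open>The switching random walk\<close>

locale switching_random_walk = prob_space M
  for M :: "'a measure" +
  fixes X X' :: "nat \<Rightarrow> 'a \<Rightarrow> real" and \<alpha> :: real
  assumes indep: "indep_vars (\<lambda>_. borel) (case_sum X X') ({1..} <+> {1..})"
    and ident: "\<And>n. 1 \<le> n \<Longrightarrow> distr M borel (X n) = distr M borel (X 1)"
    and ident': "\<And>n. 1 \<le> n \<Longrightarrow> distr M borel (X' n) = distr M borel (X' 1)"
    and nonzero: "\<not> (AE \<omega> in M. X 1 \<omega> = 0)"
    and nonzero': "\<not> (AE \<omega> in M. X' 1 \<omega> = 0)"
    and alpha: "0 \<le> \<alpha>" "\<alpha> \<le> 1"
begin

definition max_span :: real where
  "max_span = (GREATEST u. 0 \<le> u \<and>
     prob {\<omega> \<in> space M. X 1 \<omega> \<in> lattice_set u} * prob {\<omega> \<in> space M. X' 1 \<omega> \<in> lattice_set u} = 1)"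

definition Z :: "real set" where
  "Z = lattice_set max_span"

definition borel_Z :: "real measure" where
  "borel_Z = restrict_space borel Z"

definition jump :: "real \<Rightarrow> real measure" where
  "jump x =
     (if 0 < x then distr M borel (\<lambda>\<omega>. x + X 1 \<omega>)
      else if x < 0 then distr M borel (\<lambda>\<omega>. x + X' 1 \<omega>)
      else plus_measure (scale_measure (ennreal \<alpha>) (distr M borel (X 1)))
             (scale_measure (ennreal (1 - \<alpha>)) (distr M borel (X' 1))))"

text \<open>For \<open>x \<in> Z\<close> the jump law is carried by \<open>Z\<close>, so restricting it loses no mass
  (\<open>prob_space_kernel\<close> below).\<close>

definition kernel :: "real \<Rightarrow> real measure" where
  "kernel x = restrict_space (jump x) Z"

definition step_kernel :: "real \<Rightarrow> nat \<Rightarrow> (nat \<Rightarrow> real) \<Rightarrow> real measure" where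
  "step_kernel x n y = (case n of 0 \<Rightarrow> return borel_Z x | Suc m \<Rightarrow> kernel (y m))"

text \<open>The law of the whole trajectory \<open>(Y\<^sub>0, Y\<^sub>1, \<dots>)\<close> started at \<open>x\<close>, on the product space
  \<open>Z\<^sup>\<nat>\<close>, given by the Ionescu-Tulcea theorem; see \<open>Ionescu_Tulcea_step_kernel\<close> below.\<close>

definition path_law :: "real \<Rightarrow> (nat \<Rightarrow> real) measure" where
  "path_law x =
     projective_family.lim UNIV (Ionescu_Tulcea.CI (step_kernel x) (\<lambda>_. borel_Z)) (\<lambda>_. borel_Z)"

definition topologically_recurrent :: "real \<Rightarrow> bool" where
  "topologically_recurrent x \<longleftrightarrow> x \<in> Z \<and>
     (\<forall>G. openin (top_of_set Z) G \<and> x \<in> G \<longrightarrow>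
        emeasure (path_law x) {y \<in> space (path_law x). \<exists>n\<ge>1. y n \<in> G} = 1)"

definition invariant :: "real measure \<Rightarrow> bool" where
  "invariant \<phi> \<longleftrightarrow> sets \<phi> = sets borel_Z \<and>
     (\<forall>B \<in> sets borel_Z. (\<integral>\<^sup>+x. emeasure (kernel x) B \<partial>\<phi>) = emeasure \<phi> B)"

definition paths :: "(nat \<Rightarrow> real) measure" where
  "paths = (\<Pi>\<^sub>M n\<in>UNIV. borel_Z)"

text \<open>Ergodicity is a property of invariant measures, so invariance is part of the definition.\<close>

definition ergodic :: "real measure \<Rightarrow> bool" where
  "ergodic \<phi> \<longleftrightarrow> invariant \<phi> \<and>
     (\<forall>B \<in> sets paths. B = {y \<in> space paths. (\<lambda>n. y (Suc n)) \<in> B} \<longrightarrow>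
        (AE x in \<phi>. emeasure (path_law x) B = 0) \<or>
        (AE x in \<phi>. emeasure (path_law x) (space paths - B) = 0))"

definition topological_support :: "real measure \<Rightarrow> real set" where
  "topological_support \<phi> =
     {x \<in> Z. \<forall>G. openin (top_of_set Z) G \<and> x \<in> G \<longrightarrow> 0 < emeasure \<phi> G}"

definition law_D :: "real measure" where
  "law_D = ladder_law M X {..0}"

definition law_A' :: "real measure" where
  "law_A' = ladder_law M X' {0..}"

definition U_pos :: "real measure" where
  "U_pos = renewal_measure (ladder_law M X {0<..})"

definition U_neg' :: "real measure" where
  "U_neg' = renewal_measure (ladder_law M X' {..<0})"

definition p :: real where
  "p = measure law_D {..<0}"

definition p' :: real where
  "p' = measure law_A' {0<..}"

definition a :: real where
  "a = p * \<alpha> / (p * \<alpha> + p' * (1 - \<alpha>))"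

definition \<nu> :: "real measure" where
  "\<nu> = density (lattice_haar max_span) (\<lambda>x. ennreal
     (measure law_D {..<x} + measure law_A' {x<..} - 1
        + a * measure law_D {x} + (1 - a) * measure law_A' {x}))"

text \<open>Both convolutions are Borel measures on the line carried by \<open>Z\<close>; \<open>\<mu>\<close> is their sum regarded
  as a measure on \<open>Z\<close>.\<close>

definition \<mu> :: "real measure" where
  "\<mu> = restrict_space (plus_measure (U_pos \<star> part_pos \<alpha> \<nu>) (U_neg' \<star> part_neg \<alpha> \<nu>)) Z"


subsection \<open>The trajectory law is well defined\<close>

lemma rv [measurable]: "1 \<le> n \<Longrightarrow> X n \<in> borel_measurable M"
  and rv' [measurable]: "1 \<le> n \<Longrightarrow> X' n \<in> borel_measurable M"
  using indep by (auto simp: indep_vars_def Plus_def ball_Un)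

lemma rv1 [measurable]: "X (Suc 0) \<in> borel_measurable M" "X' (Suc 0) \<in> borel_measurable M"
  using rv[of 1] rv'[of 1] by simp_all

lemma Z_borel [measurable]: "Z \<in> sets borel"
  by (simp add: Z_def)

lemma AE_lattice_iff:
  "prob {\<omega> \<in> space M. X 1 \<omega> \<in> lattice_set u} * prob {\<omega> \<in> space M. X' 1 \<omega> \<in> lattice_set u} = 1
     \<longleftrightarrow> (AE \<omega> in M. X 1 \<omega> \<in> lattice_set u) \<and> (AE \<omega> in M. X' 1 \<omega> \<in> lattice_set u)"
proof -
  have "x * y = 1 \<longleftrightarrow> x = 1 \<and> y = 1" if "0 \<le> x" "x \<le> 1" "0 \<le> y" "y \<le> 1" for x y :: real
    using that by (metis mult.commute mult.right_neutral mult_left_le_one_le order_antisym)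
  then show ?thesis
    by (simp add: prob_Collect_eq_1)
qed

lemma max_span_exists:
  "\<exists>d\<ge>0. (AE \<omega> in M. X 1 \<omega> \<in> lattice_set d) \<and> (AE \<omega> in M. X' 1 \<omega> \<in> lattice_set d) \<and>
     (\<forall>u\<ge>0. (AE \<omega> in M. X 1 \<omega> \<in> lattice_set u) \<and> (AE \<omega> in M. X' 1 \<omega> \<in> lattice_set u) \<longrightarrow> u \<le> d)"
proof -
  define Q where "Q u \<longleftrightarrow> (AE \<omega> in M. X 1 \<omega> \<in> lattice_set u) \<and> (AE \<omega> in M. X' 1 \<omega> \<in> lattice_set u)" for u
  have "\<exists>d\<ge>0. Q d \<and> (\<forall>u\<ge>0. Q u \<longrightarrow> u \<le> d)"
  proof (cases "\<exists>u>0. Q u")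
    case False
    moreover have "Q 0" by (simp add: Q_def lattice_set_def)
    ultimately show ?thesis by (metis not_le order_refl)
  next
    case True
    then obtain u where u: "u > 0" "Q u" by auto
    have "\<exists>k::int. k \<noteq> 0 \<and> \<not> (AE \<omega> in M. X 1 \<omega> \<noteq> u * of_int k)"
    proof (rule ccontr)
      assume "\<not> ?thesis"
      then have "AE \<omega> in M. \<forall>k::int. k \<noteq> 0 \<longrightarrow> X 1 \<omega> \<noteq> u * of_int k"
        by (subst AE_all_countable) auto
      moreover have "AE \<omega> in M. X 1 \<omega> \<in> lattice_set u" using u by (simp add: Q_def)
      ultimately have "AE \<omega> in M. X 1 \<omega> = 0"
        by eventually_elim (use u in \<open>auto simp: lattice_set_def\<close>)
      with nonzero show False by simp
    qed
    then obtain k :: int where k: "k \<noteq> 0" "\<not> (AE \<omega> in M. X 1 \<omega> \<noteq> u * of_int k)" by auto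
    define c where "c = \<bar>u * of_int k\<bar>"
    have c: "c > 0" using u k by (simp add: c_def)
    have form: "\<exists>m::nat. 0 < m \<and> v = c / of_nat m" if v: "v > 0" "Q v" for v
    proof -
      have "u * of_int k \<in> lattice_set v"
      proof (rule ccontr)
        assume "u * of_int k \<notin> lattice_set v"
        then have "AE \<omega> in M. X 1 \<omega> \<noteq> u * of_int k"
          using v by (auto simp: Q_def elim!: eventually_mono)
        with k show False by simp
      qed
      then obtain j :: int where j: "u * of_int k = v * of_int j"
        using v by (auto simp: lattice_set_def)
      then have "c = v * of_nat (nat \<bar>j\<bar>)" using v by (simp add: c_def abs_mult)
      moreover from this c have "0 < nat \<bar>j\<bar>" by (cases "j = 0") auto
      ultimately show ?thesis by (intro exI[of _ "nat \<bar>j\<bar>"]) (simp add: field_simps)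
    qed
    define m where "m = (LEAST m. 0 < m \<and> Q (c / of_nat m))"
    have "\<exists>m::nat. 0 < m \<and> Q (c / of_nat m)" using form[OF u] u by auto
    then have m: "0 < m" "Q (c / of_nat m)"
      unfolding m_def by (metis (mono_tags, lifting) LeastI)+
    have "v \<le> c / of_nat m" if v: "v \<ge> 0" "Q v" for v
    proof (cases "v = 0")
      case False
      with v have "0 < v" by simp
      from form[OF this v(2)] obtain n :: nat where n: "0 < n" "v = c / of_nat n" by blast
      then have "m \<le> n" unfolding m_def using v(2) by (intro Least_le) simp
      then show ?thesis unfolding n(2) using m(1) n(1) c by (intro divide_left_mono) simp_all
    qed (use c in simp)
    moreover have "0 \<le> c / of_nat m" using c by simp
    ultimately show ?thesis using m(2) by blast
  qed
  then show ?thesis unfolding Q_def by simp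
qed

lemma max_span_nonneg: "0 \<le> max_span"
  and AE_Z: "AE \<omega> in M. X 1 \<omega> \<in> Z" "AE \<omega> in M. X' 1 \<omega> \<in> Z"
proof -
  obtain d where d: "0 \<le> d"
      "(AE \<omega> in M. X 1 \<omega> \<in> lattice_set d) \<and> (AE \<omega> in M. X' 1 \<omega> \<in> lattice_set d)"
      "\<And>u. 0 \<le> u \<and> (AE \<omega> in M. X 1 \<omega> \<in> lattice_set u) \<and> (AE \<omega> in M. X' 1 \<omega> \<in> lattice_set u) \<Longrightarrow> u \<le> d"
    using max_span_exists by blast
  have "max_span = d"
    unfolding max_span_def AE_lattice_iff by (rule Greatest_equality) (use d in blast)+
  with d show "0 \<le> max_span" "AE \<omega> in M. X 1 \<omega> \<in> Z" "AE \<omega> in M. X' 1 \<omega> \<in> Z"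
    by (simp_all add: Z_def)
qed

lemma Z_0 [simp]: "0 \<in> Z"
  unfolding Z_def lattice_set_def by (auto intro!: image_eqI[of _ _ 0])

lemma Z_add: "x \<in> Z \<Longrightarrow> y \<in> Z \<Longrightarrow> x + y \<in> Z"
  unfolding Z_def lattice_set_def
  by (auto simp: distrib_left[symmetric] of_int_add[symmetric] simp del: of_int_add)

lemma space_borel_Z [simp]: "space borel_Z = Z"
  by (simp add: borel_Z_def space_restrict_space)

lemma prob_space_restrict_Z:
  assumes "prob_space N" "sets N = sets borel" "emeasure N Z = 1"
  shows "prob_space (restrict_space N Z)"
  using assms sets_eq_imp_space_eq[OF assms(2)]
  by (intro prob_spaceI) (auto simp: space_restrict_space emeasure_restrict_space)

lemma sets_jump [simp]: "sets (jump x) = sets borel"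
  by (simp add: jump_def)

lemma emeasure_distr_Z:
  assumes "x \<in> Z"
  shows "emeasure (distr M borel (\<lambda>\<omega>. x + X 1 \<omega>)) Z = 1"
    "emeasure (distr M borel (\<lambda>\<omega>. x + X' 1 \<omega>)) Z = 1"
proof -
  have "AE \<omega> in M. x + X 1 \<omega> \<in> Z"
    using AE_Z(1) by eventually_elim (rule Z_add[OF assms])
  moreover have "AE \<omega> in M. x + X' 1 \<omega> \<in> Z"
    using AE_Z(2) by eventually_elim (rule Z_add[OF assms])
  ultimately show "emeasure (distr M borel (\<lambda>\<omega>. x + X 1 \<omega>)) Z = 1"
    "emeasure (distr M borel (\<lambda>\<omega>. x + X' 1 \<omega>)) Z = 1"
    by (auto simp: emeasure_distr vimage_def Int_def conj_commute intro!: emeasure_eq_1_AE)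
qed

lemma emeasure_mix:
  assumes "emeasure N A = 1" "emeasure N' A = 1" "sets N' = sets N" "A \<in> sets N"
  shows "emeasure (plus_measure (scale_measure (ennreal \<alpha>) N) (scale_measure (ennreal (1 - \<alpha>)) N')) A = 1"
proof -
  have "ennreal \<alpha> + ennreal (1 - \<alpha>) = ennreal (\<alpha> + (1 - \<alpha>))"
    using alpha by (intro ennreal_plus[symmetric]) simp_all
  then show ?thesis
    using assms by (subst emeasure_plus_measure) simp_all
qed

lemma prob_space_jump: "prob_space (jump x)"
proof -
  interpret N: prob_space "distr M borel (X 1)" by (intro prob_space_distr) simp
  interpret N': prob_space "distr M borel (X' 1)" by (intro prob_space_distr) simp
  have "prob_space (plus_measure (scale_measure (ennreal \<alpha>) (distr M borel (X 1)))
             (scale_measure (ennreal (1 - \<alpha>)) (distr M borel (X' 1))))"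
    using N.emeasure_space_1 N'.emeasure_space_1
    by (intro prob_spaceI) (simp add: emeasure_mix space_scale_measure)
  then show ?thesis
    unfolding jump_def by (auto intro!: prob_space_distr)
qed

lemma prob_space_kernel: "x \<in> Z \<Longrightarrow> prob_space (kernel x)"
  unfolding kernel_def
proof (intro prob_space_restrict_Z prob_space_jump sets_jump)
  assume "x \<in> Z"
  then show "emeasure (jump x) Z = 1"
    using emeasure_distr_Z[of x] emeasure_distr_Z[of 0] by (auto simp: jump_def emeasure_mix)
qed

lemma measurable_jump: "jump \<in> borel \<rightarrow>\<^sub>M subprob_algebra borel"
proof -
  have M: "M \<in> space (subprob_algebra M)"
    by (simp add: space_subprob_algebra prob_space_imp_subprob_space prob_space_axioms)
  have [measurable]: "(\<lambda>x. distr M borel (\<lambda>\<omega>. x + X 1 \<omega>)) \<in> borel \<rightarrow>\<^sub>M subprob_algebra borel"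
    "(\<lambda>x. distr M borel (\<lambda>\<omega>. x + X' 1 \<omega>)) \<in> borel \<rightarrow>\<^sub>M subprob_algebra borel"
    by (rule measurable_distr2[where M = M]; simp add: M)+
  have [measurable]: "jump 0 \<in> space (subprob_algebra borel)"
    by (simp add: space_subprob_algebra prob_space_imp_subprob_space prob_space_jump)
  have "(\<lambda>x. if 0 < x then distr M borel (\<lambda>\<omega>. x + X 1 \<omega>)
      else if x < 0 then distr M borel (\<lambda>\<omega>. x + X' 1 \<omega>) else jump 0) \<in> borel \<rightarrow>\<^sub>M subprob_algebra borel"
    by measurable
  also have "(\<lambda>x. if 0 < x then distr M borel (\<lambda>\<omega>. x + X 1 \<omega>)
      else if x < 0 then distr M borel (\<lambda>\<omega>. x + X' 1 \<omega>) else jump 0) = jump"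
    by (auto simp: jump_def fun_eq_iff)
  finally show ?thesis .
qed

lemma measurable_kernel [measurable]: "kernel \<in> borel_Z \<rightarrow>\<^sub>M subprob_algebra borel_Z"
proof -
  have "Z \<noteq> {}"
    using Z_0 by blast
  then have "(\<lambda>x. restrict_space (jump x) Z) \<in> borel \<rightarrow>\<^sub>M subprob_algebra (restrict_space borel Z)"
    by (rule restrict_space_measurable[OF _ Z_borel measurable_jump])
  then have "kernel \<in> borel \<rightarrow>\<^sub>M subprob_algebra borel_Z"
    by (simp add: kernel_def[abs_def] borel_Z_def)
  then show ?thesis
    by (simp add: borel_Z_def measurable_restrict_space1)
qed

lemma Ionescu_Tulcea_step_kernel:
  assumes "x \<in> Z"
  shows "Ionescu_Tulcea (step_kernel x) (\<lambda>_. borel_Z)"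
proof (rule Ionescu_Tulcea.intro)
  fix i :: nat
  show "step_kernel x i \<in> (\<Pi>\<^sub>M i\<in>{0..<i}. borel_Z) \<rightarrow>\<^sub>M subprob_algebra borel_Z"
  proof (cases i)
    case 0
    have "return borel_Z x \<in> space (subprob_algebra borel_Z)"
      using assms by (simp add: space_subprob_algebra prob_space_imp_subprob_space prob_space_return)
    then show ?thesis by (simp add: step_kernel_def[abs_def] 0)
  next
    case (Suc m)
    have "(\<lambda>y. y m) \<in> (\<Pi>\<^sub>M i\<in>{0..<i}. borel_Z) \<rightarrow>\<^sub>M borel_Z"
      by (intro measurable_component_singleton) (simp add: Suc)
    then have "(\<lambda>y. kernel (y m)) \<in> (\<Pi>\<^sub>M i\<in>{0..<i}. borel_Z) \<rightarrow>\<^sub>M subprob_algebra borel_Z"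
      by (rule measurable_compose[OF _ measurable_kernel])
    then show ?thesis by (simp add: step_kernel_def[abs_def] Suc)
  qed
next
  fix i :: nat and y :: "nat \<Rightarrow> real"
  assume "y \<in> space (\<Pi>\<^sub>M i\<in>{0..<i}. borel_Z)"
  with assms show "prob_space (step_kernel x i y)"
    by (cases i) (auto simp: step_kernel_def prob_space_return space_PiM PiE_iff intro: prob_space_kernel)
qed

end

end

theory Submission
  imports Defs
begin

text \<open>Let \<open>D\<close> and \<open>A'\<close> be the ladder heights. The chain that moves from \<open>x > 0\<close> by \<open>D\<close> and from \<open>x < 0\<close> by \<open>A'\<close>
  records the positions of \<open>Y\<close> at the ladder times of its excursions; it leaves \<open>\<nu>\<close> invariant, and \<open>\<mu>\<close> is the occupation
  measure of the excursions that start from \<open>\<nu>\<close>, hence invariant for \<open>Y\<close>. For a shift-invariant event \<open>B\<close> the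
  function \<open>h x = P\<^sub>x(Y \<in> B)\<close> is bounded and harmonic, and as the chain is conservative, \<open>h\<close> does not change along almost
  all of its steps. So \<open>h\<close> is invariant under the moves of the ladder chain. For fixed values of \<open>D\<close> and \<open>A'\<close> these
  moves form a rotation of an interval of length \<open>A' - D\<close>, which makes \<open>h\<close> periodic; the periods generate the lattice
  or a dense subgroup, so that \<open>h\<close> is constant. Then \<open>B\<close> is independent of all cylinders and has probability 0 or 1.\<close>

section \<open>Renewal measures of walks killed on leaving a half-line\<close>

text \<open>The hypotheses on \<open>S\<close> and \<open>S'\<close> make the weak ladder heights
  \<open>D\<close> and \<open>A'\<close> proper; the strict ones on the other side may be defective,
  and no moments are available. Identities between possibly infinite measures are therefore written
  as equalities of sums in \<open>ennreal\<close>, and a term is cancelled only after the test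
  function has been cut down so that this term is finite. Two facts about walks carry the argument.
  Duality identifies the renewal measure \<open>U_+\<close> with the Green measure of the walk
  killed on leaving the positive half-line, which makes \<open>\<mu>\<close> an occupation measure.
  The Wiener-Hopf factorization shows that a group containing almost all values of \<open>D\<close>
  contains almost all values of \<open>X_1\<close>, so that the ladder heights have the same span as
  the steps. Recurrence is used only for bounded open pieces of \<open>Z\<close>, which have finite
  \<open>\<mu>\<close>-measure. The delicate points are the origin and the atoms: the constant
  \<open>a\<close> makes the ties balance, and the rotation acts on \<open>[-s, r)\<close> or on
  \<open>(-s, r]\<close> according to which walk leaves the origin. The case
  \<open>\<alpha> = 0\<close> is reduced to the first form by reflection.\<close>

lemma nn_integral_convolution_sigma_finite:
  fixes M N :: "real measure"
  assumes N: "sigma_finite_measure N"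
    and [measurable_cong]: "sets N = sets borel" "sets M = sets borel"
    and [measurable]: "f \<in> borel_measurable borel"
  shows "(\<integral>\<^sup>+x. f x \<partial>(M \<star> N)) = (\<integral>\<^sup>+x. \<integral>\<^sup>+y. f (x + y) \<partial>N \<partial>M)"
proof -
  interpret N: sigma_finite_measure N by fact
  have "(\<integral>\<^sup>+x. f x \<partial>(M \<star> N)) = (\<integral>\<^sup>+x. f (fst x + snd x) \<partial>(M \<Otimes>\<^sub>M N))"
    unfolding convolution_def by (subst nn_integral_distr) (auto simp: case_prod_beta)
  then show ?thesis
    by (subst (asm) N.nn_integral_fst[symmetric]) auto
qed

lemma nn_integral_plus_measure:
  assumes "sets N = sets M" and "f \<in> borel_measurable M"
  shows "(\<integral>\<^sup>+x. f x \<partial>plus_measure M N) = (\<integral>\<^sup>+x. f x \<partial>M) + (\<integral>\<^sup>+x. f x \<partial>N)"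
  using assms(2)
proof induct
  case (cong f g)
  then have "AE x in N. f x = g x" "AE x in plus_measure M N. f x = g x"
    using sets_eq_imp_space_eq[OF assms(1)] by auto
  then have "integral\<^sup>N N f = integral\<^sup>N N g"
    "integral\<^sup>N (plus_measure M N) f = integral\<^sup>N (plus_measure M N) g"
    by (auto intro!: nn_integral_cong_AE)
  moreover have "integral\<^sup>N M f = integral\<^sup>N M g"
    using cong(3) by (rule nn_integral_cong)
  ultimately show ?case using cong(4) by simp
next
  case (set A)
  then show ?case using assms(1) by (simp add: emeasure_plus_measure)
next
  case (mult u c)
  moreover have "u \<in> borel_measurable N" "u \<in> borel_measurable (plus_measure M N)"
    using mult assms(1) by (auto cong: measurable_cong_sets)
  ultimately show ?case by (simp add: nn_integral_cmult distrib_left)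
next
  case (add u v)
  moreover have "u \<in> borel_measurable N" "u \<in> borel_measurable (plus_measure M N)"
    "v \<in> borel_measurable N" "v \<in> borel_measurable (plus_measure M N)"
    using add assms(1) by (auto cong: measurable_cong_sets)
  ultimately show ?case by (simp add: nn_integral_add ac_simps)
next
  case (seq U)
  have 1: "U i \<in> borel_measurable N" "U i \<in> borel_measurable (plus_measure M N)" for i
    using seq assms(1) by (auto cong: measurable_cong_sets)
  have inc: "incseq (\<lambda>i. integral\<^sup>N M (U i))" "incseq (\<lambda>i. integral\<^sup>N N (U i))"
    using seq by (auto simp: incseq_def le_fun_def intro!: nn_integral_mono)
  have eq: "(\<Squnion>range U) = (\<lambda>x. SUP i. U i x)" by (auto simp: fun_eq_iff image_comp)
  show ?case
    unfolding eq using seq 1 inc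
    by (simp add: nn_integral_monotone_convergence_SUP ennreal_SUP_add)
qed

lemma nn_integral_series_measure:
  assumes s: "\<And>n. sets (F n) = sets N" and "f \<in> borel_measurable N"
  shows "(\<integral>\<^sup>+x. f x \<partial>series_measure F) = (\<Sum>n. \<integral>\<^sup>+x. f x \<partial>F n)"
  using assms(2)
proof induct
  case (cong f g)
  have "AE x in F n. f x = g x" for n
    using cong(3) sets_eq_imp_space_eq[OF s] by auto
  moreover have "AE x in series_measure F. f x = g x"
    using cong(3) sets_eq_imp_space_eq[OF s] by auto
  ultimately have "integral\<^sup>N (F n) f = integral\<^sup>N (F n) g"
    "integral\<^sup>N (series_measure F) f = integral\<^sup>N (series_measure F) g" for n
    by (auto intro!: nn_integral_cong_AE)
  then show ?case using cong(4) by simp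
next
  case (set A)
  then show ?case using s by (simp add: emeasure_series_measure[where N=N])
next
  case (mult u c)
  moreover have "u \<in> borel_measurable (F n)" "u \<in> borel_measurable (series_measure F)" for n
    using mult s by (auto cong: measurable_cong_sets)
  ultimately show ?case by (simp add: nn_integral_cmult)
next
  case (add u v)
  moreover have "u \<in> borel_measurable (F n)" "u \<in> borel_measurable (series_measure F)"
    "v \<in> borel_measurable (F n)" "v \<in> borel_measurable (series_measure F)" for n
    using add s by (auto cong: measurable_cong_sets)
  ultimately show ?case by (simp add: nn_integral_add suminf_add)
next
  case (seq U)
  have m: "U i \<in> borel_measurable (F n)" "U i \<in> borel_measurable (series_measure F)" for i n
    using seq s by (auto cong: measurable_cong_sets)
  have eq: "(\<Squnion>range U) = (\<lambda>x. SUP i. U i x)" by (auto simp: fun_eq_iff image_comp)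
  have "(\<Sum>n. SUP i. integral\<^sup>N (F n) (U i)) = (SUP i. \<Sum>n. integral\<^sup>N (F n) (U i))"
    by (intro ennreal_suminf_SUP_eq incseq_SucI nn_integral_mono)
       (use seq in \<open>auto simp: incseq_def le_fun_def\<close>)
  then show ?case
    unfolding eq using seq m
    by (simp add: nn_integral_monotone_convergence_SUP)
qed

section \<open>The walk with step law \<open>F\<close>, killed on leaving a set\<close>

locale step_law = prob_space F for F :: "real measure" +
  assumes sets_F [measurable_cong, simp]: "sets F = sets borel"
begin

lemma space_F [simp]: "space F = UNIV"
  using sets_eq_imp_space_eq[OF sets_F] by simp

text \<open>The law of \<open>S_k\<close> on the event that \<open>S_1, ..., S_k\<close> lie in
  \<open>C\<close>. The start at 0 is not tested, so that \<open>C\<close> may be an open half-line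
  with endpoint 0.\<close>

primrec stay :: "real set \<Rightarrow> nat \<Rightarrow> real measure" where
  "stay C 0 = return borel 0"
| "stay C (Suc k) = density (stay C k \<star> F) (indicator C)"

declare stay.simps(2) [simp del]

text \<open>The law of the walk at its first exit from \<open>C\<close>, on the event that this exit
  takes place at time \<open>Suc k\<close>; the index counts the steps spent in \<open>C\<close>
  before.\<close>

definition exit_law :: "real set \<Rightarrow> nat \<Rightarrow> real measure" where
  "exit_law C k = density (stay C k \<star> F) (indicator (- C))"

lemma sets_stay [measurable_cong, simp]: "sets (stay C k) = sets borel"
  by (cases k) (auto simp: stay.simps(2))

lemma sets_exit_law [measurable_cong, simp]: "sets (exit_law C k) = sets borel"
  by (auto simp: exit_law_def)

lemma space_stay [simp]: "space (stay C k) = UNIV" and space_exit_law [simp]: "space (exit_law C k) = UNIV"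
  using sets_eq_imp_space_eq[OF sets_stay] sets_eq_imp_space_eq[OF sets_exit_law] by auto

lemma nn_integral_convolution_F:
  assumes [measurable_cong]: "sets M = sets borel" and [measurable]: "f \<in> borel_measurable borel"
  shows "(\<integral>\<^sup>+x. f x \<partial>(M \<star> F)) = (\<integral>\<^sup>+x. \<integral>\<^sup>+y. f (x + y) \<partial>F \<partial>M)"
  using assms by (intro nn_integral_convolution_sigma_finite sigma_finite_measure_axioms sets_F)

lemma nn_integral_stay_0 [simp]:
  assumes [measurable]: "f \<in> borel_measurable borel"
  shows "(\<integral>\<^sup>+x. f x \<partial>stay C 0) = f 0"
  by (simp add: nn_integral_return)

lemma nn_integral_stay_Suc:
  assumes [measurable]: "f \<in> borel_measurable borel" "C \<in> sets borel"
  shows "(\<integral>\<^sup>+x. f x \<partial>stay C (Suc k)) = (\<integral>\<^sup>+x. \<integral>\<^sup>+y. f (x + y) * indicator C (x + y) \<partial>F \<partial>stay C k)"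
  by (simp add: stay.simps(2) nn_integral_density nn_integral_convolution_F mult.commute)

lemma nn_integral_exit_law:
  assumes [measurable]: "f \<in> borel_measurable borel" "C \<in> sets borel"
  shows "(\<integral>\<^sup>+x. f x \<partial>exit_law C k) = (\<integral>\<^sup>+x. \<integral>\<^sup>+y. f (x + y) * indicator (-C) (x + y) \<partial>F \<partial>stay C k)"
  unfolding exit_law_def
  by (simp add: nn_integral_density nn_integral_convolution_F mult.commute)

lemma nn_integral_stay_step:
  assumes [measurable]: "f \<in> borel_measurable borel" "C \<in> sets borel"
  shows "(\<integral>\<^sup>+x. \<integral>\<^sup>+y. f (x + y) \<partial>F \<partial>stay C k) = (\<integral>\<^sup>+x. f x \<partial>stay C (Suc k)) + (\<integral>\<^sup>+x. f x \<partial>exit_law C k)"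
proof -
  have "(\<integral>\<^sup>+x. \<integral>\<^sup>+y. f (x + y) \<partial>F \<partial>stay C k) =
     (\<integral>\<^sup>+x. (\<integral>\<^sup>+y. f (x + y) * indicator C (x + y) \<partial>F) + (\<integral>\<^sup>+y. f (x + y) * indicator (-C) (x + y) \<partial>F) \<partial>stay C k)"
    by (intro nn_integral_cong, subst nn_integral_add[symmetric])
      (auto intro!: nn_integral_cong split: split_indicator)
  then show ?thesis
    by (simp add: nn_integral_stay_Suc nn_integral_exit_law nn_integral_add del: stay.simps(1))
qed

lemma AE_stay_Suc: "C \<in> sets borel \<Longrightarrow> AE x in stay C (Suc k). x \<in> C"
  by (subst stay.simps(2), subst AE_density) (auto split: split_indicator)

lemma AE_exit_law: "C \<in> sets borel \<Longrightarrow> AE x in exit_law C k. x \<notin> C"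
  unfolding exit_law_def by (subst AE_density) (auto split: split_indicator)

lemma emeasure_stay_le: "C \<in> sets borel \<Longrightarrow> emeasure (stay C k) UNIV \<le> 1"
proof (induction k)
  case (Suc k)
  have "emeasure (stay C (Suc k)) UNIV = (\<integral>\<^sup>+x. 1 \<partial>stay C (Suc k))" by simp
  also have "\<dots> \<le> (\<integral>\<^sup>+x. \<integral>\<^sup>+y. 1 \<partial>F \<partial>stay C k)"
    using Suc.prems by (subst nn_integral_stay_Suc) (simp, simp, intro nn_integral_mono, simp split: split_indicator)
  also have "\<dots> \<le> 1" using Suc emeasure_space_1 by simp
  finally show ?case .
qed simp

lemma finite_measure_stay: "C \<in> sets borel \<Longrightarrow> finite_measure (stay C k)"
  by (intro finite_measureI) (use emeasure_stay_le[of C k] in \<open>auto simp: top_unique\<close>)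

lemma emeasure_stay_exit:
  assumes "C \<in> sets borel"
  shows "emeasure (stay C (Suc k)) UNIV + emeasure (exit_law C k) UNIV = emeasure (stay C k) UNIV"
  using nn_integral_stay_step[of "\<lambda>_. 1" C k] assms emeasure_space_1
  by (simp del: stay.simps(1))

lemma emeasure_exit_le: "C \<in> sets borel \<Longrightarrow> emeasure (exit_law C k) UNIV \<le> 1"
proof -
  assume C: "C \<in> sets borel"
  have "emeasure (exit_law C k) UNIV \<le> emeasure (stay C k) UNIV"
    unfolding emeasure_stay_exit[OF C, of k, symmetric] by (rule add_increasing) simp_all
  then show ?thesis
    using emeasure_stay_le[OF C, of k] by (rule order_trans)
qed

lemma finite_measure_exit: "C \<in> sets borel \<Longrightarrow> finite_measure (exit_law C k)"
  by (intro finite_measureI) (use emeasure_exit_le[of C k] in \<open>auto simp: top_unique\<close>)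

end

section \<open>Duality and the renewal equation\<close>

text \<open>The finite inequality is kept apart from the limit because the comparison of occupation
  and renewal measure works with partial sums.\<close>

lemma sum_triangle_le:
  fixes c :: "nat \<Rightarrow> nat \<Rightarrow> ennreal"
  shows "(\<Sum>k<n. \<Sum>j\<le>k. c j (k - j)) \<le> (\<Sum>j<n. \<Sum>i. c j i)"
proof -
  have "(\<Sum>k<n. \<Sum>j\<le>k. c j (k - j)) = (\<Sum>(i,j)\<in>{(i,j). i+j < n}. c i j)"
    by (rule sum.triangle_reindex[symmetric])
  also have "\<dots> \<le> (\<Sum>(i,j)\<in>{..<n}\<times>{..<n}. c i j)"
    by (rule sum_mono2) auto
  also have "\<dots> = (\<Sum>j<n. \<Sum>i<n. c j i)"
    by (simp add: sum.cartesian_product)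
  also have "\<dots> \<le> (\<Sum>j<n. \<Sum>i. c j i)"
    by (intro sum_mono sum_le_suminf) auto
  finally show ?thesis .
qed

lemma suminf_triangle:
  fixes c :: "nat \<Rightarrow> nat \<Rightarrow> ennreal"
  shows "(\<Sum>k. \<Sum>j\<le>k. c j (k - j)) = (\<Sum>j. \<Sum>i. c j i)"
proof (rule antisym)
  show "(\<Sum>k. \<Sum>j\<le>k. c j (k - j)) \<le> (\<Sum>j. \<Sum>i. c j i)"
    by (intro suminf_le_const summableI order_trans[OF sum_triangle_le] sum_le_suminf) auto
  show "(\<Sum>j. \<Sum>i. c j i) \<le> (\<Sum>k. \<Sum>j\<le>k. c j (k - j))"
  proof (intro suminf_le_const summableI)
    fix n
    have "(\<Sum>j<n. \<Sum>i. c j i) = (\<Sum>i. \<Sum>j<n. c j i)"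
      by (rule suminf_sum[symmetric]) auto
    also have "\<dots> \<le> (\<Sum>k. \<Sum>j\<le>k. c j (k - j))"
    proof (intro suminf_le_const summableI)
      fix m
      have "(\<Sum>i<m. \<Sum>j<n. c j i) = (\<Sum>j<n. \<Sum>i<m. c j i)"
        by (rule sum.swap)
      also have "\<dots> = (\<Sum>(i,j)\<in>{..<n}\<times>{..<m}. c i j)"
        by (simp add: sum.cartesian_product)
      also have "\<dots> \<le> (\<Sum>(i,j)\<in>{(i,j). i+j < n+m}. c i j)"
        by (rule sum_mono2) (auto intro!: finite_subset[of "{(i,j). i+j < n+m}" "{..<n+m}\<times>{..<n+m}"])
      also have "\<dots> = (\<Sum>k<n+m. \<Sum>j\<le>k. c j (k - j))"
        by (rule sum.triangle_reindex)
      also have "\<dots> \<le> (\<Sum>k. \<Sum>j\<le>k. c j (k - j))"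
        by (intro sum_le_suminf) auto
      finally show "(\<Sum>i<m. \<Sum>j<n. c j i) \<le> (\<Sum>k. \<Sum>j\<le>k. c j (k - j))" .
    qed
    finally show "(\<Sum>j<n. \<Sum>i. c j i) \<le> (\<Sum>k. \<Sum>j\<le>k. c j (k - j))" .
  qed
qed

lemma nn_integral_swap_add:
  fixes A B :: "real measure" and f :: "real \<Rightarrow> ennreal"
  assumes A: "finite_measure A" and B: "finite_measure B"
    and [measurable_cong]: "sets A = sets borel" "sets B = sets borel"
    and [measurable]: "f \<in> borel_measurable borel"
  shows "(\<integral>\<^sup>+x. \<integral>\<^sup>+y. f (x + y) \<partial>B \<partial>A) = (\<integral>\<^sup>+y. \<integral>\<^sup>+x. f (x + y) \<partial>A \<partial>B)"
proof -
  interpret A: finite_measure A by fact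
  interpret B: finite_measure B by fact
  interpret pair_sigma_finite A B ..
  show ?thesis
    by (rule Fubini'[symmetric]) measurable
qed

text \<open>Duality uses of a half-line only that \<open>C\<close> and its complement are closed
  under addition and that 0 lies in the complement. Stated in this form it serves
  \<open>{0<..}\<close> for \<open>S\<close> and \<open>{..<0}\<close> for \<open>S'\<close> at
  once; ladder heights into \<open>C\<close> are then strict and those into \<open>- C\<close>
  weak.\<close>

locale half_line_step = step_law +
  fixes C :: "real set"
  assumes C_borel [measurable]: "C \<in> sets borel"
    and zero_notin_C: "0 \<notin> C"
    and add_C: "x \<in> C \<Longrightarrow> y \<in> C \<Longrightarrow> x + y \<in> C"
    and add_Compl_C: "x \<notin> C \<Longrightarrow> y \<notin> C \<Longrightarrow> x + y \<notin> C"
begin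

lemma Compl_C_borel [measurable]: "- C \<in> sets borel"
  using C_borel by (rule borel_comp)

lemmas finite_stay [simp] = finite_measure_stay[OF C_borel] finite_measure_stay[OF Compl_C_borel]
  and finite_exit [simp] = finite_measure_exit[OF C_borel] finite_measure_exit[OF Compl_C_borel]

lemma measurable_nn_integral_stay [measurable]:
  assumes [measurable]: "(\<lambda>(x, y). f x y) \<in> borel_measurable (N \<Otimes>\<^sub>M borel)"
  shows "(\<lambda>x. \<integral>\<^sup>+y. f x y \<partial>stay C k) \<in> borel_measurable N"
    "(\<lambda>x. \<integral>\<^sup>+y. f x y \<partial>stay (-C) k) \<in> borel_measurable N"
    "(\<lambda>x. \<integral>\<^sup>+y. f x y \<partial>exit_law C k) \<in> borel_measurable N"
    "(\<lambda>x. \<integral>\<^sup>+y. f x y \<partial>exit_law (-C) k) \<in> borel_measurable N"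
proof -
  interpret finite_measure "stay C k" by simp
  show "(\<lambda>x. \<integral>\<^sup>+y. f x y \<partial>stay C k) \<in> borel_measurable N" by measurable
next
  interpret finite_measure "stay (-C) k" by simp
  show "(\<lambda>x. \<integral>\<^sup>+y. f x y \<partial>stay (-C) k) \<in> borel_measurable N" by measurable
next
  interpret finite_measure "exit_law C k" by simp
  show "(\<lambda>x. \<integral>\<^sup>+y. f x y \<partial>exit_law C k) \<in> borel_measurable N" by measurable
next
  interpret finite_measure "exit_law (-C) k" by simp
  show "(\<lambda>x. \<integral>\<^sup>+y. f x y \<partial>exit_law (-C) k) \<in> borel_measurable N" by measurable
qed

lemma AE_stay: "AE x in stay C k. x = 0 \<or> x \<in> C"
proof (cases k)
  case 0
  show ?thesis unfolding 0 stay.simps(1) by (subst AE_return) auto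
next
  case (Suc n)
  show ?thesis
    unfolding Suc using AE_stay_Suc[OF C_borel, of n] by eventually_elim simp
qed

lemma AE_stay_Compl: "AE x in stay (-C) k. x \<notin> C"
proof (cases k)
  case 0
  show ?thesis unfolding 0 stay.simps(1) using zero_notin_C by (subst AE_return) auto
next
  case (Suc n)
  show ?thesis
    unfolding Suc using AE_stay_Suc[OF Compl_C_borel, of n] by eventually_elim simp
qed

lemma AE_exit_Compl: "AE x in exit_law (-C) k. x \<in> C"
  using AE_exit_law[OF Compl_C_borel] by simp

text \<open>Both sides integrate \<open>f (x + z + y)\<close> with \<open>x\<close> from
  \<open>stay C j\<close>, one free step \<open>z\<close> from \<open>F\<close>, and
  \<open>y\<close> from \<open>stay (-C) i\<close>. Appending \<open>z\<close> to the first walk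
  gives the left side, appending it to the second one the right side.\<close>

lemma pairing_step:
  assumes [measurable]: "f \<in> borel_measurable borel"
  shows "(\<integral>\<^sup>+x. \<integral>\<^sup>+y. f (x + y) \<partial>stay (-C) i \<partial>stay C (Suc j)) + (\<integral>\<^sup>+x. \<integral>\<^sup>+y. f (x + y) \<partial>stay (-C) i \<partial>exit_law C j) =
     (\<integral>\<^sup>+x. \<integral>\<^sup>+y. f (x + y) \<partial>stay (-C) (Suc i) \<partial>stay C j) + (\<integral>\<^sup>+x. \<integral>\<^sup>+y. f (x + y) \<partial>exit_law (-C) i \<partial>stay C j)"
    (is "?L = ?R")
proof -
  have "?L = (\<integral>\<^sup>+x. \<integral>\<^sup>+z. \<integral>\<^sup>+y. f (x + z + y) \<partial>stay (-C) i \<partial>F \<partial>stay C j)"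
    by (rule nn_integral_stay_step[symmetric]) measurable
  also have "\<dots> = (\<integral>\<^sup>+x. \<integral>\<^sup>+y. \<integral>\<^sup>+z. f (x + (y + z)) \<partial>F \<partial>stay (-C) i \<partial>stay C j)"
  proof (rule nn_integral_cong)
    fix x
    show "(\<integral>\<^sup>+z. \<integral>\<^sup>+y. f (x + z + y) \<partial>stay (-C) i \<partial>F) = (\<integral>\<^sup>+y. \<integral>\<^sup>+z. f (x + (y + z)) \<partial>F \<partial>stay (-C) i)"
      using nn_integral_swap_add[of F "stay (-C) i" "\<lambda>u. f (x + u)"] finite_measure_axioms
      by (simp add: ac_simps del: stay.simps(1))
  qed
  also have "\<dots> = (\<integral>\<^sup>+x. (\<integral>\<^sup>+y. f (x + y) \<partial>stay (-C) (Suc i)) + (\<integral>\<^sup>+y. f (x + y) \<partial>exit_law (-C) i) \<partial>stay C j)"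
    by (intro nn_integral_cong nn_integral_stay_step Compl_C_borel) measurable
  also have "\<dots> = ?R"
    by (rule nn_integral_add) measurable
  finally show ?thesis .
qed

text \<open>Duality of the walk and its time reversal, obtained without reversing paths: the sum of
  \<open>pairing_step\<close> over \<open>j + i = k\<close> telescopes. In terms of paths, reversal
  turns staying in \<open>C\<close> until time \<open>Suc k\<close> into the event that
  \<open>Suc k\<close> is a strict ladder epoch, and \<open>j\<close> is the ladder epoch before
  it.\<close>

lemma nn_integral_stay_renewal:
  assumes [measurable]: "f \<in> borel_measurable borel" and le1: "\<And>x. f x \<le> 1"
  shows "(\<integral>\<^sup>+x. f x \<partial>stay C (Suc k)) = (\<Sum>j\<le>k. \<integral>\<^sup>+x. \<integral>\<^sup>+y. f (x + y) \<partial>exit_law (-C) (k - j) \<partial>stay C j)"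
proof -
  \<comment> \<open>Cutting \<open>f\<close> down to \<open>C\<close> kills the terms in which an
    exit from \<open>C\<close> is followed by a walk in \<open>- C\<close>, since the complement of
    \<open>C\<close> is closed under addition.\<close>
  define g where "g x = f x * indicator C x" for x
  have [measurable]: "g \<in> borel_measurable borel" unfolding g_def by measurable
  define a where "a j i = (\<integral>\<^sup>+x. \<integral>\<^sup>+y. g (x + y) \<partial>stay (-C) i \<partial>stay C j)" for i j
  define b where "b j i = (\<integral>\<^sup>+x. \<integral>\<^sup>+y. g (x + y) \<partial>stay (-C) i \<partial>exit_law C j)" for i j
  define c where "c j i = (\<integral>\<^sup>+x. \<integral>\<^sup>+y. g (x + y) \<partial>exit_law (-C) i \<partial>stay C j)" for i j
  have step: "a (Suc j) i + b j i = a j (Suc i) + c j i" for i j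
    unfolding a_def b_def c_def by (rule pairing_step) (rule \<open>g \<in> _\<close>)
  have b0: "b j i = 0" for i j
  proof -
    have "b j i = (\<integral>\<^sup>+x. 0 \<partial>exit_law C j)"
      unfolding b_def
    proof (rule nn_integral_cong_AE)
      show "AE x in exit_law C j. (\<integral>\<^sup>+ y. g (x + y) \<partial>stay (- C) i) = 0"
        using AE_exit_law[OF C_borel, of j]
      proof eventually_elim
        fix x assume "x \<notin> C"
        have "(\<integral>\<^sup>+ y. g (x + y) \<partial>stay (- C) i) = (\<integral>\<^sup>+ y. 0 \<partial>stay (- C) i)"
          using AE_stay_Compl[of i]
          by (intro nn_integral_cong_AE, eventually_elim) (use \<open>x \<notin> C\<close> add_Compl_C in \<open>auto simp: g_def\<close>)
        then show "(\<integral>\<^sup>+ y. g (x + y) \<partial>stay (- C) i) = 0" by simp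
      qed
    qed
    then show ?thesis by simp
  qed
  have a0: "a 0 (Suc i) = 0" for i
  proof -
    have "a 0 (Suc i) = (\<integral>\<^sup>+ y. g y \<partial>stay (- C) (Suc i))"
      unfolding a_def using nn_integral_stay_0[of "\<lambda>x. \<integral>\<^sup>+ y. g (x + y) \<partial>stay (- C) (Suc i)" C]
      by simp
    also have "\<dots> = (\<integral>\<^sup>+ y. 0 \<partial>stay (- C) (Suc i))"
      using AE_stay_Compl[of "Suc i"]
      by (intro nn_integral_cong_AE, eventually_elim) (auto simp: g_def)
    finally show ?thesis by simp
  qed
  have afin: "a j i < \<infinity>" for i j
  proof -
    have "a j i \<le> (\<integral>\<^sup>+x. \<integral>\<^sup>+y. 1 \<partial>stay (-C) i \<partial>stay C j)"
      unfolding a_def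
      by (intro nn_integral_mono) (auto simp: g_def le1 split: split_indicator)
    also have "\<dots> = emeasure (stay (-C) i) UNIV * emeasure (stay C j) UNIV" by simp
    also have "\<dots> \<le> 1 * 1" by (intro mult_mono emeasure_stay_le) auto
    finally show ?thesis by (rule order_le_less_trans) simp
  qed
  \<comment> \<open>After the index shift \<open>S\<close> occurs on both sides; the bound
    \<open>f \<le> 1\<close> makes it finite, so that it can be cancelled.\<close>
  define S where "S = (\<Sum>j<k. a (Suc j) (k - j))"
  have "(\<Sum>j\<le>k. a (Suc j) (k - j)) = (\<Sum>j\<le>k. a (Suc j) (k - j) + b j (k - j))"
    by (simp add: b0)
  also have "\<dots> = (\<Sum>j\<le>k. a j (Suc (k - j))) + (\<Sum>j\<le>k. c j (k - j))"
    by (simp add: step sum.distrib)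
  also have "(\<Sum>j\<le>k. a j (Suc (k - j))) = S"
  proof (cases k)
    case 0 then show ?thesis by (simp add: a0 S_def)
  next
    case (Suc m)
    have "(\<Sum>j\<le>k. a j (Suc (k - j))) = (\<Sum>j\<le>m. a (Suc j) (Suc (m - j)))"
      unfolding Suc by (subst sum.atMost_Suc_shift) (simp add: a0)
    also have "\<dots> = (\<Sum>j<k. a (Suc j) (k - j))"
      unfolding Suc lessThan_Suc_atMost by (intro sum.cong refl) (simp add: Suc_diff_le)
    finally show ?thesis by (simp add: S_def)
  qed
  also have "(\<Sum>j\<le>k. a (Suc j) (k - j)) = S + a (Suc k) 0"
    unfolding S_def lessThan_Suc_atMost[symmetric] by simp
  finally have "S + a (Suc k) 0 = S + (\<Sum>j\<le>k. c j (k - j))" .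
  moreover have "S \<noteq> \<infinity>"
    unfolding S_def using afin by (simp add: less_top)
  ultimately have main: "a (Suc k) 0 = (\<Sum>j\<le>k. c j (k - j))"
    by simp
  have "a (Suc k) 0 = (\<integral>\<^sup>+x. g x \<partial>stay C (Suc k))"
    unfolding a_def by (intro nn_integral_cong, subst nn_integral_stay_0) auto
  also have "\<dots> = (\<integral>\<^sup>+x. f x \<partial>stay C (Suc k))"
    using AE_stay_Suc[OF C_borel, of k] by (intro nn_integral_cong_AE, eventually_elim) (simp add: g_def)
  finally have A: "a (Suc k) 0 = (\<integral>\<^sup>+x. f x \<partial>stay C (Suc k))" .
  have "c j i = (\<integral>\<^sup>+x. \<integral>\<^sup>+y. f (x + y) \<partial>exit_law (-C) i \<partial>stay C j)" for j i
    unfolding c_def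
  proof (rule nn_integral_cong_AE)
    show "AE x in stay C j. (\<integral>\<^sup>+ y. g (x + y) \<partial>exit_law (- C) i) = (\<integral>\<^sup>+ y. f (x + y) \<partial>exit_law (- C) i)"
      using AE_stay[of j]
    proof eventually_elim
      fix x assume x: "x = 0 \<or> x \<in> C"
      show "(\<integral>\<^sup>+ y. g (x + y) \<partial>exit_law (- C) i) = (\<integral>\<^sup>+ y. f (x + y) \<partial>exit_law (- C) i)"
        using AE_exit_Compl[of i]
        by (intro nn_integral_cong_AE, eventually_elim) (use x add_C in \<open>auto simp: g_def\<close>)
    qed
  qed
  with main A show ?thesis by simp
qed

text \<open>The law of the strict ladder height on the side of \<open>C\<close>, possibly
  defective.\<close>

definition entry_law :: "real measure" where
  "entry_law = series_measure (exit_law (-C))"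

text \<open>The law of the weak ladder height on the side opposite to \<open>C\<close>: the first
  exit from \<open>C\<close> is the first visit to \<open>- C\<close> at a positive time.\<close>

definition leave_law :: "real measure" where
  "leave_law = series_measure (exit_law C)"

text \<open>The Green measure of the killed walk started at 0.\<close>

definition occupation :: "real measure" where
  "occupation = series_measure (stay C)"

lemma sets_laws [measurable_cong, simp]:
  "sets entry_law = sets borel" "sets leave_law = sets borel" "sets occupation = sets borel"
  by (simp_all add: entry_law_def leave_law_def occupation_def)

lemma space_laws [simp]:
  "space entry_law = UNIV" "space leave_law = UNIV" "space occupation = UNIV"
  using sets_laws[THEN sets_eq_imp_space_eq] by simp_all

lemma nn_integral_laws:
  assumes [measurable]: "f \<in> borel_measurable borel"
  shows "(\<integral>\<^sup>+x. f x \<partial>entry_law) = (\<Sum>k. \<integral>\<^sup>+x. f x \<partial>exit_law (-C) k)"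
    "(\<integral>\<^sup>+x. f x \<partial>leave_law) = (\<Sum>k. \<integral>\<^sup>+x. f x \<partial>exit_law C k)"
    "(\<integral>\<^sup>+x. f x \<partial>occupation) = (\<Sum>k. \<integral>\<^sup>+x. f x \<partial>stay C k)"
  unfolding entry_law_def leave_law_def occupation_def
  by (rule nn_integral_series_measure[where N=borel], simp, fact)+

lemma suminf_exit_le:
  assumes "B \<in> sets borel"
  shows "(\<Sum>k. emeasure (exit_law B k) UNIV) \<le> 1"
proof (intro suminf_le_const summableI)
  fix n
  have "emeasure (stay B n) UNIV + (\<Sum>k<n. emeasure (exit_law B k) UNIV) = 1"
  proof (induction n)
    case (Suc n)
    have "emeasure (stay B (Suc n)) UNIV + (\<Sum>k<Suc n. emeasure (exit_law B k) UNIV) =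
      (emeasure (stay B (Suc n)) UNIV + emeasure (exit_law B n) UNIV) + (\<Sum>k<n. emeasure (exit_law B k) UNIV)"
      by (simp add: ac_simps del: stay.simps(1))
    then show ?case
      unfolding emeasure_stay_exit[OF assms, of n] using Suc by simp
  qed simp
  then show "(\<Sum>k<n. emeasure (exit_law B k) UNIV) \<le> 1"
    by (metis add_increasing order_refl zero_le)
qed

lemma emeasure_entry_le: "emeasure entry_law UNIV \<le> 1"
  and emeasure_leave_le: "emeasure leave_law UNIV \<le> 1"
  using nn_integral_laws(1)[of "\<lambda>_. 1"] nn_integral_laws(2)[of "\<lambda>_. 1"]
    suminf_exit_le[OF C_borel] suminf_exit_le[OF Compl_C_borel] by simp_all

lemma finite_measure_laws [simp]: "finite_measure entry_law" "finite_measure leave_law"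
  by (rule finite_measureI, use emeasure_entry_le emeasure_leave_le in \<open>force simp: top_unique\<close>)+

lemma AE_series_measure:
  assumes "\<And>n. sets (G n) = sets borel" "\<And>n. AE x in G n. P x" and [measurable]: "Measurable.pred borel P"
  shows "AE x in series_measure G. P (x::real)"
proof -
  have "emeasure (series_measure G) {x. \<not> P x} = (\<Sum>n. emeasure (G n) {x. \<not> P x})"
    by (rule emeasure_series_measure[where N=borel]) (auto simp: assms(1))
  also have "\<dots> = (\<Sum>n. 0)"
    using assms(2) sets_eq_imp_space_eq[OF assms(1)]
    by (intro suminf_cong) (subst (asm) AE_iff_measurable[OF _ refl], auto simp: assms(1))
  finally have "emeasure (series_measure G) {x. \<not> P x} = 0" by simp
  then show ?thesis
    by (intro AE_I[of _ _ "{x. \<not> P x}"]) (auto simp: assms(1))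
qed

lemma AE_entry_law: "AE x in entry_law. x \<in> C"
  unfolding entry_law_def by (rule AE_series_measure[OF _ AE_exit_Compl]) simp_all

lemma AE_leave_law: "AE x in leave_law. x \<notin> C"
  unfolding leave_law_def by (rule AE_series_measure[OF _ AE_exit_law[OF C_borel]]) simp_all

lemma AE_occupation: "AE x in occupation. x = 0 \<or> x \<in> C"
  unfolding occupation_def by (rule AE_series_measure[OF _ AE_stay]) simp_all

lemma measurable_nn_integral_laws [measurable]:
  assumes [measurable]: "(\<lambda>(x, y). f x y) \<in> borel_measurable (N \<Otimes>\<^sub>M borel)"
  shows "(\<lambda>x. \<integral>\<^sup>+y. f x y \<partial>entry_law) \<in> borel_measurable N"
    "(\<lambda>x. \<integral>\<^sup>+y. f x y \<partial>leave_law) \<in> borel_measurable N"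
proof -
  interpret finite_measure entry_law by simp
  show "(\<lambda>x. \<integral>\<^sup>+y. f x y \<partial>entry_law) \<in> borel_measurable N" by measurable
next
  interpret finite_measure leave_law by simp
  show "(\<lambda>x. \<integral>\<^sup>+y. f x y \<partial>leave_law) \<in> borel_measurable N" by measurable
qed

text \<open>Mass balance: every visit makes one step, which ends at a further visit or at the exit,
  and the start is the only visit that is not reached by a step.\<close>

lemma occupation_step:
  assumes [measurable]: "f \<in> borel_measurable borel"
  shows "(\<integral>\<^sup>+x. \<integral>\<^sup>+y. f (x + y) \<partial>F \<partial>occupation) + f 0 = (\<integral>\<^sup>+x. f x \<partial>occupation) + (\<integral>\<^sup>+x. f x \<partial>leave_law)"
proof -
  have "(\<integral>\<^sup>+x. \<integral>\<^sup>+y. f (x + y) \<partial>F \<partial>occupation) = (\<Sum>k. \<integral>\<^sup>+x. f x \<partial>stay C (Suc k)) + (\<integral>\<^sup>+x. f x \<partial>leave_law)"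
    by (simp add: nn_integral_laws nn_integral_stay_step suminf_add[symmetric] del: stay.simps(1))
  moreover have "(\<integral>\<^sup>+x. f x \<partial>occupation) = (\<Sum>k. \<integral>\<^sup>+x. f x \<partial>stay C (Suc k)) + f 0"
    unfolding nn_integral_laws(3)[OF assms]
    by (subst suminf_offset[where i=1]) (simp_all del: stay.simps(1))
  ultimately show ?thesis by (simp add: ac_simps)
qed

lemma nn_integral_stay_entry:
  assumes [measurable]: "f \<in> borel_measurable borel"
  shows "(\<integral>\<^sup>+x. \<integral>\<^sup>+y. f (x + y) \<partial>entry_law \<partial>stay C j) = (\<Sum>i. \<integral>\<^sup>+x. \<integral>\<^sup>+y. f (x + y) \<partial>exit_law (-C) i \<partial>stay C j)"
  by (simp add: nn_integral_laws nn_integral_suminf del: stay.simps(1))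

lemma occupation_renewal:
  assumes [measurable]: "f \<in> borel_measurable borel" and le1: "\<And>x. f x \<le> 1"
  shows "(\<integral>\<^sup>+x. f x \<partial>occupation) = f 0 + (\<integral>\<^sup>+x. \<integral>\<^sup>+y. f (x + y) \<partial>entry_law \<partial>occupation)"
proof -
  have "(\<integral>\<^sup>+x. f x \<partial>occupation) = f 0 + (\<Sum>k. \<integral>\<^sup>+x. f x \<partial>stay C (Suc k))"
    unfolding nn_integral_laws(3)[OF assms(1)]
    by (subst suminf_offset[where i=1]) (simp_all add: add.commute del: stay.simps(1))
  then show ?thesis
    by (simp add: nn_integral_stay_renewal le1 suminf_triangle[where c="\<lambda>j i. \<integral>\<^sup>+x. \<integral>\<^sup>+y. f (x + y) \<partial>exit_law (-C) i \<partial>stay C j"]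
       nn_integral_laws(3) nn_integral_stay_entry)
qed

lemma occupation_partial_le:
  assumes [measurable]: "f \<in> borel_measurable borel" and le1: "\<And>x. f x \<le> 1"
  shows "(\<Sum>k<Suc n. \<integral>\<^sup>+x. f x \<partial>stay C k) \<le> f 0 + (\<Sum>j<n. \<integral>\<^sup>+x. \<integral>\<^sup>+y. f (x + y) \<partial>entry_law \<partial>stay C j)"
proof -
  have "(\<Sum>k<Suc n. \<integral>\<^sup>+x. f x \<partial>stay C k) = f 0 + (\<Sum>k<n. \<integral>\<^sup>+x. f x \<partial>stay C (Suc k))"
    by (subst sum.lessThan_Suc_shift) (simp del: stay.simps(1))
  also have "\<dots> \<le> f 0 + (\<Sum>j<n. \<Sum>i. \<integral>\<^sup>+x. \<integral>\<^sup>+y. f (x + y) \<partial>exit_law (-C) i \<partial>stay C j)"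
    using sum_triangle_le[where c="\<lambda>j i. \<integral>\<^sup>+x. \<integral>\<^sup>+y. f (x + y) \<partial>exit_law (-C) i \<partial>stay C j" and n=n]
    by (simp add: nn_integral_stay_renewal le1 del: stay.simps(1))
  finally show ?thesis
    by (simp only: nn_integral_stay_entry[OF assms(1)])
qed

definition entry_power :: "nat \<Rightarrow> real measure" where
  "entry_power n = ((\<lambda>N. entry_law \<star> N) ^^ n) (return borel 0)"

lemma entry_power_props: "sets (entry_power n) = sets borel \<and> finite_measure (entry_power n)"
proof (induction n)
  case 0
  then show ?case
    by (simp add: entry_power_def prob_space_return prob_space.finite_measure)
next
  case (Suc n)
  then show ?case
    by (simp add: entry_power_def convolution_finite)
qed

lemma sets_entry_power [measurable_cong, simp]: "sets (entry_power n) = sets borel"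
  by (rule conjunct1[OF entry_power_props])

lemma nn_integral_entry_power_Suc:
  assumes [measurable]: "f \<in> borel_measurable borel"
  shows "(\<integral>\<^sup>+x. f x \<partial>entry_power (Suc n)) = (\<integral>\<^sup>+x. \<integral>\<^sup>+y. f (x + y) \<partial>entry_law \<partial>entry_power n)"
proof -
  have fin: "finite_measure (entry_power n)" by (rule conjunct2[OF entry_power_props])
  have "(\<integral>\<^sup>+x. f x \<partial>entry_power (Suc n)) = (\<integral>\<^sup>+x. f x \<partial>(entry_law \<star> entry_power n))"
    by (simp add: entry_power_def)
  also have "\<dots> = (\<integral>\<^sup>+x. \<integral>\<^sup>+y. f (x + y) \<partial>entry_power n \<partial>entry_law)"
    by (rule nn_integral_convolution) (simp_all add: fin)
  also have "\<dots> = (\<integral>\<^sup>+y. \<integral>\<^sup>+x. f (y + x) \<partial>entry_law \<partial>entry_power n)"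
    by (subst nn_integral_swap_add) (simp_all add: fin add.commute)
  finally show ?thesis .
qed

lemma nn_integral_renewal:
  assumes [measurable]: "f \<in> borel_measurable borel"
  shows "(\<integral>\<^sup>+x. f x \<partial>renewal_measure entry_law) = (\<Sum>n. \<integral>\<^sup>+x. f x \<partial>entry_power n)"
  unfolding renewal_measure_def entry_power_def[symmetric]
  by (rule nn_integral_series_measure[where N=borel]) simp_all

lemma nn_integral_entry_le1:
  assumes "\<And>x. f x \<le> (1::ennreal)"
  shows "(\<integral>\<^sup>+y. f (x + y) \<partial>entry_law) \<le> 1"
proof -
  have "(\<integral>\<^sup>+y. f (x + y) \<partial>entry_law) \<le> (\<integral>\<^sup>+y. 1 \<partial>entry_law)"
    by (intro nn_integral_mono assms)
  then show ?thesis using emeasure_entry_le by auto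
qed

text \<open>Both measures solve the renewal equation \<open>u = \<delta>_0 + L * u\<close> with the
  entry law \<open>L\<close>, but they may be infinite and cannot be subtracted. Instead the partial
  sums of each are bounded by the other. The induction passes from \<open>f\<close> to its average
  over \<open>L\<close>, hence \<open>f\<close> is arbitrary.\<close>

lemma nn_integral_occupation_eq_renewal:
  assumes [measurable]: "f \<in> borel_measurable borel" and le1: "\<And>x. f x \<le> 1"
  shows "(\<integral>\<^sup>+x. f x \<partial>occupation) = (\<integral>\<^sup>+x. f x \<partial>renewal_measure entry_law)"
proof (rule antisym)
  have "(\<Sum>k<n. \<integral>\<^sup>+x. f x \<partial>stay C k) \<le> (\<integral>\<^sup>+x. f x \<partial>renewal_measure entry_law)" for n
    using assms
  proof (induction n arbitrary: f)
    case (Suc n)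
    note [measurable] = Suc.prems(1)
    have "(\<Sum>k<Suc n. \<integral>\<^sup>+x. f x \<partial>stay C k) \<le> f 0 + (\<Sum>j<n. \<integral>\<^sup>+x. \<integral>\<^sup>+y. f (x + y) \<partial>entry_law \<partial>stay C j)"
      by (rule occupation_partial_le) (use Suc.prems in auto)
    also have "\<dots> \<le> f 0 + (\<integral>\<^sup>+x. \<integral>\<^sup>+y. f (x + y) \<partial>entry_law \<partial>renewal_measure entry_law)"
      by (intro add_left_mono Suc.IH nn_integral_entry_le1 Suc.prems) measurable
    also have "\<dots> = f 0 + (\<Sum>n. \<integral>\<^sup>+x. f x \<partial>entry_power (Suc n))"
      by (subst nn_integral_renewal) (measurable, simp add: nn_integral_entry_power_Suc)
    also have "\<dots> = (\<integral>\<^sup>+x. f x \<partial>renewal_measure entry_law)"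
      by (subst nn_integral_renewal, measurable, subst (2) suminf_offset[where i=1])
         (simp_all add: entry_power_def nn_integral_return add.commute)
    finally show ?case .
  qed simp
  then show "(\<integral>\<^sup>+x. f x \<partial>occupation) \<le> (\<integral>\<^sup>+x. f x \<partial>renewal_measure entry_law)"
    unfolding nn_integral_laws(3)[OF assms(1)] by (intro suminf_le_const summableI)
  have "(\<Sum>k<n. \<integral>\<^sup>+x. f x \<partial>entry_power k) \<le> (\<integral>\<^sup>+x. f x \<partial>occupation)" for n
    using assms
  proof (induction n arbitrary: f)
    case (Suc n)
    note [measurable] = Suc.prems(1)
    have "(\<Sum>k<Suc n. \<integral>\<^sup>+x. f x \<partial>entry_power k) = f 0 + (\<Sum>k<n. \<integral>\<^sup>+x. \<integral>\<^sup>+y. f (x + y) \<partial>entry_law \<partial>entry_power k)"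
      by (subst sum.lessThan_Suc_shift)
        (simp add: nn_integral_entry_power_Suc, simp add: entry_power_def nn_integral_return)
    also have "\<dots> \<le> f 0 + (\<integral>\<^sup>+x. \<integral>\<^sup>+y. f (x + y) \<partial>entry_law \<partial>occupation)"
      by (intro add_left_mono Suc.IH nn_integral_entry_le1 Suc.prems) measurable
    also have "\<dots> = (\<integral>\<^sup>+x. f x \<partial>occupation)"
      by (rule occupation_renewal[symmetric]) (use Suc.prems in auto)
    finally show ?case .
  qed simp
  then show "(\<integral>\<^sup>+x. f x \<partial>renewal_measure entry_law) \<le> (\<integral>\<^sup>+x. f x \<partial>occupation)"
    unfolding nn_integral_renewal[OF assms(1)] by (intro suminf_le_const summableI)
qed

lemma occupation_eq_renewal: "occupation = renewal_measure entry_law"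
proof (rule measure_eqI)
  show s: "sets occupation = sets (renewal_measure entry_law)"
    unfolding renewal_measure_def entry_power_def[symmetric] by simp
  fix A assume A: "A \<in> sets occupation"
  then show "emeasure occupation A = emeasure (renewal_measure entry_law) A"
    using nn_integral_occupation_eq_renewal[of "indicator A"] s by (auto split: split_indicator)
qed

section \<open>Local finiteness and the Wiener-Hopf factorization\<close>

text \<open>The function \<open>exp (- (c * x))\<close> is multiplicative over sums and smaller than
  1 on \<open>C\<close>. Its integral \<open>r\<close> against the entry law is thus smaller than 1
  even if that law has full mass, and its integral against the renewal measure is a geometric series
  in \<open>r\<close>. A Markov bound finishes the proof.\<close>

lemma occupation_locally_finite:
  assumes c: "\<And>x. x \<in> C \<Longrightarrow> 0 < c * x"
  shows "emeasure occupation {x. c * x \<le> b} < \<infinity>"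
proof -
  define \<phi> where "\<phi> x = ennreal (exp (- (c * x)))" for x
  have [measurable]: "\<phi> \<in> borel_measurable borel" unfolding \<phi>_def by measurable
  define r where "r = (\<integral>\<^sup>+x. \<phi> x \<partial>entry_law)"
  have le1: "AE x in entry_law. \<phi> x < 1"
    using AE_entry_law by eventually_elim (use c in \<open>auto simp: \<phi>_def ennreal_less_one_iff\<close>)
  have eq: "r + (\<integral>\<^sup>+x. 1 - \<phi> x \<partial>entry_law) = emeasure entry_law UNIV"
  proof -
    have "r + (\<integral>\<^sup>+x. 1 - \<phi> x \<partial>entry_law) = (\<integral>\<^sup>+x. \<phi> x + (1 - \<phi> x) \<partial>entry_law)"
      unfolding r_def by (rule nn_integral_add[symmetric]) measurable
    also have "\<dots> = (\<integral>\<^sup>+x. 1 \<partial>entry_law)"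
      using le1 by (intro nn_integral_cong_AE, eventually_elim) (simp add: less_imp_le add_diff_inverse_ennreal)
    finally show ?thesis by simp
  qed
  \<comment> \<open>As the entry law has mass at most 1, equality would force
    \<open>\<phi> = 1\<close> almost everywhere, against \<open>\<phi> < 1\<close> on
    \<open>C\<close>.\<close>
  have r: "r < 1"
  proof (rule ccontr)
    assume "\<not> r < 1"
    moreover have "r + (\<integral>\<^sup>+x. 1 - \<phi> x \<partial>entry_law) \<le> 1"
      unfolding eq by (rule emeasure_entry_le)
    moreover have "r \<le> r + (\<integral>\<^sup>+x. 1 - \<phi> x \<partial>entry_law)"
      by (rule add_increasing2) simp_all
    ultimately have r1: "r = 1" by (meson antisym not_le order_trans)
    have "1 + (\<integral>\<^sup>+x. 1 - \<phi> x \<partial>entry_law) \<le> 1 + 0"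
      using \<open>r + _ \<le> 1\<close> unfolding r1 by simp
    then have "(\<integral>\<^sup>+x. 1 - \<phi> x \<partial>entry_law) = 0"
      unfolding ennreal_add_left_cancel_le by simp
    then have "AE x in entry_law. 1 - \<phi> x = 0"
      by (subst (asm) nn_integral_0_iff_AE) measurable
    with le1 have "AE x in entry_law. False"
      by eventually_elim (auto simp: diff_eq_0_iff_ennreal)
    then have "r = (\<integral>\<^sup>+x. 0 \<partial>entry_law)"
      unfolding r_def by (intro nn_integral_cong_AE) auto
    with r1 show False by simp
  qed
  have pow: "(\<integral>\<^sup>+x. \<phi> x \<partial>entry_power n) = r ^ n" for n
  proof (induction n)
    case 0
    then show ?case by (simp add: entry_power_def nn_integral_return \<phi>_def)
  next
    case (Suc n)
    have "\<phi> (x + y) = \<phi> x * \<phi> y" for x y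
      by (simp add: \<phi>_def distrib_left exp_add[symmetric] ennreal_mult[symmetric])
    then have "(\<integral>\<^sup>+x. \<phi> x \<partial>entry_power (Suc n)) = (\<integral>\<^sup>+x. \<integral>\<^sup>+y. \<phi> x * \<phi> y \<partial>entry_law \<partial>entry_power n)"
      by (simp add: nn_integral_entry_power_Suc)
    also have "\<dots> = (\<integral>\<^sup>+x. \<phi> x \<partial>entry_power n) * r"
      by (simp add: nn_integral_cmult nn_integral_multc r_def)
    finally show ?case by (simp add: Suc mult.commute)
  qed
  obtain q where q: "r = ennreal q" "0 \<le> q" using r by (cases r) auto
  have "q < 1" using r q by (simp add: ennreal_less_one_iff)
  then have "(\<Sum>n. r ^ n) = ennreal (\<Sum>n. q ^ n)"
    unfolding q(1) ennreal_power[OF q(2)] using q(2)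
    by (intro suminf_ennreal2 summable_geometric) auto
  then have fin: "(\<integral>\<^sup>+x. \<phi> x \<partial>occupation) < \<infinity>"
    unfolding occupation_eq_renewal by (simp add: nn_integral_renewal pow)
  have "emeasure occupation {x. c * x \<le> b} = (\<integral>\<^sup>+x. indicator {x. c * x \<le> b} x \<partial>occupation)"
    by simp
  also have "\<dots> \<le> (\<integral>\<^sup>+x. ennreal (exp b) * \<phi> x \<partial>occupation)"
    by (intro nn_integral_mono)
      (auto simp: \<phi>_def ennreal_mult[symmetric] exp_add[symmetric] split: split_indicator)
  also have "\<dots> = ennreal (exp b) * (\<integral>\<^sup>+x. \<phi> x \<partial>occupation)"
    by (rule nn_integral_cmult) measurable
  also have "\<dots> < \<infinity>" using fin by (simp add: ennreal_mult_less_top)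
  finally show ?thesis .
qed

text \<open>The Wiener-Hopf factorization \<open>\<delta>\<^sub>0 - F = (\<delta>\<^sub>0 - L) \<star> (\<delta>\<^sub>0 - D)\<close> of entry law \<open>L\<close> and leave law \<open>D\<close>, with
  the negative terms moved to the other side.\<close>

lemma Wiener_Hopf:
  assumes [measurable]: "f \<in> borel_measurable borel" and le1: "\<And>x. f x \<le> 1"
    and fin: "(\<integral>\<^sup>+x. f x \<partial>occupation) < \<infinity>"
  shows "(\<integral>\<^sup>+x. f x \<partial>F) + (\<integral>\<^sup>+x. \<integral>\<^sup>+y. f (x + y) \<partial>entry_law \<partial>leave_law) =
     (\<integral>\<^sup>+x. f x \<partial>entry_law) + (\<integral>\<^sup>+x. f x \<partial>leave_law)"
proof -
  interpret L: finite_measure entry_law by simp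
  let ?G = "\<lambda>f. \<integral>\<^sup>+x. f x \<partial>occupation"
  let ?T = "\<lambda>f x. \<integral>\<^sup>+y. f (x + y) \<partial>F" and ?L = "\<lambda>f x. \<integral>\<^sup>+y. f (x + y) \<partial>entry_law"
  have TL: "?T (?L f) = ?L (?T f)"
    using nn_integral_swap_add[of F entry_law "\<lambda>y. f (x + y)" for x] finite_measure_axioms
    by (auto simp: fun_eq_iff ac_simps)
  have T1: "?T f x \<le> 1" for x
  proof -
    have "?T f x \<le> (\<integral>\<^sup>+y. 1 \<partial>F)" by (intro nn_integral_mono le1)
    then show ?thesis using emeasure_space_1 by simp
  qed
  have 1: "?G (?T f) + f 0 = ?G f + (\<integral>\<^sup>+x. f x \<partial>leave_law)"
    by (rule occupation_step) measurable
  have 2: "?G f = f 0 + ?G (?L f)"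
    by (rule occupation_renewal) (auto simp: le1)
  have 3: "?G (?T (?L f)) + ?L f 0 = ?G (?L f) + (\<integral>\<^sup>+x. ?L f x \<partial>leave_law)"
    by (rule occupation_step) measurable
  have 4: "?G (?T f) = ?T f 0 + ?G (?T (?L f))"
    unfolding TL by (rule occupation_renewal) (measurable, rule T1)
  \<comment> \<open>Combining the four equations leaves a single quantity to be cancelled, the
    integral of \<open>f\<close> against the occupation measure; this is the one assumed to be
    finite.\<close>
  have arith: "g + (l0 + d) = g + (t0 + dl)"
    if "a + f0 = g + d" "g = f0 + gl" "gtl + l0 = gl + dl" "a = t0 + gtl" for a f0 g d gl gtl l0 dl t0 :: ennreal
  proof -
    have "g + (l0 + d) = (a + f0) + l0" by (simp only: that(1) ac_simps)
    also have "\<dots> = (f0 + t0) + (gtl + l0)" by (simp only: that(4) ac_simps)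
    also have "\<dots> = (f0 + gl) + (t0 + dl)" by (simp only: that(3) ac_simps)
    finally show ?thesis by (simp only: that(2))
  qed
  have "?L f 0 + (\<integral>\<^sup>+x. f x \<partial>leave_law) = ?T f 0 + (\<integral>\<^sup>+x. ?L f x \<partial>leave_law)"
    using arith[OF 1 2 3 4] fin unfolding ennreal_add_left_cancel by auto
  then show ?thesis by simp
qed

text \<open>Test the Wiener-Hopf identity on the complement of \<open>H\<close>. The leave law does
  not charge it and, having mass 1 on \<open>H\<close>, shifts the entry law without changing its
  mass outside \<open>H\<close>; what remains is \<open>F (- H) = 0\<close>. For lattices this means
  that the weak ladder height cannot have a coarser span than the steps.\<close>

lemma step_in_subgroup:
  assumes c: "\<And>x. x \<in> C \<Longrightarrow> 0 < c * x"
    and mass: "emeasure leave_law UNIV = 1"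
    and H [measurable]: "H \<in> sets borel"
    and sub: "\<And>x y. x \<in> H \<Longrightarrow> x + y \<in> H \<longleftrightarrow> y \<in> H"
    and D: "AE x in leave_law. x \<in> H"
  shows "AE x in F. x \<in> H"
proof -
  interpret L: finite_measure entry_law by simp
  \<comment> \<open>The truncation at \<open>c * x \<le> n\<close> makes the occupation integral
    finite, as \<open>Wiener_Hopf\<close> requires; monotone convergence then removes it.\<close>
  define f where "f n x = (indicator (- H \<inter> {x. c * x \<le> real n}) x :: ennreal)" for n x
  have [measurable]: "f n \<in> borel_measurable borel" for n unfolding f_def by measurable
  have inc: "incseq (\<lambda>n. f n x)" for x
    by (auto simp: incseq_def f_def split: split_indicator)
  have sup: "(SUP n. f n x) = indicator (-H) x" for x
  proof (rule antisym)
    show "(SUP n. f n x) \<le> indicator (-H) x"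
      by (intro SUP_least) (auto simp: f_def split: split_indicator)
    obtain n where "c * x \<le> real n" using real_arch_simple by blast
    then show "indicator (-H) x \<le> (SUP n. f n x)"
      by (intro SUP_upper2[of n]) (auto simp: f_def split: split_indicator)
  qed
  have fin: "(\<integral>\<^sup>+x. f n x \<partial>occupation) < \<infinity>" for n
  proof -
    have "(\<integral>\<^sup>+x. f n x \<partial>occupation) \<le> (\<integral>\<^sup>+x. indicator {x. c * x \<le> real n} x \<partial>occupation)"
      by (intro nn_integral_mono) (auto simp: f_def split: split_indicator)
    also have "\<dots> = emeasure occupation {x. c * x \<le> real n}" by simp
    also have "\<dots> < \<infinity>" by (rule occupation_locally_finite[OF c])
    finally show ?thesis .
  qed
  have "(\<integral>\<^sup>+x. f n x \<partial>F) + (\<integral>\<^sup>+x. \<integral>\<^sup>+y. f n (x + y) \<partial>entry_law \<partial>leave_law) =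
     (\<integral>\<^sup>+x. f n x \<partial>entry_law) + (\<integral>\<^sup>+x. f n x \<partial>leave_law)" for n
    by (rule Wiener_Hopf[OF _ _ fin]) (auto simp: f_def split: split_indicator)
  moreover have "(\<integral>\<^sup>+x. f n x \<partial>leave_law) = 0" for n
    using D by (subst nn_integral_0_iff_AE) (auto simp: f_def split: split_indicator elim!: eventually_mono)
  ultimately have eq: "(\<integral>\<^sup>+x. f n x \<partial>F) + (\<integral>\<^sup>+x. \<integral>\<^sup>+y. f n (x + y) \<partial>entry_law \<partial>leave_law) = (\<integral>\<^sup>+x. f n x \<partial>entry_law)" for n
    by simp
  have inc2: "incseq (\<lambda>n. \<integral>\<^sup>+y. f n (x + y) \<partial>entry_law)" for x
    using inc by (auto simp: incseq_def intro!: nn_integral_mono)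
  have "(SUP n. (\<integral>\<^sup>+x. f n x \<partial>F) + (\<integral>\<^sup>+x. \<integral>\<^sup>+y. f n (x + y) \<partial>entry_law \<partial>leave_law)) =
     (SUP n. \<integral>\<^sup>+x. f n x \<partial>F) + (SUP n. \<integral>\<^sup>+x. \<integral>\<^sup>+y. f n (x + y) \<partial>entry_law \<partial>leave_law)"
    using inc inc2 by (intro ennreal_SUP_add) (auto simp: incseq_def intro!: nn_integral_mono)
  also have "(SUP n. \<integral>\<^sup>+x. f n x \<partial>F) = emeasure F (-H)"
    by (subst nn_integral_monotone_convergence_SUP[symmetric]) (use inc in \<open>auto simp: sup incseq_def le_fun_def\<close>)
  also have "(SUP n. \<integral>\<^sup>+x. \<integral>\<^sup>+y. f n (x + y) \<partial>entry_law \<partial>leave_law) =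
    (\<integral>\<^sup>+x. (SUP n. \<integral>\<^sup>+y. f n (x + y) \<partial>entry_law) \<partial>leave_law)"
    by (rule nn_integral_monotone_convergence_SUP[symmetric]) (use inc2 in \<open>auto simp: incseq_def le_fun_def\<close>)
  also have "(\<lambda>x. SUP n. \<integral>\<^sup>+y. f n (x + y) \<partial>entry_law) = (\<lambda>x. \<integral>\<^sup>+y. indicator (-H) (x + y) \<partial>entry_law)"
    by (intro ext, subst nn_integral_monotone_convergence_SUP[symmetric])
      (use inc in \<open>auto simp: sup incseq_def le_fun_def\<close>)
  also have "(\<integral>\<^sup>+x. \<integral>\<^sup>+y. indicator (-H) (x + y) \<partial>entry_law \<partial>leave_law) = (\<integral>\<^sup>+x. \<integral>\<^sup>+y. indicator (-H) y \<partial>entry_law \<partial>leave_law)"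
    using D by (intro nn_integral_cong_AE, eventually_elim, intro nn_integral_cong)
      (auto simp: sub split: split_indicator)
  also have "\<dots> = emeasure entry_law (-H)"
    using mass by simp
  also have "(SUP n. (\<integral>\<^sup>+x. f n x \<partial>F) + (\<integral>\<^sup>+x. \<integral>\<^sup>+y. f n (x + y) \<partial>entry_law \<partial>leave_law)) = emeasure entry_law (-H)"
    unfolding eq
    by (subst nn_integral_monotone_convergence_SUP[symmetric]) (use inc in \<open>auto simp: sup incseq_def le_fun_def\<close>)
  finally have "emeasure entry_law (-H) + emeasure F (-H) = emeasure entry_law (-H) + 0"
    by (simp add: add.commute)
  then have "emeasure F (-H) = 0"
    unfolding ennreal_add_left_cancel using L.emeasure_finite[of "-H"] by simp
  then show ?thesis
    by (intro AE_I[of _ _ "-H"]) auto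
qed

end

section \<open>Ladder heights of a random walk\<close>

locale iid_walk = prob_space M for M :: "'a measure" +
  fixes X :: "nat \<Rightarrow> 'a \<Rightarrow> real"
  assumes indep_X: "indep_vars (\<lambda>_. borel) X {1..}"
    and ident_X: "\<And>n. 1 \<le> n \<Longrightarrow> distr M borel (X n) = distr M borel (X 1)"
begin

definition F :: "real measure" where
  "F = distr M borel (X 1)"

lemma rv_X [measurable]: "1 \<le> n \<Longrightarrow> X n \<in> borel_measurable M"
  using indep_X by (auto simp: indep_vars_def)

sublocale F: step_law F
  unfolding F_def by (intro step_law.intro step_law_axioms.intro prob_space_distr rv_X) auto

lemma measurable_walk [measurable]: "walk X k \<in> borel_measurable M"
  unfolding walk_def[abs_def] by (intro borel_measurable_sum rv_X) auto

text \<open>The Markov property at time \<open>k\<close>: the block \<open>X_1, ..., X_k\<close> is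
  independent of the next step, and both the constraint and the current position are functions of
  the block.\<close>

lemma walk_step:
  assumes B [measurable]: "B \<in> sets borel" and g [measurable]: "g \<in> borel_measurable borel"
  shows "(\<integral>\<^sup>+\<omega>. indicator {\<omega>. \<forall>j\<in>{1..k}. walk X j \<omega> \<in> B} \<omega> * g (walk X (Suc k) \<omega>) \<partial>M) =
    (\<integral>\<^sup>+\<omega>. indicator {\<omega>. \<forall>j\<in>{1..k}. walk X j \<omega> \<in> B} \<omega> * (\<integral>\<^sup>+z. g (walk X k \<omega> + z) \<partial>F) \<partial>M)"
proof -
  let ?P = "PiM {1..k} (\<lambda>_. borel :: real measure)"
  define R where "R \<omega> = restrict (\<lambda>i. X i \<omega>) {1..k}" for \<omega>
  define \<Psi> :: "(nat \<Rightarrow> real) \<times> real \<Rightarrow> ennreal" where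
    "\<Psi> = (\<lambda>(\<xi>, z). indicator {\<xi>. \<forall>j\<in>{1..k}. (\<Sum>i=1..j. \<xi> i) \<in> B} \<xi> * g ((\<Sum>i=1..k. \<xi> i) + z))"
  have [measurable]: "R \<in> M \<rightarrow>\<^sub>M ?P"
    unfolding R_def by (intro measurable_restrict rv_X) auto
  have sum_meas [measurable]: "(\<lambda>\<xi>. \<Sum>i=1..j. \<xi> i) \<in> borel_measurable ?P" if "j \<le> k" for j
    using that by (intro borel_measurable_sum measurable_component_singleton) auto
  have [measurable]: "Measurable.pred ?P (\<lambda>\<xi>. \<forall>j\<in>{1..k}. (\<Sum>i=1..j. \<xi> i) \<in> B)"
    by (intro pred_intros_finite) (auto intro!: pred_sets2[OF B] sum_meas)
  have \<Psi>: "\<Psi> \<in> borel_measurable (?P \<Otimes>\<^sub>M borel)"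
    unfolding \<Psi>_def case_prod_beta by measurable
  let ?Q = "PiM {Suc k} (\<lambda>_. borel :: real measure)"
  define R' where "R' \<omega> = restrict (\<lambda>i. X i \<omega>) {Suc k}" for \<omega>
  have [measurable]: "R' \<in> M \<rightarrow>\<^sub>M ?Q"
    unfolding R'_def by (intro measurable_restrict rv_X) auto
  have last [measurable]: "(\<lambda>\<eta>. \<eta> (Suc k)) \<in> borel_measurable ?Q"
    by (intro measurable_component_singleton) simp
  have "indep_var ?P R ?Q R'"
    unfolding R_def R'_def by (intro indep_var_restrict[OF indep_X]) auto
  then have joint: "distr M ?P R \<Otimes>\<^sub>M distr M ?Q R' = distr M (?P \<Otimes>\<^sub>M ?Q) (\<lambda>\<omega>. (R \<omega>, R' \<omega>))"
    by (simp add: indep_var_distribution_eq)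
  interpret R': prob_space "distr M ?Q R'" by (rule prob_space_distr) measurable
  have FX: "distr M borel (X (Suc k)) = F" unfolding F_def by (rule ident_X) simp
  have R'F: "(\<integral>\<^sup>+\<eta>. \<Psi> (\<xi>, \<eta> (Suc k)) \<partial>distr M ?Q R') = (\<integral>\<^sup>+z. \<Psi> (\<xi>, z) \<partial>F)" if [simp]: "\<xi> \<in> space ?P" for \<xi>
  proof -
    have m: "(\<lambda>z. \<Psi> (\<xi>, z)) \<in> borel_measurable borel"
      using \<Psi> by (rule measurable_compose_Pair1[OF that])
    have "(\<integral>\<^sup>+\<eta>. \<Psi> (\<xi>, \<eta> (Suc k)) \<partial>distr M ?Q R') = (\<integral>\<^sup>+\<omega>. \<Psi> (\<xi>, R' \<omega> (Suc k)) \<partial>M)"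
      by (rule nn_integral_distr) (measurable, rule measurable_compose[OF last m])
    also have "\<dots> = (\<integral>\<^sup>+z. \<Psi> (\<xi>, z) \<partial>F)"
      unfolding FX[symmetric] by (subst nn_integral_distr) (use m in \<open>auto simp: R'_def\<close>)
    finally show ?thesis .
  qed
  have m2: "(\<lambda>x. \<Psi> (fst x, snd x (Suc k))) \<in> borel_measurable (?P \<Otimes>\<^sub>M ?Q)"
    by (rule measurable_compose[OF _ \<Psi>]) measurable
  have pair_R: "(\<lambda>\<omega>. (R \<omega>, R' \<omega>)) \<in> M \<rightarrow>\<^sub>M ?P \<Otimes>\<^sub>M ?Q" by measurable
  have m3: "(\<lambda>x. \<Psi> (fst x, snd x (Suc k))) \<in> borel_measurable (distr M ?P R \<Otimes>\<^sub>M distr M ?Q R')"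
    unfolding joint measurable_distr_eq1 by (rule m2)
  have wR: "(\<Sum>i=1..j. R \<omega> i) = walk X j \<omega>" if "j \<le> k" for j \<omega>
    unfolding walk_def R_def using that by (intro sum.cong) auto
  have "(\<integral>\<^sup>+\<omega>. \<Psi> (R \<omega>, X (Suc k) \<omega>) \<partial>M) = (\<integral>\<^sup>+\<omega>. \<Psi> (R \<omega>, R' \<omega> (Suc k)) \<partial>M)"
    by (simp add: R'_def)
  also have "\<dots> = (\<integral>\<^sup>+x. \<Psi> (fst x, snd x (Suc k)) \<partial>(distr M ?P R \<Otimes>\<^sub>M distr M ?Q R'))"
    unfolding joint using nn_integral_distr[OF pair_R m3[unfolded joint]] by simp
  also have "\<dots> = (\<integral>\<^sup>+\<xi>. \<integral>\<^sup>+\<eta>. \<Psi> (\<xi>, \<eta> (Suc k)) \<partial>distr M ?Q R' \<partial>distr M ?P R)"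
    using R'.nn_integral_fst[OF m3] by (simp only: fst_conv snd_conv)
  also have "\<dots> = (\<integral>\<^sup>+\<xi>. \<integral>\<^sup>+z. \<Psi> (\<xi>, z) \<partial>F \<partial>distr M ?P R)"
    by (intro nn_integral_cong R'F) simp
  also have "\<dots> = (\<integral>\<^sup>+\<omega>. \<integral>\<^sup>+z. \<Psi> (R \<omega>, z) \<partial>F \<partial>M)"
  proof (rule nn_integral_distr)
    have "\<Psi> \<in> borel_measurable (?P \<Otimes>\<^sub>M F)"
      using \<Psi> by (simp add: measurable_cong_sets[OF sets_pair_measure_cong[OF refl F.sets_F] refl])
    then show "(\<lambda>\<xi>. \<integral>\<^sup>+z. \<Psi> (\<xi>, z) \<partial>F) \<in> borel_measurable (distr M ?P R)"
      using F.borel_measurable_nn_integral_fst by simp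
  qed measurable
  finally have "(\<integral>\<^sup>+\<omega>. \<Psi> (R \<omega>, X (Suc k) \<omega>) \<partial>M) = (\<integral>\<^sup>+\<omega>. \<integral>\<^sup>+z. \<Psi> (R \<omega>, z) \<partial>F \<partial>M)" .
  moreover have "\<Psi> (R \<omega>, z) = indicator {\<omega>. \<forall>j\<in>{1..k}. walk X j \<omega> \<in> B} \<omega> * g (walk X k \<omega> + z)" for \<omega> z
    unfolding \<Psi>_def by (auto simp: wR[unfolded One_nat_def] split: split_indicator)
  moreover have "walk X k \<omega> + X (Suc k) \<omega> = walk X (Suc k) \<omega>" for \<omega>
    by (simp add: walk_def)
  moreover have "(\<integral>\<^sup>+z. c * g (x + z) \<partial>F) = c * (\<integral>\<^sup>+z. g (x + z) \<partial>F)" for c x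
    by (rule nn_integral_cmult) (simp cong: measurable_cong_sets)
  ultimately show ?thesis
    by simp
qed

lemma nn_integral_walk_stay:
  assumes B [measurable]: "B \<in> sets borel" and "f \<in> borel_measurable borel"
  shows "(\<integral>\<^sup>+\<omega>. indicator {\<omega>. \<forall>j\<in>{1..k}. walk X j \<omega> \<in> B} \<omega> * f (walk X k \<omega>) \<partial>M) = (\<integral>\<^sup>+x. f x \<partial>F.stay B k)"
  using assms(2)
proof (induction k arbitrary: f)
  case 0
  note [measurable] = 0
  show ?case using emeasure_space_1
    by (subst F.nn_integral_stay_0) (auto simp: walk_def)
next
  case (Suc k)
  note [measurable] = Suc.prems
  have "(\<integral>\<^sup>+\<omega>. indicator {\<omega>. \<forall>j\<in>{1..Suc k}. walk X j \<omega> \<in> B} \<omega> * f (walk X (Suc k) \<omega>) \<partial>M) =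
    (\<integral>\<^sup>+\<omega>. indicator {\<omega>. \<forall>j\<in>{1..k}. walk X j \<omega> \<in> B} \<omega> * (f (walk X (Suc k) \<omega>) * indicator B (walk X (Suc k) \<omega>)) \<partial>M)"
    by (intro nn_integral_cong) (auto simp: atLeastAtMostSuc_conv split: split_indicator)
  also have "\<dots> = (\<integral>\<^sup>+x. \<integral>\<^sup>+z. f (x + z) * indicator B (x + z) \<partial>F \<partial>F.stay B k)"
    by (subst walk_step) (measurable, intro Suc.IH, measurable)
  also have "\<dots> = (\<integral>\<^sup>+x. f x \<partial>F.stay B (Suc k))"
    by (rule F.nn_integral_stay_Suc[symmetric]) measurable
  finally show ?case .
qed

text \<open>Split by the time of the first visit to \<open>B\<close>: before it the walk stays in
  \<open>- B\<close>, so the pieces are the exit laws of \<open>- B\<close>. Paths that never visit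
  \<open>B\<close> contribute to neither side, so possible defects agree.\<close>

lemma ladder_law_eq:
  assumes B [measurable]: "B \<in> sets borel"
  shows "ladder_law M X B = series_measure (F.exit_law (- B))"
proof (rule measure_eqI)
  show "sets (ladder_law M X B) = sets (series_measure (F.exit_law (- B)))"
    by (simp add: ladder_law_def)
  fix A assume "A \<in> sets (ladder_law M X B)"
  then have A [measurable]: "A \<in> sets borel" by (simp add: ladder_law_def)
  have nB [measurable]: "- B \<in> sets borel" using B by (rule borel_comp)
  let ?W = "{\<omega> \<in> space M. \<exists>k\<ge>1. walk X k \<omega> \<in> B}"
  define T where "T \<omega> = (LEAST k. 1 \<le> k \<and> walk X k \<omega> \<in> B)" for \<omega>
  have [measurable]: "T \<in> M \<rightarrow>\<^sub>M count_space UNIV" unfolding T_def by measurable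
  have [measurable]: "(\<lambda>\<omega>. walk X (T \<omega>) \<omega>) \<in> borel_measurable M"
    by (rule measurable_compose_countable[of "\<lambda>k \<omega>. walk X k \<omega>"]) measurable
  define E where "E k = {\<omega> \<in> space M. (\<forall>j\<in>{1..k}. walk X j \<omega> \<in> - B) \<and> walk X (Suc k) \<omega> \<in> A \<inter> B}" for k
  have [measurable]: "E k \<in> sets M" for k unfolding E_def by measurable
  have TE: "T \<omega> = Suc k" if "\<omega> \<in> E k" for \<omega> k
    unfolding T_def using that by (intro Least_equality) (auto simp: E_def not_less_eq_eq[symmetric])
  have "emeasure (ladder_law M X B) A = emeasure (restrict_space M ?W) {\<omega> \<in> ?W. walk X (T \<omega>) \<omega> \<in> A}"
    unfolding ladder_law_def T_def[symmetric]
    by (subst emeasure_distr)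
      (auto intro!: measurable_restrict_space1 arg_cong2[where f=emeasure] simp: space_restrict_space)
  also have "\<dots> = emeasure M {\<omega> \<in> ?W. walk X (T \<omega>) \<omega> \<in> A}"
    by (subst emeasure_restrict_space) auto
  also have "{\<omega> \<in> ?W. walk X (T \<omega>) \<omega> \<in> A} = (\<Union>k. E k)"
  proof safe
    fix \<omega> k assume \<omega>: "\<omega> \<in> space M" "walk X (T \<omega>) \<omega> \<in> A" and k: "1 \<le> k" "walk X k \<omega> \<in> B"
    have T: "1 \<le> T \<omega> \<and> walk X (T \<omega>) \<omega> \<in> B"
      unfolding T_def by (rule LeastI[of _ k]) (use k in simp)
    moreover have "walk X j \<omega> \<notin> B" if "1 \<le> j" "j < T \<omega>" for j
      using not_less_Least[OF that(2)[unfolded T_def]] that(1) by auto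
    ultimately show "\<omega> \<in> (\<Union>k. E k)"
      using \<omega> by (intro UN_I[of "T \<omega> - 1"]) (auto simp: E_def)
  next
    fix \<omega> k assume "\<omega> \<in> E k"
    with TE[OF this] show "\<omega> \<in> space M" "\<exists>k\<ge>1. walk X k \<omega> \<in> B" "walk X (T \<omega>) \<omega> \<in> A"
      by (auto simp: E_def intro!: exI[of _ "Suc k"])
  qed
  also have "emeasure M (\<Union>k. E k) = (\<Sum>k. emeasure M (E k))"
  proof (intro suminf_emeasure[symmetric])
    have "E m \<inter> E n = {}" if "m \<noteq> n" for m n
    proof (rule ccontr)
      assume "E m \<inter> E n \<noteq> {}"
      then obtain \<omega> where "\<omega> \<in> E m" "\<omega> \<in> E n" by blast
      then have "Suc m = Suc n" using TE[of \<omega> m] TE[of \<omega> n] by simp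
      with that show False by simp
    qed
    then show "disjoint_family E"
      by (simp add: disjoint_family_on_def)
  qed auto
  also have "\<dots> = (\<Sum>k. emeasure (F.exit_law (- B)  k) A)"
  proof (intro suminf_cong)
    fix k
    have "emeasure M (E k) = (\<integral>\<^sup>+\<omega>. indicator (E k) \<omega> \<partial>M)" by simp
    also have "\<dots> = (\<integral>\<^sup>+\<omega>. indicator {\<omega>. \<forall>j\<in>{1..k}. walk X j \<omega> \<in> -B} \<omega> * indicator (A \<inter> B) (walk X (Suc k) \<omega>) \<partial>M)"
      by (intro nn_integral_cong) (auto simp: E_def split: split_indicator)
    also have "\<dots> = (\<integral>\<^sup>+x. \<integral>\<^sup>+z. indicator (A \<inter> B) (x + z) \<partial>F \<partial>F.stay (-B) k)"
      by (subst walk_step) (measurable, intro nn_integral_walk_stay, measurable)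
    also have "\<dots> = (\<integral>\<^sup>+x. indicator A x \<partial>F.exit_law (- B) k)"
      by (subst F.nn_integral_exit_law) (auto simp: indicator_inter_arith)
    finally show "emeasure M (E k) = emeasure (F.exit_law (- B) k) A" by simp
  qed
  also have "\<dots> = emeasure (series_measure (F.exit_law (- B))) A"
    by (rule emeasure_series_measure[symmetric, where N=borel]) auto
  finally show "emeasure (ladder_law M X B) A = emeasure (series_measure (F.exit_law (- B))) A" .
qed

lemma emeasure_ladder_law_UNIV:
  assumes [measurable]: "B \<in> sets borel" and "AE \<omega> in M. \<exists>k\<ge>1. walk X k \<omega> \<in> B"
  shows "emeasure (ladder_law M X B) UNIV = 1"
proof -
  let ?W = "{\<omega> \<in> space M. \<exists>k\<ge>1. walk X k \<omega> \<in> B}"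
  define T where "T \<omega> = (LEAST k. 1 \<le> k \<and> walk X k \<omega> \<in> B)" for \<omega>
  have [measurable]: "T \<in> M \<rightarrow>\<^sub>M count_space UNIV" unfolding T_def by measurable
  have [measurable]: "(\<lambda>\<omega>. walk X (T \<omega>) \<omega>) \<in> borel_measurable M"
    by (rule measurable_compose_countable[of "\<lambda>k \<omega>. walk X k \<omega>"]) measurable
  have "emeasure (ladder_law M X B) UNIV = emeasure (restrict_space M ?W) ?W"
    unfolding ladder_law_def T_def[symmetric]
    by (subst emeasure_distr)
      (auto intro!: measurable_restrict_space1 arg_cong2[where f=emeasure] simp: space_restrict_space)
  also have "\<dots> = emeasure M ?W" by (subst emeasure_restrict_space) auto
  also have "\<dots> = 1" using assms by (intro emeasure_eq_1_AE) auto
  finally show ?thesis .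
qed

end

section \<open>Markov chains with an invariant measure\<close>

locale markov_kernel =
  fixes N :: "'s measure" and K :: "'s \<Rightarrow> 's measure"
  assumes measurable_K [measurable]: "K \<in> N \<rightarrow>\<^sub>M subprob_algebra N"
    and prob_space_K: "x \<in> space N \<Longrightarrow> prob_space (K x)"
begin

text \<open>The functions \<open>step\<close> and \<open>law\<close> repeat the construction of
  \<open>step_kernel\<close> and \<open>path_law\<close> for an abstract kernel, so that the
  trajectory laws coincide by unfolding.\<close>

definition step :: "'s \<Rightarrow> nat \<Rightarrow> (nat \<Rightarrow> 's) \<Rightarrow> 's measure" where
  "step x n y = (case n of 0 \<Rightarrow> return N x | Suc m \<Rightarrow> K (y m))"

definition law :: "'s \<Rightarrow> (nat \<Rightarrow> 's) measure" where
  "law x = projective_family.lim UNIV (Ionescu_Tulcea.CI (step x) (\<lambda>_. N)) (\<lambda>_. N)"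

abbreviation trajectories :: "(nat \<Rightarrow> 's) measure" where
  "trajectories \<equiv> (\<Pi>\<^sub>M n\<in>UNIV. N)"

lemma sets_K [measurable_cong, simp]: "x \<in> space N \<Longrightarrow> sets (K x) = sets N"
  by (rule sets_kernel[OF measurable_K])

lemma space_K [simp]: "x \<in> space N \<Longrightarrow> space (K x) = space N"
  using sets_eq_imp_space_eq[OF sets_K] .

lemma Ionescu_Tulcea_step: "x \<in> space N \<Longrightarrow> Ionescu_Tulcea (step x) (\<lambda>_. N)"
proof (rule Ionescu_Tulcea.intro)
  fix i :: nat
  assume x: "x \<in> space N"
  show "step x i \<in> (\<Pi>\<^sub>M i\<in>{0..<i}. N) \<rightarrow>\<^sub>M subprob_algebra N"
  proof (cases i)
    case 0
    have "return N x \<in> space (subprob_algebra N)"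
      using x by (simp add: space_subprob_algebra prob_space_imp_subprob_space prob_space_return)
    then show ?thesis by (simp add: step_def[abs_def] 0)
  next
    case (Suc m)
    have "(\<lambda>y. y m) \<in> (\<Pi>\<^sub>M i\<in>{0..<i}. N) \<rightarrow>\<^sub>M N"
      by (intro measurable_component_singleton) (simp add: Suc)
    then have "(\<lambda>y. K (y m)) \<in> (\<Pi>\<^sub>M i\<in>{0..<i}. N) \<rightarrow>\<^sub>M subprob_algebra N"
      by (rule measurable_compose[OF _ measurable_K])
    then show ?thesis by (simp add: step_def[abs_def] Suc)
  qed
next
  fix i :: nat and y :: "nat \<Rightarrow> 's"
  assume "x \<in> space N" "y \<in> space (\<Pi>\<^sub>M i\<in>{0..<i}. N)"
  then show "prob_space (step x i y)"
    by (cases i) (auto simp: step_def prob_space_return space_PiM PiE_iff intro: prob_space_K)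
qed

section \<open>Finite-dimensional distributions and the Markov property\<close>

text \<open>For the chain \<open>Y\<close> started at \<open>x\<close>, this is the expectation of
  \<open>f (Y_n)\<close> on the event \<open>Y_0 \<in> A 0, ..., Y_n \<in> A n\<close>, computed by
  conditioning on the first step.\<close>

primrec cyl :: "nat \<Rightarrow> (nat \<Rightarrow> 's set) \<Rightarrow> ('s \<Rightarrow> ennreal) \<Rightarrow> 's \<Rightarrow> ennreal" where
  "cyl 0 A f x = indicator (A 0) x * f x"
| "cyl (Suc n) A f x = indicator (A 0) x * (\<integral>\<^sup>+y. cyl n (\<lambda>i. A (Suc i)) f y \<partial>K x)"

lemma measurable_cyl [measurable]:
  "(\<And>i. A i \<in> sets N) \<Longrightarrow> f \<in> borel_measurable N \<Longrightarrow> cyl n A f \<in> borel_measurable N"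
proof (induction n arbitrary: A)
  case 0
  then show ?case by (simp cong: measurable_cong)
next
  case (Suc n)
  have [measurable]: "A 0 \<in> sets N" "cyl n (\<lambda>i. A (Suc i)) f \<in> borel_measurable N"
    using Suc by auto
  show ?case by (simp cong: measurable_cong)
qed

text \<open>The Ionescu-Tulcea measure grows at the last coordinate, whereas the Markov property
  peels off the first one; this equation converts one recursion into the other.\<close>

lemma cyl_back:
  assumes "\<And>i. A i \<in> sets N" "f \<in> borel_measurable N" "x \<in> space N"
  shows "cyl (Suc n) A f x = cyl n A (\<lambda>y. \<integral>\<^sup>+z. indicator (A (Suc n)) z * f z \<partial>K y) x"
  using assms
proof (induction n arbitrary: A x)
  case (Suc n)
  have "(\<integral>\<^sup>+y. cyl (Suc n) (\<lambda>i. A (Suc i)) f y \<partial>K x) =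
     (\<integral>\<^sup>+y. cyl n (\<lambda>i. A (Suc i)) (\<lambda>y. \<integral>\<^sup>+z. indicator (A (Suc (Suc n))) z * f z \<partial>K y) y \<partial>K x)"
    by (intro nn_integral_cong, subst Suc.IH) (use Suc.prems in auto)
  then show ?case
    unfolding cyl.simps(2)[of "Suc n" A f x] cyl.simps(2)[of n A _ x] by (simp only:)
qed simp

text \<open>The measure \<open>C 0 (Suc n)\<close> carries the coordinates \<open>0, ..., n\<close>,
  because the initial Dirac mass at \<open>x\<close> already counts as a step.\<close>

lemma nn_integral_C_step:
  assumes x: "x \<in> space N" and A [measurable]: "\<And>i. A i \<in> sets N" and "f \<in> borel_measurable N"
  shows "(\<integral>\<^sup>+y. (\<Prod>i\<le>n. indicator (A i) (y i)) * f (y n) \<partial>Ionescu_Tulcea.C (step x) (\<lambda>_. N) 0 (Suc n) (\<lambda>_. undefined))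
    = cyl n A f x"
  using assms(3)
proof (induction n arbitrary: f)
  interpret IT: Ionescu_Tulcea "step x" "\<lambda>_. N" by (rule Ionescu_Tulcea_step[OF x])
  have und: "(\<lambda>_. undefined) \<in> space (Pi\<^sub>M {0..<0::nat} (\<lambda>_. N))" by (simp add: space_PiM)
  { case 0
    note [measurable] = 0
    have m: "(\<lambda>y. indicator (A 0) (y 0) * f (y 0)) \<in> borel_measurable (Pi\<^sub>M {0..<Suc 0} (\<lambda>_. N))"
      by (rule measurable_compose[OF measurable_component_singleton[of 0], where g="\<lambda>z. indicator (A 0) z * f z"]) auto
    have "IT.C 0 (Suc 0) (\<lambda>_. undefined) = IT.eP 0 (\<lambda>_. undefined)"
      using bind_return[OF IT.measurable_eP und] by simp
    then have "(\<integral>\<^sup>+y. (\<Prod>i\<le>0. indicator (A i) (y i)) * f (y 0) \<partial>IT.C 0 (Suc 0) (\<lambda>_. undefined)) =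
      (\<integral>\<^sup>+y. indicator (A 0) (y 0) * f (y 0) \<partial>IT.eP 0 (\<lambda>_. undefined))"
      by (simp del: IT.C.simps)
    also have "\<dots> = (\<integral>\<^sup>+z. indicator (A 0) z * f z \<partial>step x 0 (\<lambda>_. undefined))"
      by (subst IT.nn_integral_eP[OF und m]) simp
    also have "\<dots> = indicator (A 0) x * f x"
      unfolding step_def using x by (simp add: nn_integral_return)
    finally show ?case by simp }
  { case (Suc n)
    note [measurable] = Suc.prems
    let ?C = "IT.C 0 (Suc n) (\<lambda>_. undefined)"
    have comp: "(\<lambda>y. y i) \<in> Pi\<^sub>M {0..<Suc (Suc n)} (\<lambda>_. N) \<rightarrow>\<^sub>M N" if "i \<le> Suc n" for i
      using that by (intro measurable_component_singleton) auto
    have m: "(\<lambda>y. (\<Prod>i\<le>Suc n. indicator (A i) (y i)) * f (y (Suc n))) \<in> borel_measurable (Pi\<^sub>M {0..<Suc (Suc n)} (\<lambda>_. N))"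
      by (intro borel_measurable_times_ennreal borel_measurable_prod_ennreal measurable_compose[OF comp Suc.prems]
          measurable_compose[OF comp borel_measurable_indicator[OF A]]) auto
    have sp: "space ?C = space (Pi\<^sub>M {0..<Suc n} (\<lambda>_. N))" using IT.space_C[OF und, of "Suc n"] by simp
    have "(\<integral>\<^sup>+y. (\<Prod>i\<le>Suc n. indicator (A i) (y i)) * f (y (Suc n)) \<partial>IT.C 0 (Suc (Suc n)) (\<lambda>_. undefined)) =
      (\<integral>\<^sup>+\<omega>. \<integral>\<^sup>+y. (\<Prod>i\<le>Suc n. indicator (A i) (y i)) * f (y (Suc n)) \<partial>IT.eP (Suc n) \<omega> \<partial>?C)"
      using IT.measurable_eP[of "Suc n"] IT.sets_C[OF und, of "Suc n"]
      by (subst IT.C.simps(2), subst nn_integral_bind[OF m])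
        (simp_all del: IT.C.simps cong: measurable_cong_sets)
    also have "\<dots> = (\<integral>\<^sup>+\<omega>. (\<Prod>i\<le>n. indicator (A i) (\<omega> i)) *
         (\<integral>\<^sup>+z. indicator (A (Suc n)) z * f z \<partial>K (\<omega> n)) \<partial>?C)"
    proof (rule nn_integral_cong)
      fix \<omega> assume "\<omega> \<in> space ?C"
      then have \<omega>: "\<omega> \<in> space (Pi\<^sub>M {0..<Suc n} (\<lambda>_. N))" unfolding sp .
      then have \<omega>n: "\<omega> n \<in> space N" by (auto simp: space_PiM PiE_iff)
      have "(\<integral>\<^sup>+y. (\<Prod>i\<le>Suc n. indicator (A i) (y i)) * f (y (Suc n)) \<partial>IT.eP (Suc n) \<omega>) =
        (\<integral>\<^sup>+z. (\<Prod>i\<le>Suc n. indicator (A i) (fun_upd \<omega> (Suc n) z i)) * f z \<partial>K (\<omega> n))"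
        by (subst IT.nn_integral_eP[OF \<omega> m]) (simp add: step_def)
      also have "\<dots> = (\<integral>\<^sup>+z. (\<Prod>i\<le>n. indicator (A i) (\<omega> i)) * (indicator (A (Suc n)) z * f z) \<partial>K (\<omega> n))"
        by (intro nn_integral_cong) (simp add: mult.assoc)
      also have "\<dots> = (\<Prod>i\<le>n. indicator (A i) (\<omega> i)) * (\<integral>\<^sup>+z. indicator (A (Suc n)) z * f z \<partial>K (\<omega> n))"
        using \<omega>n by (intro nn_integral_cmult) (simp cong: measurable_cong_sets)
      finally show "(\<integral>\<^sup>+y. (\<Prod>i\<le>Suc n. indicator (A i) (y i)) * f (y (Suc n)) \<partial>IT.eP (Suc n) \<omega>) =
         (\<Prod>i\<le>n. indicator (A i) (\<omega> i)) * (\<integral>\<^sup>+z. indicator (A (Suc n)) z * f z \<partial>K (\<omega> n))" .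
    qed
    also have "\<dots> = cyl n A (\<lambda>y. \<integral>\<^sup>+z. indicator (A (Suc n)) z * f z \<partial>K y) x"
      by (rule Suc.IH) measurable
    also have "\<dots> = cyl (Suc n) A f x"
      by (rule cyl_back[symmetric]) (use A x Suc.prems in auto)
    finally show ?case . }
qed

lemma sets_law [measurable_cong]: "x \<in> space N \<Longrightarrow> sets (law x) = sets trajectories"
proof -
  assume "x \<in> space N"
  then interpret IT: Ionescu_Tulcea "step x" "\<lambda>_. N" by (rule Ionescu_Tulcea_step)
  show ?thesis unfolding law_def by (rule IT.PF.sets_lim)
qed

lemma space_law: "x \<in> space N \<Longrightarrow> space (law x) = space trajectories"
  using sets_eq_imp_space_eq[OF sets_law] .

lemma emeasure_law_cylinder:
  assumes x: "x \<in> space N" and A: "\<And>i. A i \<in> sets N"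
  shows "emeasure (law x) {y \<in> space trajectories. \<forall>i\<le>n. y i \<in> A i} = cyl n A (\<lambda>_. 1) x"
proof -
  interpret IT: Ionescu_Tulcea "step x" "\<lambda>_. N" by (rule Ionescu_Tulcea_step[OF x])
  have und: "(\<lambda>_. undefined) \<in> space (Pi\<^sub>M {0..<0::nat} (\<lambda>_. N))" by (simp add: space_PiM)
  let ?J = "{0..<Suc n}" and ?C = "IT.C 0 (Suc n) (\<lambda>_. undefined)"
  have XM: "Pi\<^sub>E ?J A \<in> sets (Pi\<^sub>M ?J (\<lambda>_. N))" by (intro sets_PiM_I_finite) (auto simp: A)
  have "{y \<in> space trajectories. \<forall>i\<le>n. y i \<in> A i} = IT.PF.emb UNIV ?J (Pi\<^sub>E ?J A)"
    by (auto simp: prod_emb_def space_PiM PiE_iff less_Suc_eq_le extensional_def)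
  then have "emeasure (law x) {y \<in> space trajectories. \<forall>i\<le>n. y i \<in> A i} = emeasure (IT.CI ?J) (Pi\<^sub>E ?J A)"
    unfolding law_def using IT.lim[OF _ XM] by simp
  also have "\<dots> = emeasure ?C (Pi\<^sub>E ?J A)"
    using IT.emeasure_CI[OF order_refl XM] sets.sets_into_space[OF XM]
    by (simp add: prod_emb_id space_PiM del: IT.C.simps)
  also have "\<dots> = (\<integral>\<^sup>+y. indicator (Pi\<^sub>E ?J A) y \<partial>?C)"
    using XM IT.sets_C[OF und, of "Suc n"] by (simp del: IT.C.simps)
  also have "\<dots> = (\<integral>\<^sup>+y. (\<Prod>i\<le>n. indicator (A i) (y i)) * 1 \<partial>?C)"
  proof (rule nn_integral_cong)
    fix y assume "y \<in> space ?C"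
    then have "y \<in> space (Pi\<^sub>M ?J (\<lambda>_. N))" using IT.space_C[OF und, of "Suc n"] by (simp del: IT.C.simps)
    then have "y \<in> extensional ?J" by (auto simp: space_PiM PiE_def)
    then have "indicator (Pi\<^sub>E ?J A) y = (if \<forall>i\<le>n. y i \<in> A i then 1 else 0 :: ennreal)"
      by (auto simp: indicator_def PiE_iff less_Suc_eq_le)
    also have "\<dots> = (\<Prod>i\<le>n. indicator (A i) (y i))"
      by (auto simp: indicator_def)
    finally show "indicator (Pi\<^sub>E ?J A) y = (\<Prod>i\<le>n. indicator (A i) (y i)) * (1 :: ennreal)" by simp
  qed
  also have "\<dots> = cyl n A (\<lambda>_. 1) x"
    by (rule nn_integral_C_step[OF x A]) simp
  finally show ?thesis .
qed

lemma prob_space_law: "x \<in> space N \<Longrightarrow> prob_space (law x)"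
proof (rule prob_spaceI)
  assume x: "x \<in> space N"
  have "{y \<in> space trajectories. \<forall>i\<le>0. y i \<in> space N} = space trajectories"
    by (auto simp: space_PiM)
  then show "emeasure (law x) (space (law x)) = 1"
    using emeasure_law_cylinder[OF x, of "\<lambda>_. space N" 0] x prob_space.emeasure_space_1[OF prob_space_K[OF x]]
    by (simp add: space_law)
qed

text \<open>Padding with the whole space turns a cylinder over any finite index set into one over an
  initial segment, the form to which \<open>cyl\<close> applies.\<close>

lemma prod_algebra_cylinder:
  assumes "E \<in> prod_algebra (UNIV :: nat set) (\<lambda>_. N)"
  obtains n A where "\<And>i. A i \<in> sets N" "E = {y \<in> space trajectories. \<forall>i\<le>n. y i \<in> A i}"
proof -
  from assms obtain J X where E: "E = prod_emb UNIV (\<lambda>_. N) J (\<Pi>\<^sub>E j\<in>J. X j)" and J: "finite J"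
    and X: "\<And>i. i \<in> J \<Longrightarrow> X i \<in> sets N" by (rule prod_algebraE) auto
  define A where "A i = (if i \<in> J then X i else space N)" for i
  obtain n where n: "\<And>i. i \<in> J \<Longrightarrow> i \<le> n" using J finite_nat_set_iff_bounded_le by auto
  have "E = {y \<in> space trajectories. \<forall>i\<le>n. y i \<in> A i}"
    unfolding E using n by (auto simp: prod_emb_def space_PiM PiE_iff A_def)
  moreover have "A i \<in> sets N" for i using X by (simp add: A_def)
  ultimately show thesis by (rule that[rotated])
qed

lemma measurable_law [measurable]: "law \<in> N \<rightarrow>\<^sub>M subprob_algebra trajectories"
proof (rule measurable_subprob_algebra_generated[OF sets_PiM Int_stable_prod_algebra prod_algebra_sets_into_space])
  fix x assume x: "x \<in> space N"
  show "subprob_space (law x)"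
    by (rule prob_space_imp_subprob_space[OF prob_space_law[OF x]])
  show "sets (law x) = sets trajectories" by (rule sets_law[OF x])
next
  fix E assume "E \<in> prod_algebra (UNIV :: nat set) (\<lambda>_. N)"
  then obtain n A where A: "\<And>i. A i \<in> sets N" "E = {y \<in> space trajectories. \<forall>i\<le>n. y i \<in> A i}"
    by (rule prod_algebra_cylinder) blast
  have "(\<lambda>x. cyl n A (\<lambda>_. 1) x) \<in> borel_measurable N" using A by (intro measurable_cyl) auto
  then show "(\<lambda>x. emeasure (law x) E) \<in> borel_measurable N"
    using emeasure_law_cylinder[OF _ A(1)] unfolding A(2) by (simp cong: measurable_cong)
next
  have "emeasure (law x) (\<Pi>\<^sub>E i\<in>UNIV. space N) = 1" if "x \<in> space N" for x
    using prob_space.emeasure_space_1[OF prob_space_law[OF that]] space_law[OF that] by (simp add: space_PiM)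
  then show "(\<lambda>x. emeasure (law x) (\<Pi>\<^sub>E i\<in>UNIV. space N)) \<in> borel_measurable N"
    by (simp cong: measurable_cong)
qed

text \<open>Starting from \<open>K x\<close> and putting \<open>x\<close> in front gives a law
  \<open>Q\<close>, which agrees with \<open>law x\<close> on all cylinders and hence
  everywhere.\<close>

lemma law_Markov:
  assumes x: "x \<in> space N" and B: "B \<in> sets trajectories"
  shows "emeasure (law x) B = (\<integral>\<^sup>+z. emeasure (law z) {y \<in> space trajectories. case_nat x y \<in> B} \<partial>K x)"
proof -
  interpret K: prob_space "K x" by (rule prob_space_K[OF x])
  have cons [measurable]: "case_nat x \<in> trajectories \<rightarrow>\<^sub>M trajectories"
  proof (rule measurable_PiM_single')
    fix i show "(\<lambda>y. case_nat x y i) \<in> trajectories \<rightarrow>\<^sub>M N" using x by (cases i) auto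
  qed (use x in \<open>auto simp: space_PiM PiE_iff split: nat.split\<close>)
  have law': "law \<in> K x \<rightarrow>\<^sub>M subprob_algebra trajectories"
    using measurable_law x by (simp cong: measurable_cong_sets)
  define Q where "Q = distr (K x \<bind> law) trajectories (case_nat x)"
  have ne: "space (K x) \<noteq> {}" by (rule K.not_empty)
  have sb: "sets (K x \<bind> law) = sets trajectories"
    using ne by (rule sets_bind_measurable[OF law'])
  have spb: "space (K x \<bind> law) = space trajectories" by (rule sets_eq_imp_space_eq[OF sb])
  have Q: "emeasure Q B = (\<integral>\<^sup>+z. emeasure (law z) {y \<in> space trajectories. case_nat x y \<in> B} \<partial>K x)"
    if B: "B \<in> sets trajectories" for B
  proof -
    have mb: "case_nat x \<in> (K x \<bind> law) \<rightarrow>\<^sub>M trajectories"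
      using cons sb by (simp cong: measurable_cong_sets)
    have S: "case_nat x -` B \<inter> space trajectories = {y \<in> space trajectories. case_nat x y \<in> B}" by auto
    have Sm: "{y \<in> space trajectories. case_nat x y \<in> B} \<in> sets trajectories"
      unfolding S[symmetric] by (rule measurable_sets[OF cons B])
    show ?thesis
      unfolding Q_def emeasure_distr[OF mb B] spb S by (rule emeasure_bind[OF ne law' Sm])
  qed
  have "law x = Q"
  proof (rule measure_eqI_generator_eq[where E="prod_algebra UNIV (\<lambda>_. N)" and A="\<lambda>_. (\<Pi>\<^sub>E i\<in>UNIV. space N)"
      and \<Omega>="(\<Pi>\<^sub>E i\<in>UNIV. space N)", OF Int_stable_prod_algebra prod_algebra_sets_into_space])
    fix E assume "E \<in> prod_algebra (UNIV :: nat set) (\<lambda>_. N)"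
    then obtain n A where A: "\<And>i. A i \<in> sets N" "E = {y \<in> space trajectories. \<forall>i\<le>n. y i \<in> A i}"
      by (rule prod_algebra_cylinder) blast
    \<comment> \<open>One free coordinate is appended so that \<open>cyl\<close> can be unfolded
      once even for \<open>n = 0\<close>.\<close>
    define A' where "A' i = (if i \<le> n then A i else space N)" for i
    have A': "A' i \<in> sets N" for i using A by (simp add: A'_def)
    have E: "E = {y \<in> space trajectories. \<forall>i\<le>Suc n. y i \<in> A' i}"
      unfolding A(2) A'_def by (auto simp: space_PiM PiE_iff)
    have Em: "E \<in> sets trajectories"
      unfolding E using A' by measurable
    have "emeasure (law x) E = cyl (Suc n) A' (\<lambda>_. 1) x"
      unfolding E by (rule emeasure_law_cylinder[OF x A'])
    also have "\<dots> = (\<integral>\<^sup>+z. indicator (A' 0) x * cyl n (\<lambda>i. A' (Suc i)) (\<lambda>_. 1) z \<partial>K x)"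
      using A' x measurable_cyl[of "\<lambda>i. A' (Suc i)" "\<lambda>_. 1" n]
      by (subst nn_integral_cmult) (auto cong: measurable_cong_sets)
    also have "\<dots> = (\<integral>\<^sup>+z. emeasure (law z) {y \<in> space trajectories. case_nat x y \<in> E} \<partial>K x)"
    proof (rule nn_integral_cong)
      fix z assume "z \<in> space (K x)"
      then have z: "z \<in> space N" using x by simp
      have "{y \<in> space trajectories. case_nat x y \<in> E} =
        (if x \<in> A' 0 then {y \<in> space trajectories. \<forall>i\<le>n. y i \<in> A' (Suc i)} else {})"
      proof -
        have "case_nat x y \<in> space trajectories" if "y \<in> space trajectories" for y
          using that x by (auto simp: space_PiM PiE_iff split: nat.split)
        moreover have "(\<forall>i\<le>Suc n. case_nat x y i \<in> A' i) \<longleftrightarrow> x \<in> A' 0 \<and> (\<forall>i\<le>n. y i \<in> A' (Suc i))" for y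
          by (simp add: less_Suc_eq_le[symmetric] All_less_Suc2)
        ultimately show ?thesis unfolding E by auto
      qed
      then show "indicator (A' 0) x * cyl n (\<lambda>i. A' (Suc i)) (\<lambda>_. 1) z =
         emeasure (law z) {y \<in> space trajectories. case_nat x y \<in> E}"
        using emeasure_law_cylinder[OF z, of "\<lambda>i. A' (Suc i)" n] A' by simp
    qed
    also have "\<dots> = emeasure Q E" by (rule Q[OF Em, symmetric])
    finally show "emeasure (law x) E = emeasure Q E" .
  next
    show "sets (law x) = sigma_sets (\<Pi>\<^sub>E i\<in>UNIV. space N) (prod_algebra UNIV (\<lambda>_. N))"
      by (simp add: sets_law[OF x] sets_PiM)
    show "sets Q = sigma_sets (\<Pi>\<^sub>E i\<in>UNIV. space N) (prod_algebra UNIV (\<lambda>_. N))"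
      by (simp add: Q_def sets_PiM)
    show "range (\<lambda>_::nat. (\<Pi>\<^sub>E i\<in>UNIV. space N)) \<subseteq> prod_algebra UNIV (\<lambda>_. N)"
      using prod_algebraI_finite[of UNIV] by (auto intro!: space_in_prod_algebra)
    show "emeasure (law x) (\<Pi>\<^sub>E i\<in>UNIV. space N) \<noteq> \<infinity>"
      using prob_space.emeasure_space_1[OF prob_space_law[OF x]] space_law[OF x] by (simp add: space_PiM)
  qed auto
  then show ?thesis using Q[OF B] by simp
qed

lemma measurable_cons:
  assumes "x \<in> space N"
  shows "case_nat x \<in> trajectories \<rightarrow>\<^sub>M trajectories"
proof (rule measurable_PiM_single')
  fix i show "(\<lambda>y. case_nat x y i) \<in> trajectories \<rightarrow>\<^sub>M N" using assms by (cases i) auto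
qed (use assms in \<open>auto simp: space_PiM PiE_iff split: nat.split\<close>)

lemma cons_in_trajectories:
  "x \<in> space N \<Longrightarrow> y \<in> space trajectories \<Longrightarrow> case_nat x y \<in> space trajectories"
  by (rule measurable_space[OF measurable_cons])

lemma measurable_emeasure_law [measurable]:
  "B \<in> sets trajectories \<Longrightarrow> (\<lambda>x. emeasure (law x) B) \<in> borel_measurable N"
  by (rule measurable_emeasure_kernel[OF measurable_law])

lemma law_start:
  assumes x: "x \<in> space N" and A: "A \<in> sets N" and B: "B \<in> sets trajectories"
  shows "emeasure (law x) {y \<in> B. y 0 \<in> A} = indicator A x * emeasure (law x) B"
proof -
  have [measurable]: "(\<lambda>y. y 0) \<in> trajectories \<rightarrow>\<^sub>M N" by measurable
  have eq: "{y \<in> B. y 0 \<in> A} = B \<inter> ((\<lambda>y. y 0) -` A \<inter> space trajectories)"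
    using sets.sets_into_space[OF B] by auto
  have BA: "{y \<in> B. y 0 \<in> A} \<in> sets trajectories"
    unfolding eq using A B by measurable
  have "{y \<in> space trajectories. case_nat x y \<in> {y \<in> B. y 0 \<in> A}} =
     (if x \<in> A then {y \<in> space trajectories. case_nat x y \<in> B} else {})" by auto
  then show ?thesis
    unfolding law_Markov[OF x BA] law_Markov[OF x B] by simp
qed

lemma law_shift_invariant:
  assumes x: "x \<in> space N" and B: "B \<in> sets trajectories"
    and shift: "B = {y \<in> space trajectories. (\<lambda>n. y (Suc n)) \<in> B}"
  shows "emeasure (law x) B = (\<integral>\<^sup>+z. emeasure (law z) B \<partial>K x)"
proof -
  have "case_nat x y \<in> B \<longleftrightarrow> y \<in> B" if "y \<in> space trajectories" for y
    by (subst shift) (simp add: cons_in_trajectories[OF x that])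
  then have "{y \<in> space trajectories. case_nat x y \<in> B} = B"
    using sets.sets_into_space[OF B] by blast
  then show ?thesis by (subst law_Markov[OF x B]) simp
qed

text \<open>If the probability of a shift-invariant event is constant along an absorbing set, the event is
  independent of every cylinder, hence of itself.\<close>

lemma law_zero_one:
  assumes B: "B \<in> sets trajectories" and shift: "B = {y \<in> space trajectories. (\<lambda>n. y (Suc n)) \<in> B}"
    and S: "S \<subseteq> space N" "\<And>x. x \<in> S \<Longrightarrow> AE y in K x. y \<in> S" "\<And>x. x \<in> S \<Longrightarrow> emeasure (law x) B = c"
    and x: "x \<in> S"
  shows "c = c * c"
proof -
  have xN: "x \<in> space N" using S x by auto
  \<comment> \<open>Induction on the length of the cylinder: the first step stays in
    \<open>S\<close>, where \<open>B\<close> has again probability \<open>c\<close>, and shift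
    invariance lets \<open>B\<close> forget the first coordinate.\<close>
  have cyl_indep: "emeasure (law x) {y \<in> B. \<forall>i\<le>n. y i \<in> A i} = c * cyl n A (\<lambda>_. 1) x"
    if "x \<in> S" "\<And>i. A i \<in> sets N" for n A x
    using that
  proof (induction n arbitrary: x A)
    case 0
    then have x: "x \<in> space N" using S by auto
    have "{y \<in> B. \<forall>i\<le>0. y i \<in> A i} = {y \<in> B. y 0 \<in> A 0}" by auto
    then show ?case using law_start[OF x 0(2) B, of 0] S(3)[OF 0(1)] by (simp add: mult.commute)
  next
    case (Suc n)
    then have x: "x \<in> space N" using S by auto
    let ?E = "{y \<in> B. \<forall>i\<le>Suc n. y i \<in> A i}" and ?E' = "{y \<in> B. \<forall>i\<le>n. y i \<in> A (Suc i)}"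
    have "?E = B \<inter> {y \<in> space trajectories. \<forall>i\<le>Suc n. y i \<in> A i}"
      using sets.sets_into_space[OF B] by auto
    then have E: "?E \<in> sets trajectories"
      using B Suc.prems(2) by simp
    have cons: "case_nat x y \<in> B \<longleftrightarrow> y \<in> B" if "y \<in> space trajectories" for y
      by (subst shift) (simp add: cons_in_trajectories[OF x that])
    have "case_nat x y \<in> ?E \<longleftrightarrow> x \<in> A 0 \<and> y \<in> ?E'" if "y \<in> space trajectories" for y
      using cons[OF that] by (simp add: less_Suc_eq_le[symmetric] All_less_Suc2) blast
    then have "{y \<in> space trajectories. case_nat x y \<in> ?E} = (if x \<in> A 0 then ?E' else {})"
      using sets.sets_into_space[OF B] by auto
    then have "emeasure (law x) ?E = (\<integral>\<^sup>+z. indicator (A 0) x * emeasure (law z) ?E' \<partial>K x)"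
      unfolding law_Markov[OF x E] by (intro nn_integral_cong) simp
    also have "\<dots> = (\<integral>\<^sup>+z. (c * indicator (A 0) x) * cyl n (\<lambda>i. A (Suc i)) (\<lambda>_. 1) z \<partial>K x)"
    proof (rule nn_integral_cong_AE)
      show "AE z in K x. indicator (A 0) x * emeasure (law z) ?E' = (c * indicator (A 0) x) * cyl n (\<lambda>i. A (Suc i)) (\<lambda>_. 1) z"
        using S(2)[OF Suc.prems(1)]
      proof eventually_elim
        fix z assume "z \<in> S"
        then show "indicator (A 0) x * emeasure (law z) ?E' = (c * indicator (A 0) x) * cyl n (\<lambda>i. A (Suc i)) (\<lambda>_. 1) z"
          using Suc.IH[of z "\<lambda>i. A (Suc i)"] Suc.prems(2) by (simp add: ac_simps)
      qed
    qed
    also have "\<dots> = c * cyl (Suc n) A (\<lambda>_. 1) x"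
      using measurable_cyl[of "\<lambda>i. A (Suc i)" "\<lambda>_. 1" n] Suc.prems(2) x
      by (subst nn_integral_cmult) (simp_all add: mult.assoc cong: measurable_cong_sets)
    finally show ?case .
  qed
  have sB: "sets (law x) = sets trajectories" by (rule sets_law[OF xN])
  have Bl: "B \<in> sets (law x)" using B sB by simp
  \<comment> \<open>Independence of the cylinders, written as an equality of measures, may be
    evaluated at \<open>B\<close> itself.\<close>
  have "density (law x) (indicator B) = scale_measure c (law x)"
  proof (rule measure_eqI_generator_eq[where E="prod_algebra UNIV (\<lambda>_. N)" and A="\<lambda>_. (\<Pi>\<^sub>E i\<in>UNIV. space N)"
      and \<Omega>="(\<Pi>\<^sub>E i\<in>UNIV. space N)", OF Int_stable_prod_algebra prod_algebra_sets_into_space])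
    fix E assume "E \<in> prod_algebra (UNIV :: nat set) (\<lambda>_. N)"
    then obtain n A where A: "\<And>i. A i \<in> sets N" "E = {y \<in> space trajectories. \<forall>i\<le>n. y i \<in> A i}"
      by (rule prod_algebra_cylinder) blast
    have E: "E \<in> sets (law x)" unfolding sB A(2) using A(1) by simp
    have "B \<inter> E = {y \<in> B. \<forall>i\<le>n. y i \<in> A i}"
      using sets.sets_into_space[OF B] by (auto simp: A(2))
    then have "emeasure (density (law x) (indicator B)) E = emeasure (law x) {y \<in> B. \<forall>i\<le>n. y i \<in> A i}"
      using emeasure_restricted[OF Bl E] by simp
    also have "\<dots> = c * emeasure (law x) E"
      unfolding A(2) emeasure_law_cylinder[OF xN A(1)] by (rule cyl_indep[OF x A(1)])
    finally show "emeasure (density (law x) (indicator B)) E = emeasure (scale_measure c (law x)) E"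
      by simp
  next
    show "sets (density (law x) (indicator B)) = sigma_sets (\<Pi>\<^sub>E i\<in>UNIV. space N) (prod_algebra UNIV (\<lambda>_. N))"
      "sets (scale_measure c (law x)) = sigma_sets (\<Pi>\<^sub>E i\<in>UNIV. space N) (prod_algebra UNIV (\<lambda>_. N))"
      by (simp_all add: sB sets_PiM)
    show "range (\<lambda>_::nat. (\<Pi>\<^sub>E i\<in>UNIV. space N)) \<subseteq> prod_algebra UNIV (\<lambda>_. N)"
      by (auto intro!: space_in_prod_algebra)
    have sp: "(\<Pi>\<^sub>E i\<in>UNIV. space N) \<in> sets (law x)" unfolding sB by (simp add: space_PiM[symmetric])
    have "emeasure (density (law x) (indicator B)) (\<Pi>\<^sub>E i\<in>UNIV. space N) = emeasure (law x) (B \<inter> (\<Pi>\<^sub>E i\<in>UNIV. space N))"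
      by (rule emeasure_restricted[OF Bl sp])
    also have "\<dots> \<le> 1" by (rule prob_space.measure_le_1[OF prob_space_law[OF xN]])
    finally show "emeasure (density (law x) (indicator B)) (\<Pi>\<^sub>E i\<in>UNIV. space N) \<noteq> \<infinity>"
      by (auto simp: top_unique)
  qed auto
  then have "emeasure (density (law x) (indicator B)) B = emeasure (scale_measure c (law x)) B" by simp
  then have "emeasure (law x) B = c * emeasure (law x) B"
    using emeasure_restricted[OF Bl Bl] by simp
  then show ?thesis using S(3)[OF x] by simp
qed

end

section \<open>Almost sure properties under an invariant measure\<close>

locale invariant_measure = markov_kernel +
  fixes m :: "'a measure"
  assumes sets_m [measurable_cong, simp]: "sets m = sets N"
    and invariant: "B \<in> sets N \<Longrightarrow> (\<integral>\<^sup>+x. emeasure (K x) B \<partial>m) = emeasure m B"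
begin

lemma space_m [simp]: "space m = space N"
  by (rule sets_eq_imp_space_eq[OF sets_m])

lemma nn_integral_invariant:
  assumes f [measurable]: "f \<in> borel_measurable N"
  shows "(\<integral>\<^sup>+x. \<integral>\<^sup>+y. f y \<partial>K x \<partial>m) = (\<integral>\<^sup>+x. f x \<partial>m)"
proof (cases "space N = {}")
  case True
  then show ?thesis by (simp add: nn_integral_empty)
next
  case False
  have K: "K \<in> m \<rightarrow>\<^sub>M subprob_algebra N" by measurable
  have ne: "space m \<noteq> {}" using False by simp
  have "m \<bind> K = m"
  proof (rule measure_eqI)
    show "sets (m \<bind> K) = sets m" using sets_bind_measurable[OF K ne] by simp
    fix A assume "A \<in> sets (m \<bind> K)"
    then have "A \<in> sets N" using sets_bind_measurable[OF K ne] by simp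
    then show "emeasure (m \<bind> K) A = emeasure m A"
      using emeasure_bind[OF ne K] invariant by simp
  qed
  then show ?thesis using nn_integral_bind[OF f K] by simp
qed

lemma AE_invariant:
  assumes "AE x in m. P x"
  shows "AE x in m. AE y in K x. P y"
proof -
  from assms obtain Z where Z: "{x \<in> space m. \<not> P x} \<subseteq> Z" "Z \<in> sets m" "emeasure m Z = 0"
    by (auto elim!: AE_E)
  have ZN [measurable]: "Z \<in> sets N" using Z by simp
  have "(\<integral>\<^sup>+x. emeasure (K x) Z \<partial>m) = 0" using invariant Z by simp
  moreover have "(\<lambda>x. emeasure (K x) Z) \<in> borel_measurable m"
    using measurable_emeasure_kernel[OF measurable_K ZN] by simp
  ultimately have "AE x in m. emeasure (K x) Z = 0"
    by (simp add: nn_integral_0_iff_AE)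
  then show ?thesis
    using AE_space[of m]
  proof eventually_elim
    fix x assume "emeasure (K x) Z = 0" "x \<in> space m"
    then show "AE y in K x. P y"
      using Z by (intro AE_I[of _ _ Z]) auto
  qed
qed

text \<open>The set \<open>S\<close> consists of the points at which \<open>P\<close> holds and
  continues to hold almost surely after one step, after two steps, and so on. Invariance gives each
  of these conditions almost everywhere, and there are countably many. \<open>S\<close> need not be
  measurable.\<close>

lemma AE_absorbing:
  assumes P: "AE x in m. P x"
  obtains S where "S \<subseteq> space N" "AE x in m. x \<in> S" "\<And>x. x \<in> S \<Longrightarrow> P x" "\<And>x. x \<in> S \<Longrightarrow> AE y in K x. y \<in> S"
proof -
  define p where "p n = ((\<lambda>Q x. AE y in K x. Q y) ^^ n) P" for n
  define S where "S = {x \<in> space N. \<forall>n. p n x}"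
  have "AE x in m. p n x" for n
  proof (induction n)
    case (Suc n)
    show ?case using AE_invariant[OF Suc] by (simp add: p_def)
  qed (simp add: p_def P)
  then have "AE x in m. \<forall>n. p n x" by (simp add: AE_all_countable)
  then have "AE x in m. x \<in> S" using AE_space[of m] by eventually_elim (auto simp: S_def)
  moreover have "P x" if "x \<in> S" for x
    using that unfolding S_def p_def by (auto dest: spec[of _ 0])
  moreover have "AE y in K x. y \<in> S" if x: "x \<in> S" for x
  proof -
    have "p (Suc n) x" for n using x by (simp add: S_def)
    then have "AE y in K x. p n y" for n by (simp add: p_def)
    then have "AE y in K x. \<forall>n. p n y" by (simp add: AE_all_countable)
    then show ?thesis using AE_space[of "K x"]
      by eventually_elim (use x in \<open>auto simp: S_def\<close>)
  qed
  moreover have "S \<subseteq> space N" by (auto simp: S_def)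
  ultimately show thesis using that by blast
qed

lemma shift_invariant_zero_one:
  assumes B: "B \<in> sets trajectories" and shift: "B = {y \<in> space trajectories. (\<lambda>n. y (Suc n)) \<in> B}"
    and c: "AE x in m. emeasure (law x) B = c"
  shows "(AE x in m. emeasure (law x) B = 0) \<or> (AE x in m. emeasure (law x) (space trajectories - B) = 0)"
proof -
  from c obtain S where S: "S \<subseteq> space N" "AE x in m. x \<in> S" "\<And>x. x \<in> S \<Longrightarrow> emeasure (law x) B = c"
      "\<And>x. x \<in> S \<Longrightarrow> AE y in K x. y \<in> S" by (rule AE_absorbing) blast
  show ?thesis
  proof (cases "S = {}")
    case True
    with S(2) have "AE x in m. emeasure (law x) B = 0" by (auto elim!: eventually_mono)
    then show ?thesis ..
  next
    case False
    then obtain x where x: "x \<in> S" by blast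
    have "c = c * c" by (rule law_zero_one[OF B shift S(1,4,3) x])
    moreover have "c \<le> 1"
      using prob_space.measure_le_1[OF prob_space_law, of x B] S x by auto
    ultimately have "c = 0 \<or> c = 1"
      by (cases c) (auto simp: ennreal_mult[symmetric] top_unique)
    then show ?thesis
    proof
      assume "c = 0"
      with c show ?thesis by simp
    next
      assume c1: "c = 1"
      have "emeasure (law x) (space trajectories - B) = 0" if "x \<in> S" for x
      proof -
        have xN: "x \<in> space N" using that S by auto
        interpret L: prob_space "law x" by (rule prob_space_law[OF xN])
        have "B \<in> sets (law x)" using B sets_law[OF xN] by simp
        then have "emeasure (law x) (space (law x) - B) = 1 - emeasure (law x) B"
          by (subst emeasure_compl) (simp_all add: L.emeasure_space_1)
        then show ?thesis using S(3)[OF that] c1 space_law[OF xN] by simp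
      qed
      then have "AE x in m. emeasure (law x) (space trajectories - B) = 0"
        using S(2) by (auto elim!: eventually_mono)
      then show ?thesis ..
    qed
  qed
qed

text \<open>A bounded harmonic function \<open>h\<close> has a conditional variance \<open>K (h - h x)\<^sup>2 = K h\<^sup>2 - h\<^sup>2\<close> which, summed along the
  excursions from a recurrent set \<open>G\<close> of finite measure, is compensated by the mass balance of the chain induced
  on \<open>G\<close>; hence it vanishes.\<close>

lemma harmonic_constant_on_recurrent:
  assumes h [measurable]: "h \<in> borel_measurable N" and h01: "\<And>x. 0 \<le> h x" "\<And>x. h x \<le> (1::real)"
    and harm: "\<And>x. x \<in> space N \<Longrightarrow> (\<integral>\<^sup>+y. ennreal (h y) \<partial>K x) = ennreal (h x)"
    and G [measurable]: "G \<in> sets N" and G_fin: "emeasure m G < \<infinity>"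
    and rec: "AE x in m. x \<in> G \<longrightarrow> emeasure (law x) {y \<in> space trajectories. \<exists>n\<ge>1. y n \<in> G} = 1"
  shows "AE x in m. x \<in> G \<longrightarrow> (AE y in K x. h y = h x)"
proof -
  \<comment> \<open>\<open>Q\<close> is the kernel of the moves that miss \<open>G\<close> and
    \<open>R\<close> that of the moves that hit it. Thus \<open>(Q ^^ k) (R u)\<close> is the mean
    of \<open>u\<close> at the first return to \<open>G\<close>, on the event that it happens at
    time \<open>Suc k\<close>.\<close>
  define Q where "Q u x = (\<integral>\<^sup>+y. indicator (space N - G) y * u y \<partial>K x)" for u :: "'a \<Rightarrow> ennreal" and x
  define R where "R u x = (\<integral>\<^sup>+y. indicator G y * u y \<partial>K x)" for u :: "'a \<Rightarrow> ennreal" and x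
  have Q_meas [measurable]: "Q u \<in> borel_measurable N" and R_meas [measurable]: "R u \<in> borel_measurable N"
    if [measurable]: "u \<in> borel_measurable N" for u
    unfolding Q_def R_def by measurable
  have Qn_meas [measurable]: "(Q ^^ n) u \<in> borel_measurable N" if "u \<in> borel_measurable N" for u n
    using that by (induction n) auto
  have split: "(\<integral>\<^sup>+y. u y \<partial>K x) = R u x + Q u x" if u [measurable]: "u \<in> borel_measurable N" and x: "x \<in> space N" for u x
  proof -
    have "R u x + Q u x = (\<integral>\<^sup>+y. indicator G y * u y + indicator (space N - G) y * u y \<partial>K x)"
      unfolding R_def Q_def using x by (intro nn_integral_add[symmetric]) (simp_all cong: measurable_cong_sets)
    also have "\<dots> = (\<integral>\<^sup>+y. u y \<partial>K x)"
      using x by (intro nn_integral_cong) (auto split: split_indicator)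
    finally show ?thesis by simp
  qed
  have Q_mono: "Q u x \<le> Q v x" if "\<And>y. y \<in> space N \<Longrightarrow> u y \<le> v y" "x \<in> space N" for u v x
    unfolding Q_def using that by (intro nn_integral_mono) (auto split: split_indicator)
  have Q_cong: "Q u x = Q v x" if "\<And>y. y \<in> space N \<Longrightarrow> u y = v y" "x \<in> space N" for u v x
    unfolding Q_def using that by (intro nn_integral_cong) simp
  have Q_add: "Q (\<lambda>y. u y + v y) x = Q u x + Q v x"
    if [measurable]: "u \<in> borel_measurable N" "v \<in> borel_measurable N" and "x \<in> space N" for u v x
    unfolding Q_def distrib_left
    using that by (intro nn_integral_add) (simp_all cong: measurable_cong_sets)
  have Qn_mono: "(Q ^^ n) u x \<le> (Q ^^ n) v x"
    if "\<And>y. y \<in> space N \<Longrightarrow> u y \<le> v y" "x \<in> space N" for n u v x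
    using that(2) by (induction n arbitrary: x) (auto intro: Q_mono that(1))
  have Qn_add: "(Q ^^ n) (\<lambda>y. u y + v y) x = (Q ^^ n) u x + (Q ^^ n) v x"
    if [measurable]: "u \<in> borel_measurable N" "v \<in> borel_measurable N" and "x \<in> space N" for n u v x
    using that(3)
  proof (induction n arbitrary: x)
    case (Suc n)
    have "Q ((Q ^^ n) (\<lambda>y. u y + v y)) x = Q (\<lambda>y. (Q ^^ n) u y + (Q ^^ n) v y) x"
      using Suc by (intro Q_cong) auto
    then show ?case using Suc.prems by (simp add: Q_add)
  qed simp
  define H where "H x = ennreal (h x ^ 2)" for x
  have H_meas [measurable]: "H \<in> borel_measurable N" unfolding H_def by measurable
  have H1: "H x \<le> 1" for x
    using h01 by (simp add: H_def power_le_one)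
  define g where "g x = (\<integral>\<^sup>+y. ennreal ((h y - h x) ^ 2) \<partial>K x)" for x
  have g_meas [measurable]: "g \<in> borel_measurable N"
    unfolding g_def by (rule nn_integral_measurable_subprob_algebra2[OF _ measurable_K]) measurable
  have variance: "H x + g x = R H x + Q H x" if x: "x \<in> space N" for x
  proof -
    interpret K: prob_space "K x" by (rule prob_space_K[OF x])
    have hx [measurable]: "h \<in> borel_measurable (K x)" using h x by (simp cong: measurable_cong_sets)
    have i1: "integrable (K x) h"
      by (rule K.integrable_const_bound[of _ 1]) (use h01 in auto)
    have i2: "integrable (K x) (\<lambda>y. h y ^ 2)"
      by (rule K.integrable_const_bound[of _ 1]) (use h01 in \<open>auto simp: power_le_one\<close>)
    have i3: "integrable (K x) (\<lambda>y. (h y - h x) ^ 2)"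
      unfolding power2_diff using i1 i2 by auto
    have "ennreal (\<integral>y. h y \<partial>K x) = ennreal (h x)"
      using harm[OF x] i1 h01 by (simp add: nn_integral_eq_integral)
    then have mean: "(\<integral>y. h y \<partial>K x) = h x"
      using h01 by (simp add: integral_nonneg_AE)
    have "(\<integral>y. (h y - h x) ^ 2 \<partial>K x) = (\<integral>y. h y ^ 2 \<partial>K x) - (h x) ^ 2"
      unfolding power2_diff using i1 i2 mean by (simp add: K.prob_space power2_eq_square)
    then have "h x ^ 2 + (\<integral>y. (h y - h x) ^ 2 \<partial>K x) = (\<integral>y. h y ^ 2 \<partial>K x)" by simp
    then have "H x + g x = (\<integral>\<^sup>+y. H y \<partial>K x)"
      unfolding H_def g_def using i2 i3
      by (simp add: nn_integral_eq_integral ennreal_plus[symmetric] integral_nonneg_AE del: ennreal_plus)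
    then show ?thesis using split[OF H_meas x] by simp
  qed
  \<comment> \<open>The process \<open>h^2\<close> is stopped at the first return to
    \<open>G\<close> or at time \<open>Suc n\<close>, whichever comes first. The variance of the
    first move is kept and those of the later moves are dropped, hence an inequality.\<close>
  have submartingale: "H x + g x \<le> (\<Sum>k<Suc n. (Q ^^ k) (R H) x) + (Q ^^ Suc n) H x" if "x \<in> space N" for n x
    using that
  proof (induction n arbitrary: x)
    case 0
    then show ?case by (simp add: variance)
  next
    case (Suc n)
    have "(Q ^^ Suc n) H x \<le> (Q ^^ Suc n) (\<lambda>y. R H y + Q H y) x"
      using Suc.prems
    proof (intro Qn_mono)
      fix y assume "y \<in> space N"
      then show "H y \<le> R H y + Q H y" by (simp add: variance[symmetric])
    qed
    also have "\<dots> = (Q ^^ Suc n) (R H) x + (Q ^^ Suc n) (Q H) x"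
      using Suc.prems by (intro Qn_add) auto
    also have "(Q ^^ Suc n) (Q H) x = (Q ^^ Suc (Suc n)) H x"
      by (simp only: funpow_Suc_right comp_def)
    finally have "(\<Sum>k<Suc n. (Q ^^ k) (R H) x) + (Q ^^ Suc n) H x \<le>
       (\<Sum>k<Suc (Suc n). (Q ^^ k) (R H) x) + (Q ^^ Suc (Suc n)) H x"
      by (simp add: add.assoc add_left_mono del: funpow.simps)
    with Suc.IH[OF Suc.prems] show ?case by (rule order_trans)
  qed
  let ?I = "\<lambda>A f. \<integral>\<^sup>+x. indicator A x * f x \<partial>m"
  have balance: "?I A f = ?I G (\<lambda>x. \<integral>\<^sup>+y. indicator A y * f y \<partial>K x) + ?I (space N - G) (\<lambda>x. \<integral>\<^sup>+y. indicator A y * f y \<partial>K x)"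
    if [measurable]: "f \<in> borel_measurable N" "A \<in> sets N" for f A
  proof -
    have "?I A f = (\<integral>\<^sup>+x. (\<integral>\<^sup>+y. indicator A y * f y \<partial>K x) \<partial>m)"
      by (rule nn_integral_invariant[symmetric]) measurable
    also have "\<dots> = (\<integral>\<^sup>+x. indicator G x * (\<integral>\<^sup>+y. indicator A y * f y \<partial>K x) +
        indicator (space N - G) x * (\<integral>\<^sup>+y. indicator A y * f y \<partial>K x) \<partial>m)"
      by (intro nn_integral_cong) (auto split: split_indicator)
    also have "\<dots> = ?I G (\<lambda>x. \<integral>\<^sup>+y. indicator A y * f y \<partial>K x) + ?I (space N - G) (\<lambda>x. \<integral>\<^sup>+y. indicator A y * f y \<partial>K x)"
      by (rule nn_integral_add) measurable
    finally show ?thesis .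
  qed
  have balance_Q: "?I (space N - G) u = ?I G (Q u) + ?I (space N - G) (Q u)" if "u \<in> borel_measurable N" for u
    unfolding Q_def by (rule balance) (use that in auto)
  \<comment> \<open>The mass on \<open>G\<close> is split by the time elapsed since the previous
    visit to \<open>G\<close>; the remainder belongs to paths whose previous visit lies more than
    \<open>n\<close> steps back. Being nonnegative, it is dropped in \<open>sum_le\<close>.\<close>
  have induced: "?I G f = (\<Sum>k<n. ?I G ((Q ^^ k) (R f))) + (if n = 0 then ?I G f else ?I (space N - G) ((Q ^^ (n - 1)) (R f)))"
    if f [measurable]: "f \<in> borel_measurable N" for f n
  proof (induction n)
    case (Suc n)
    show ?case
    proof (cases n)
      case 0
      then show ?thesis using balance[OF f G] by (simp add: R_def)
    next
      case (Suc k)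
      have "?I (space N - G) ((Q ^^ k) (R f)) = ?I G (Q ((Q ^^ k) (R f))) + ?I (space N - G) (Q ((Q ^^ k) (R f)))"
        by (rule balance_Q) simp
      then show ?thesis
        using Suc.IH Suc by (simp add: add.assoc)
    qed
  qed simp
  have sum_le: "(\<Sum>k<n. ?I G ((Q ^^ k) (R H))) \<le> ?I G H" for n
    by (rule order_trans[OF _ eq_refl[OF induced[OF H_meas, of n, symmetric]]]) (simp add: add_increasing2)
  have Qn_law: "(Q ^^ n) (\<lambda>_. 1) x = emeasure (law x) {y \<in> space trajectories. \<forall>i\<in>{1..n}. y i \<notin> G}"
    if "x \<in> space N" for n x
    using that
  proof (induction n arbitrary: x)
    case 0
    then show ?case using prob_space.emeasure_space_1[OF prob_space_law[OF 0]] by (simp add: space_law)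
  next
    case (Suc n)
    have E: "{y \<in> space trajectories. \<forall>i\<in>{1..n}. y i \<notin> G} \<in> sets trajectories" for n by measurable
    have "(Q ^^ Suc n) (\<lambda>_. 1) x = (\<integral>\<^sup>+z. indicator (space N - G) z * emeasure (law z) {y \<in> space trajectories. \<forall>i\<in>{1..n}. y i \<notin> G} \<partial>K x)"
      using Q_cong[of "(Q ^^ n) (\<lambda>_. 1)" _ x, OF Suc.IH Suc.prems] by (simp add: Q_def)
    also have "\<dots> = (\<integral>\<^sup>+z. emeasure (law z) {y \<in> space trajectories. case_nat x y \<in> {y \<in> space trajectories. \<forall>i\<in>{1..Suc n}. y i \<notin> G}} \<partial>K x)"
    proof (rule nn_integral_cong)
      fix z assume "z \<in> space (K x)"
      then have z: "z \<in> space N" using Suc by simp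
      have "(\<forall>i\<in>{1..Suc n}. case_nat x y i \<notin> G) \<longleftrightarrow> y 0 \<notin> G \<and> (\<forall>i\<in>{1..n}. y i \<notin> G)" for y
      proof -
        have "(\<forall>i\<in>{1..k}. P i) \<longleftrightarrow> (\<forall>i<k. P (Suc i))" for P k
          unfolding image_Suc_lessThan[symmetric] by auto
        then show ?thesis by (simp add: All_less_Suc2)
      qed
      then have "{y \<in> space trajectories. case_nat x y \<in> {y \<in> space trajectories. \<forall>i\<in>{1..Suc n}. y i \<notin> G}} =
        {y \<in> {y \<in> space trajectories. \<forall>i\<in>{1..n}. y i \<notin> G}. y 0 \<in> space N - G}"
        using cons_in_trajectories[OF Suc.prems] by (auto simp: space_PiM PiE_iff)
      then show "indicator (space N - G) z * emeasure (law z) {y \<in> space trajectories. \<forall>i\<in>{1..n}. y i \<notin> G} =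
         emeasure (law z) {y \<in> space trajectories. case_nat x y \<in> {y \<in> space trajectories. \<forall>i\<in>{1..Suc n}. y i \<notin> G}}"
        using law_start[OF z _ E, of "space N - G" n] by simp
    qed
    also have "\<dots> = emeasure (law x) {y \<in> space trajectories. \<forall>i\<in>{1..Suc n}. y i \<notin> G}"
      by (rule law_Markov[OF Suc.prems E, symmetric])
    finally show ?case .
  qed
  have Qn_lim: "(INF n. (Q ^^ n) (\<lambda>_. 1) x) = 0"
    if x: "x \<in> space N" and r: "emeasure (law x) {y \<in> space trajectories. \<exists>n\<ge>1. y n \<in> G} = 1" for x
  proof -
    interpret L: prob_space "law x" by (rule prob_space_law[OF x])
    define E where "E n = {y \<in> space trajectories. \<forall>i\<in>{1..n}. y i \<notin> G}" for n
    have E: "E n \<in> sets (law x)" for n unfolding sets_law[OF x] E_def by measurable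
    have V: "{y \<in> space trajectories. \<exists>n\<ge>1. y n \<in> G} \<in> sets (law x)" unfolding sets_law[OF x] by measurable
    have "(INF n. (Q ^^ n) (\<lambda>_. 1) x) = (INF n. emeasure (law x) (E n))"
      using Qn_law[OF x] by (simp add: E_def)
    also have "\<dots> = emeasure (law x) (\<Inter>n. E n)"
    proof (rule INF_emeasure_decseq)
      show "range E \<subseteq> sets (law x)" using E by blast
      show "decseq E" by (auto simp: decseq_def E_def)
    qed simp
    also have "(\<Inter>n. E n) = space (law x) - {y \<in> space trajectories. \<exists>n\<ge>1. y n \<in> G}"
      unfolding E_def space_law[OF x] by (auto, meson atLeastAtMost_iff order_refl)
    also have "emeasure (law x) \<dots> = 0"
      using r by (subst emeasure_compl[OF V]) (simp_all only: L.emeasure_space_1, simp_all)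
    finally show ?thesis .
  qed
  have Qn_dec: "(Q ^^ Suc n) (\<lambda>_. 1) x \<le> (Q ^^ n) (\<lambda>_. 1) x" if x: "x \<in> space N" for n x
    unfolding Qn_law[OF x] by (rule emeasure_mono) (auto simp: sets_law[OF x])
  \<comment> \<open>By \<open>Qn_law\<close> the integrand is the probability of avoiding
    \<open>G\<close> up to time \<open>n\<close>. Recurrence sends it to 0, and the finite mass of
    \<open>G\<close> allows the limit under the integral.\<close>
  have rest: "(INF n. ?I G ((Q ^^ n) (\<lambda>_. 1))) = 0"
  proof -
    have fin: "?I G ((Q ^^ 0) (\<lambda>_. 1)) < \<infinity>" using G_fin by simp
    have "(INF n. ?I G ((Q ^^ n) (\<lambda>_. 1))) = (\<integral>\<^sup>+x. (INF n. indicator G x * (Q ^^ n) (\<lambda>_. 1) x) \<partial>m)"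
    proof (rule nn_integral_monotone_convergence_INF_AE[where i=0, symmetric])
      show "AE x in m. indicator G x * (Q ^^ Suc i) (\<lambda>_. 1) x \<le> indicator G x * (Q ^^ i) (\<lambda>_. 1) x" for i
        using AE_space[of m] by eventually_elim (intro mult_left_mono Qn_dec, simp_all del: funpow.simps)
    qed (use fin in simp_all)
    also have "\<dots> = (\<integral>\<^sup>+x. 0 \<partial>m)"
    proof (rule nn_integral_cong_AE)
      show "AE x in m. (INF n. indicator G x * (Q ^^ n) (\<lambda>_. 1) x) = 0"
        using rec AE_space[of m]
        by eventually_elim (use Qn_lim in \<open>auto split: split_indicator\<close>)
    qed
    finally show ?thesis by simp
  qed
  \<comment> \<open>By \<open>sum_le\<close>, what \<open>H\<close> collects at the returns is at
    most its integral over \<open>G\<close>. This integral is finite and cancels, leaving the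
    variance against the mass that has not yet returned.\<close>
  have main: "?I G H + ?I G g \<le> ?I G H + ?I G ((Q ^^ Suc n) (\<lambda>_. 1))" for n
  proof -
    have "?I G H + ?I G g = ?I G (\<lambda>x. H x + g x)"
      by (simp add: distrib_left nn_integral_add)
    also have "\<dots> \<le> ?I G (\<lambda>x. (\<Sum>k<Suc n. (Q ^^ k) (R H) x) + (Q ^^ Suc n) (\<lambda>_. 1) x)"
    proof (intro nn_integral_mono mult_left_mono)
      fix x assume "x \<in> space m"
      then have x: "x \<in> space N" by simp
      show "H x + g x \<le> (\<Sum>k<Suc n. (Q ^^ k) (R H) x) + (Q ^^ Suc n) (\<lambda>_. 1) x"
        using submartingale[OF x, of n] Qn_mono[of H "\<lambda>_. 1" x "Suc n"] H1 x
        by (meson add_left_mono order_trans)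
    qed simp
    also have "\<dots> = (\<Sum>k<Suc n. ?I G ((Q ^^ k) (R H))) + ?I G ((Q ^^ Suc n) (\<lambda>_. 1))"
      unfolding distrib_left sum_distrib_left
      by (subst nn_integral_add, simp, simp, subst nn_integral_sum) (simp_all del: funpow.simps sum.lessThan_Suc)
    also have "\<dots> \<le> ?I G H + ?I G ((Q ^^ Suc n) (\<lambda>_. 1))"
      by (intro add_right_mono sum_le)
    finally show ?thesis .
  qed
  have "?I G H \<le> (\<integral>\<^sup>+x. indicator G x \<partial>m)"
    by (intro nn_integral_mono) (use H1 in \<open>auto split: split_indicator\<close>)
  then have "?I G H < \<infinity>" using G_fin by (simp add: order_le_less_trans)
  then have "?I G g \<le> ?I G ((Q ^^ Suc n) (\<lambda>_. 1))" for n
    using main[of n] unfolding ennreal_add_left_cancel_le by auto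
  moreover have "?I G ((Q ^^ Suc n) (\<lambda>_. 1)) \<le> ?I G ((Q ^^ n) (\<lambda>_. 1))" for n
    by (intro nn_integral_mono mult_left_mono Qn_dec) auto
  ultimately have "?I G g \<le> ?I G ((Q ^^ n) (\<lambda>_. 1))" for n
    by (meson order_trans)
  then have "?I G g \<le> 0" unfolding rest[symmetric] by (rule INF_greatest)
  then have "AE x in m. indicator G x * g x = 0"
    by (subst nn_integral_0_iff_AE[symmetric]) auto
  then show ?thesis
    using AE_space[of m]
  proof eventually_elim
    fix x assume gx: "indicator G x * g x = 0" and "x \<in> space m"
    then have x: "x \<in> space N" by simp
    have hx [measurable]: "h \<in> borel_measurable (K x)" using h x by (simp cong: measurable_cong_sets)
    show "x \<in> G \<longrightarrow> (AE y in K x. h y = h x)"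
    proof
      assume "x \<in> G"
      with gx have "g x = 0" by simp
      then have "AE y in K x. ennreal ((h y - h x) ^ 2) = 0"
        unfolding g_def by (subst (asm) nn_integral_0_iff_AE) measurable
      then show "AE y in K x. h y = h x"
        by eventually_elim simp
    qed
  qed
qed

end

section \<open>Functions invariant under the ladder moves\<close>

lemma lattice_set_0 [simp]: "lattice_set 0 = UNIV"
  by (simp add: lattice_set_def)

lemma lattice_set_iff: "x \<in> lattice_set u \<longleftrightarrow> u = 0 \<or> (\<exists>k::int. x = u * of_int k)"
  by (auto simp: lattice_set_def)

lemma zero_in_lattice [simp]: "0 \<in> lattice_set u"
  by (auto simp: lattice_set_iff intro!: exI[of _ 0])

lemma lattice_add: "x \<in> lattice_set u \<Longrightarrow> y \<in> lattice_set u \<Longrightarrow> x + y \<in> lattice_set u"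
  by (auto simp: lattice_set_iff distrib_left[symmetric] of_int_add[symmetric] simp del: of_int_add)

lemma lattice_uminus: "x \<in> lattice_set u \<Longrightarrow> - x \<in> lattice_set u"
  by (auto simp: lattice_set_iff mult_minus_right[symmetric] of_int_minus[symmetric]
      simp del: mult_minus_right of_int_minus)

lemma lattice_mult_int: "x \<in> lattice_set u \<Longrightarrow> of_int k * x \<in> lattice_set u"
  by (auto simp: lattice_set_iff mult.left_commute of_int_mult[symmetric] simp del: of_int_mult)

lemma lattice_add_iff: "x \<in> lattice_set u \<Longrightarrow> x + y \<in> lattice_set u \<longleftrightarrow> y \<in> lattice_set u"
  using lattice_add[of x u y] lattice_add[of "-x" u "x + y"] lattice_uminus[of x u] by auto

lemma sets_lattice_haar [measurable_cong, simp]: "sets (lattice_haar u) = sets borel"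
  by (simp add: lattice_haar_def)

lemma space_lattice_haar [simp]: "space (lattice_haar u) = UNIV"
  using sets_eq_imp_space_eq[OF sets_lattice_haar] by simp

lemma nn_integral_lattice_haar:
  assumes "u \<noteq> 0" and [measurable]: "f \<in> borel_measurable borel"
  shows "(\<integral>\<^sup>+x. f x \<partial>lattice_haar u) = ennreal u * (\<integral>\<^sup>+k. f (u * of_int k) \<partial>count_space UNIV)"
  using assms by (simp add: lattice_haar_def nn_integral_scale_measure nn_integral_distr)

lemma nn_integral_lattice_haar_shift:
  assumes t: "t \<in> lattice_set u" and [measurable]: "f \<in> borel_measurable borel"
  shows "(\<integral>\<^sup>+x. f (x + t) \<partial>lattice_haar u) = (\<integral>\<^sup>+x. f x \<partial>lattice_haar u)"
proof (cases "u = 0")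
  case True
  then show ?thesis
    using nn_integral_real_affine[of f 1 t] by (simp add: lattice_haar_def add.commute)
next
  case False
  with t obtain j :: int where j: "t = u * of_int j" by (auto simp: lattice_set_iff)
  have "(\<integral>\<^sup>+k. f (u * of_int k + t) \<partial>count_space UNIV) = (\<integral>\<^sup>+k. f (u * of_int (k + j)) \<partial>count_space UNIV)"
    by (simp add: j distrib_left)
  also have "\<dots> = (\<integral>\<^sup>+k. f (u * of_int k) \<partial>count_space UNIV)"
    by (rule nn_integral_bij_count_space) (auto intro!: bij_betwI[of _ _ _ "\<lambda>k. k - j"])
  finally show ?thesis
    by (simp add: nn_integral_lattice_haar False)
qed

lemma distr_lattice_haar_shift:
  assumes t: "t \<in> lattice_set u"
  shows "distr (lattice_haar u) borel (\<lambda>x. x + t) = lattice_haar u"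
proof (rule measure_eqI)
  fix A assume "A \<in> sets (distr (lattice_haar u) borel (\<lambda>x. x + t))"
  then have A [measurable]: "A \<in> sets borel" by simp
  show "emeasure (distr (lattice_haar u) borel (\<lambda>x. x + t)) A = emeasure (lattice_haar u) A"
    using nn_integral_lattice_haar_shift[OF t, of "indicator A"]
    by (simp add: nn_integral_distr[symmetric, of "\<lambda>x. x + t" "lattice_haar u" borel "indicator A"])
qed simp

lemma AE_lattice_haar_shift:
  assumes P: "AE x in lattice_haar u. P x" and t: "t \<in> lattice_set u"
  shows "AE x in lattice_haar u. P (x + t)"
  using P by (subst (asm) distr_lattice_haar_shift[OF t, symmetric]) (rule AE_distrD[rotated], auto)

lemma AE_lattice_haar: "AE x in lattice_haar u. x \<in> lattice_set u"
proof (cases "u = 0")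
  case False
  have [measurable]: "- lattice_set u \<in> sets borel" using lattice_set_borel by (rule borel_comp)
  have "(\<lambda>k::int. indicator (- lattice_set u) (u * of_int k)) = (\<lambda>_. 0 :: ennreal)"
    by (auto simp: lattice_set_iff fun_eq_iff split: split_indicator)
  then have "emeasure (lattice_haar u) (- lattice_set u) = 0"
    using nn_integral_lattice_haar[OF False, of "indicator (- lattice_set u)"] by simp
  then show ?thesis by (intro AE_I[of _ _ "- lattice_set u"]) auto
qed simp

lemma emeasure_lattice_haar_bounded: "emeasure (lattice_haar u) {-r..r} < \<infinity>"
proof (cases "u = 0")
  case True
  then show ?thesis by (simp add: lattice_haar_def emeasure_lborel_Icc_eq)
next
  case False
  have "finite {k::int. \<bar>u * of_int k\<bar> \<le> r}"
  proof (rule finite_subset)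
    show "{k::int. \<bar>u * of_int k\<bar> \<le> r} \<subseteq> {- \<lceil>r / \<bar>u\<bar>\<rceil>..\<lceil>r / \<bar>u\<bar>\<rceil>}"
    proof safe
      fix k :: int assume "\<bar>u * of_int k\<bar> \<le> r"
      then have "\<bar>real_of_int k\<bar> \<le> r / \<bar>u\<bar>" using False by (simp add: abs_mult field_simps)
      then have "\<bar>real_of_int k\<bar> \<le> of_int \<lceil>r / \<bar>u\<bar>\<rceil>" by linarith
      then have "\<bar>k\<bar> \<le> \<lceil>r / \<bar>u\<bar>\<rceil>" by linarith
      then show "k \<in> {- \<lceil>r / \<bar>u\<bar>\<rceil>..\<lceil>r / \<bar>u\<bar>\<rceil>}" by auto
    qed
  qed simp
  moreover have "(\<lambda>k::int. u * of_int k) -` {-r..r} = {k. \<bar>u * of_int k\<bar> \<le> r}" by auto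
  ultimately show ?thesis
    using False by (simp add: lattice_haar_def emeasure_distr ennreal_mult_less_top ennreal_of_nat_eq_real_of_nat)
qed

lemma sigma_finite_lattice_haar: "sigma_finite_measure (lattice_haar u)"
proof
  let ?A = "range (\<lambda>n::nat. {- real n..real n})"
  have "x \<in> \<Union>?A" for x :: real
  proof -
    obtain n :: nat where "\<bar>x\<bar> \<le> real n" using real_arch_simple by blast
    then show ?thesis by (intro UnionI[of "{- real n..real n}"]) auto
  qed
  then have "\<Union>?A = space (lattice_haar u)" by auto
  moreover have "\<forall>a\<in>?A. emeasure (lattice_haar u) a \<noteq> \<infinity>"
    using emeasure_lattice_haar_bounded[of u] by (auto simp: less_top)
  ultimately show "\<exists>A. countable A \<and> A \<subseteq> sets (lattice_haar u) \<and> \<Union>A = space (lattice_haar u) \<and> (\<forall>a\<in>A. emeasure (lattice_haar u) a \<noteq> \<infinity>)"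
    by (intro exI[of _ ?A]) auto
qed

text \<open>Every point of a discrete lattice carries mass \<open>u > 0\<close> and so lies in no
  null set.\<close>

lemma AE_lattice_haar_iff:
  assumes "0 < u" "AE x in lattice_haar u. P x" "x \<in> lattice_set u"
  shows "P x"
proof (rule ccontr)
  assume np: "\<not> P x"
  from assms(2) obtain Z where Z: "{x \<in> space (lattice_haar u). \<not> P x} \<subseteq> Z" "Z \<in> sets (lattice_haar u)" "emeasure (lattice_haar u) Z = 0"
    by (auto elim!: AE_E)
  obtain k :: int where k: "x = u * of_int k" using assms by (auto simp: lattice_set_iff)
  have "x \<in> Z" using np Z by auto
  then have "ennreal u * indicator Z (u * of_int k) \<le> ennreal u * (\<integral>\<^sup>+j. indicator Z (u * of_int j) \<partial>count_space UNIV)"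
    by (intro mult_left_mono nn_integral_ge_point) auto
  also have "\<dots> = emeasure (lattice_haar u) Z"
    using nn_integral_lattice_haar[of u "indicator Z"] assms Z by simp
  finally show False using \<open>x \<in> Z\<close> k Z(3) assms(1) by simp
qed

section \<open>Subgroups of the line and functions with dense periods\<close>

text \<open>If the positive elements are bounded below by \<open>e\<close>, two elements at distance
  less than \<open>e\<close> coincide. Hence the infimum \<open>v\<close> of the positive elements
  is attained, and division with remainder shows that \<open>v\<close> generates
  \<open>H\<close>.\<close>

lemma real_subgroup_cases:
  fixes H :: "real set"
  assumes "p \<in> H" "0 < p" and diff: "\<And>x y. x \<in> H \<Longrightarrow> y \<in> H \<Longrightarrow> x - y \<in> H"
  obtains (lattice) v where "0 < v" "v \<in> H" "H \<subseteq> lattice_set v"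
    | (dense) "\<And>e. 0 < e \<Longrightarrow> \<exists>t\<in>H. 0 < t \<and> t < e"
proof (cases "\<forall>e>0. \<exists>t\<in>H. 0 < t \<and> t < e")
  case True
  then show thesis using dense by blast
next
  case False
  then obtain e where e: "0 < e" "\<And>t. t \<in> H \<Longrightarrow> 0 < t \<Longrightarrow> e \<le> t" by (force simp: not_less)
  have zero: "0 \<in> H" using diff[OF assms(1,1)] by simp
  have neg: "- x \<in> H" if "x \<in> H" for x using diff[OF zero that] by simp
  have add: "x + y \<in> H" if "x \<in> H" "y \<in> H" for x y using diff[OF that(1) neg[OF that(2)]] by simp
  have mult_nat: "of_nat n * x \<in> H" if "x \<in> H" for n x
    by (induction n) (auto simp: zero distrib_right intro: add that)
  have mult: "of_int k * x \<in> H" if "x \<in> H" for k x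
    by (cases k rule: int_cases2) (use mult_nat[OF that] neg in auto)
  define P where "P = {t \<in> H. 0 < t}"
  define v where "v = Inf P"
  have P: "P \<noteq> {}" "bdd_below P" using assms by (auto simp: P_def intro!: bdd_belowI[of _ 0])
  have v_le: "v \<le> t" if "t \<in> P" for t unfolding v_def using that P by (intro cInf_lower)
  have "e \<le> v" unfolding v_def using P e by (intro cInf_greatest) (auto simp: P_def)
  with e have v: "0 < v" by simp
  obtain t where t: "t \<in> P" "t < v + e"
    using cInf_lessD[OF P(1), of "v + e"] e by (auto simp: v_def)
  have "t = v"
  proof (rule ccontr)
    assume "t \<noteq> v"
    with v_le[OF t(1)] have "v < t" by simp
    then obtain t' where t': "t' \<in> P" "t' < t"
      using cInf_lessD[OF P(1), of t] by (auto simp: v_def)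
    have "e \<le> t - t'" using t t' diff by (intro e) (auto simp: P_def)
    with t t' v_le[OF t'(1)] show False by simp
  qed
  with t have vH: "v \<in> H" by (simp add: P_def)
  have "H \<subseteq> lattice_set v"
  proof
    fix x assume x: "x \<in> H"
    define y where "y = x - of_int \<lfloor>x / v\<rfloor> * v"
    have y: "y \<in> H" unfolding y_def by (intro diff x mult vH)
    have "0 \<le> y" "y < v"
      unfolding y_def using floor_divide_lower[OF v, of x] floor_divide_upper[OF v, of x] by (auto simp: algebra_simps)
    then have "y = 0" using v_le[of y] y by (cases "y = 0") (auto simp: P_def)
    then show "x \<in> lattice_set v" by (auto simp: y_def lattice_set_iff mult.commute)
  qed
  then show thesis using lattice v vH by blast
qed

text \<open>Additivity and nonnegativity give monotonicity; enclosing \<open>n * x\<close> between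
  consecutive integers then bounds the error of the linear formula by
  \<open>g 1 / n\<close>.\<close>

lemma additive_mono_linear:
  fixes g :: "real \<Rightarrow> real"
  assumes add: "\<And>x y. 0 \<le> x \<Longrightarrow> 0 \<le> y \<Longrightarrow> g (x + y) = g x + g y"
    and nonneg: "\<And>x. 0 \<le> x \<Longrightarrow> 0 \<le> g x" and x: "0 \<le> x"
  shows "g x = g 1 * x"
proof -
  have mono: "g x \<le> g y" if "0 \<le> x" "x \<le> y" for x y
    using add[of x "y - x"] nonneg[of "y - x"] that by simp
  have zero: "g 0 = 0" using add[of 0 0] by simp
  have mult: "g (of_nat n * x) = of_nat n * g x" if "0 \<le> x" for n x
    by (induction n) (use that add in \<open>auto simp: zero distrib_right\<close>)
  have "\<bar>g x - g 1 * x\<bar> \<le> e" if "0 < e" for e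
  proof -
    obtain n :: nat where n: "g 1 / e < real n" "0 < n"
      using reals_Archimedean2[of "max (g 1 / e) 0"] by (auto simp: max_less_iff_conj)
    define k where "k = nat \<lfloor>real n * x\<rfloor>"
    have k: "real k \<le> real n * x" "real n * x \<le> real (Suc k)"
      using x by (auto simp: k_def) linarith
    have "g (real k * 1) \<le> g (real n * x)" "g (real n * x) \<le> g (real (Suc k) * 1)"
      using k x by (intro mono; simp)+
    then have "real k * g 1 \<le> real n * g x" "real n * g x \<le> real (Suc k) * g 1"
      using mult[OF x, of n] mult[of 1 k] mult[of 1 "Suc k"] by simp_all
    moreover have "real k * g 1 \<le> real n * x * g 1" "real n * x * g 1 \<le> real (Suc k) * g 1"
      using k nonneg[of 1] by (auto intro!: mult_right_mono)
    ultimately have "real n * \<bar>g x - g 1 * x\<bar> \<le> g 1"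
      by (simp add: abs_if algebra_simps)
    also have "\<dots> \<le> real n * e" using n that by (simp add: field_simps)
    finally show ?thesis using n by simp
  qed
  then have "\<bar>g x - g 1 * x\<bar> \<le> 0" by (rule field_le_epsilon[of _ 0, simplified])
  then show ?thesis by simp
qed

text \<open>Adding 1 makes the function the density of a measure that is positive on intervals; the measure is
  translation invariant along a dense set and hence a multiple of Lebesgue measure.\<close>

lemma dense_periods_imp_constant:
  fixes f :: "real \<Rightarrow> real"
  assumes f [measurable]: "f \<in> borel_measurable borel" and f01: "\<And>x. 0 \<le> f x" "\<And>x. f x \<le> 1"
    and dense: "\<And>e. 0 < e \<Longrightarrow> \<exists>t. 0 < t \<and> t < e \<and> (AE x in lborel. f (x + t) = f x)"
  obtains c where "AE x in lborel. f x = c"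
proof -
  define m where "m = density lborel (\<lambda>x. ennreal (f x + 1))"
  have [measurable_cong, simp]: "sets m = sets borel" by (simp add: m_def)
  have m_le: "emeasure m A \<le> 2 * emeasure lborel A" if [measurable]: "A \<in> sets borel" for A
  proof -
    have "emeasure m A = (\<integral>\<^sup>+x. ennreal (f x + 1) * indicator A x \<partial>lborel)"
      unfolding m_def by (rule emeasure_density) auto
    also have "\<dots> \<le> (\<integral>\<^sup>+x. 2 * indicator A x \<partial>lborel)"
      using f01(2) by (intro nn_integral_mono mult_right_mono) (auto simp: ennreal_le_iff2[symmetric] simp flip: ennreal_numeral intro!: ennreal_leI)
    also have "\<dots> = 2 * emeasure lborel A" by (simp add: nn_integral_cmult)
    finally show ?thesis .
  qed
  define \<phi> where "\<phi> a b = measure m {a<..b}" for a b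
  have fin: "emeasure m {a<..b} < \<infinity>" for a b
    using m_le[of "{a<..b}"] by (cases "a \<le> b") (auto simp: ennreal_mult_less_top order_le_less_trans)
  have phi: "emeasure m {a<..b} = ennreal (\<phi> a b)" for a b
    unfolding \<phi>_def using fin[of a b] by (intro emeasure_eq_ennreal_measure) auto
  have phi_nonneg: "0 \<le> \<phi> a b" for a b by (simp add: \<phi>_def)
  have phi_le: "\<phi> a b \<le> 2 * (b - a)" if "a \<le> b" for a b
  proof -
    have "ennreal (\<phi> a b) \<le> 2 * ennreal (b - a)" using m_le[of "{a<..b}"] that by (simp add: phi[symmetric])
    also have "\<dots> = ennreal (2 * (b - a))" using that by (subst ennreal_mult) simp_all
    finally show ?thesis using that by (simp add: ennreal_le_iff)
  qed
  have phi_add: "\<phi> a b + \<phi> b d = \<phi> a d" if "a \<le> b" "b \<le> d" for a b d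
  proof -
    have "{a<..d} = {a<..b} \<union> {b<..d}" using that by auto
    then have "emeasure m {a<..d} = emeasure m {a<..b} + emeasure m {b<..d}"
      by (simp add: plus_emeasure[symmetric] disjoint_iff)
    then show ?thesis unfolding phi using phi_nonneg
      by (simp add: ennreal_plus[symmetric] del: ennreal_plus)
  qed
  have phi_period: "\<phi> (a + t) (b + t) = \<phi> a b" if t: "AE x in lborel. f (x + t) = f x" for a b t
  proof -
    have "emeasure m {a + t<..b + t} = (\<integral>\<^sup>+x. ennreal (f x + 1) * indicator {a + t<..b + t} x \<partial>lborel)"
      unfolding m_def by (rule emeasure_density) auto
    also have "\<dots> = (\<integral>\<^sup>+x. ennreal (f (x + t) + 1) * indicator {a + t<..b + t} (x + t) \<partial>lborel)"
      using nn_integral_real_affine[of "\<lambda>x. ennreal (f x + 1) * indicator {a + t<..b + t} x" 1 t]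
      by (simp add: add.commute)
    also have "\<dots> = (\<integral>\<^sup>+x. ennreal (f x + 1) * indicator {a<..b} x \<partial>lborel)"
      using t by (intro nn_integral_cong_AE, eventually_elim) (auto split: split_indicator)
    also have "\<dots> = emeasure m {a<..b}"
      unfolding m_def by (rule emeasure_density[symmetric]) auto
    finally show ?thesis by (simp add: \<phi>_def measure_def)
  qed
  \<comment> \<open>Approximate \<open>s\<close> from below by a multiple of a period
    \<open>t < e / 4\<close>. The shift by the multiple is exact, and the two leftover intervals are
    shorter than \<open>t\<close>, so each has mass at most \<open>2 * t\<close>.\<close>
  have phi_shift: "\<phi> (a + s) (b + s) = \<phi> a b" if ab: "a \<le> b" and s: "0 \<le> s" for a b s
  proof -
    have "\<bar>\<phi> (a + s) (b + s) - \<phi> a b\<bar> \<le> e" if e: "0 < e" for e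
    proof -
      obtain t where t: "0 < t" "t < e / 4" "AE x in lborel. f (x + t) = f x"
        using dense[of "e / 4"] e by auto
      define k where "k = nat \<lfloor>s / t\<rfloor>"
      have "0 \<le> s / t" using s t by simp
      then have "real k \<le> s / t" "s / t < real k + 1" by (auto simp: k_def)
      then have k: "real k * t \<le> s" "s < real k * t + t" using t by (auto simp: field_simps)
      have kt: "\<phi> (a + real n * t) (b + real n * t) = \<phi> a b" for n
        by (induction n) (use phi_period[OF t(3), of "a + real n * t" "b + real n * t" for n] in \<open>auto simp: algebra_simps\<close>)
      let ?t = "real k * t"
      have "\<phi> (a + ?t) (a + s) + \<phi> (a + s) (b + s) = \<phi> (a + ?t) (b + s)"
        "\<phi> (a + ?t) (b + ?t) + \<phi> (b + ?t) (b + s) = \<phi> (a + ?t) (b + s)"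
        using ab k by (intro phi_add; simp)+
      moreover have "\<phi> (a + ?t) (a + s) \<le> 2 * t" "\<phi> (b + ?t) (b + s) \<le> 2 * t"
        using phi_le[of "a + ?t" "a + s"] phi_le[of "b + ?t" "b + s"] k by auto
      ultimately show ?thesis
        using kt[of k] phi_nonneg[of "a + ?t" "a + s"] phi_nonneg[of "b + ?t" "b + s"] t(2) by (simp add: abs_if)
    qed
    then have "\<bar>\<phi> (a + s) (b + s) - \<phi> a b\<bar> \<le> 0" by (rule field_le_epsilon[of _ 0, simplified])
    then show ?thesis by simp
  qed
  define c where "c = \<phi> 0 1"
  have phi0: "\<phi> 0 x = c * x" if "0 \<le> x" for x
    unfolding c_def
  proof (rule additive_mono_linear[OF _ _ that])
    fix x y :: real assume "0 \<le> x" "0 \<le> y"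
    then show "\<phi> 0 (x + y) = \<phi> 0 x + \<phi> 0 y"
      using phi_add[of 0 x "x + y"] phi_shift[of 0 y x] by (simp add: add.commute)
  qed (rule phi_nonneg)
  have phi_c: "\<phi> a b = c * (b - a)" if ab: "a \<le> b" for a b
  proof (cases "0 \<le> a")
    case True
    then show ?thesis using phi_shift[of 0 "b - a" a] phi0[of "b - a"] ab by simp
  next
    case False
    then show ?thesis using phi_shift[of a b "- a"] phi0[of "b - a"] ab by simp
  qed
  have c_pos: "0 < c"
  proof (rule ccontr)
    assume "\<not> 0 < c"
    then have "emeasure m {0<..1} = 0" using phi[of 0 1] by (simp add: c_def not_less ennreal_eq_0_iff)
    then have "(\<integral>\<^sup>+x. ennreal (f x + 1) * indicator {0<..1} x \<partial>lborel) = 0"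
      unfolding m_def by (subst (asm) emeasure_density) auto
    moreover have "(\<integral>\<^sup>+x. 1 * indicator {0<..1::real} x \<partial>lborel) \<le> (\<integral>\<^sup>+x. ennreal (f x + 1) * indicator {0<..1} x \<partial>lborel)"
      using f01(1) by (intro nn_integral_mono mult_right_mono) (auto simp flip: ennreal_1 intro!: ennreal_leI)
    ultimately show False by simp
  qed
  \<comment> \<open>Divided by \<open>c\<close>, the measure gives every interval its length and is
    Lebesgue measure. Uniqueness of densities then yields \<open>f + 1 = c\<close> almost
    everywhere.\<close>
  have "lborel = density lborel (\<lambda>x. ennreal ((f x + 1) / c))"
  proof (rule lborel_eqI)
    fix l u :: real
    assume "\<And>b. b \<in> Basis \<Longrightarrow> l \<bullet> b \<le> u \<bullet> b"
    then have lu: "l \<le> u" by simp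
    have "emeasure (density lborel (\<lambda>x. ennreal ((f x + 1) / c))) (box l u) =
       (\<integral>\<^sup>+x. ennreal ((f x + 1) / c) * indicator (box l u) x \<partial>lborel)"
      by (rule emeasure_density) auto
    also have "\<dots> = (\<integral>\<^sup>+x. ennreal (1 / c) * (ennreal (f x + 1) * indicator {l<..u} x) \<partial>lborel)"
    proof (rule nn_integral_cong_AE)
      show "AE x in lborel. ennreal ((f x + 1) / c) * indicator (box l u) x = ennreal (1 / c) * (ennreal (f x + 1) * indicator {l<..u} x)"
        using AE_lborel_singleton[of u]
      proof eventually_elim
        fix x assume "x \<noteq> u"
        then have "indicator (box l u) x = (indicator {l<..u} x :: ennreal)" by (auto split: split_indicator)
        moreover have "ennreal ((f x + 1) / c) = ennreal (1 / c) * ennreal (f x + 1)"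
        proof -
          have "ennreal ((f x + 1) / c) = ennreal ((1 / c) * (f x + 1))" by (rule arg_cong[where f=ennreal]) simp
          also have "\<dots> = ennreal (1 / c) * ennreal (f x + 1)"
            using c_pos f01(1)[of x] by (intro ennreal_mult) auto
          finally show ?thesis .
        qed
        ultimately show "ennreal ((f x + 1) / c) * indicator (box l u) x = ennreal (1 / c) * (ennreal (f x + 1) * indicator {l<..u} x)"
          by (simp add: mult.assoc)
      qed
    qed
    also have "\<dots> = ennreal (1 / c) * emeasure m {l<..u}"
      unfolding m_def by (simp add: nn_integral_cmult emeasure_density)
    also have "\<dots> = ennreal (u - l)"
      using c_pos lu by (simp add: phi phi_c ennreal_mult[symmetric])
    finally show "emeasure (density lborel (\<lambda>x. ennreal ((f x + 1) / c))) (box l u) = ennreal (\<Prod>b\<in>Basis. (u - l) \<bullet> b)"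
      by simp
  qed simp
  then have "density lborel (\<lambda>_. 1) = density lborel (\<lambda>x. ennreal ((f x + 1) / c))"
    by (simp add: density_1)
  then have "AE x in lborel. 1 = ennreal ((f x + 1) / c)"
    by (subst (asm) sigma_finite_measure.density_unique_iff[OF lborel.sigma_finite_measure_axioms]) auto
  then have "AE x in lborel. f x = c - 1"
  proof eventually_elim
    fix x assume "1 = ennreal ((f x + 1) / c)"
    then have "(f x + 1) / c = 1" using c_pos f01(1)[of x] by (metis ennreal_eq_1)
    then show "f x = c - 1" using c_pos by (simp add: field_simps)
  qed
  then show thesis by (rule that)
qed

section \<open>Rotations of an interval and their common periodic extension\<close>

lemma AE_countable_shifts:
  assumes "AE x in lattice_haar u. P x" "w \<in> lattice_set u"
  shows "AE x in lattice_haar u. \<forall>k::int. P (x + of_int k * w)"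
  unfolding AE_all_countable using AE_lattice_haar_shift[OF assms(1) lattice_mult_int[OF assms(2)]] by blast

text \<open>The representative of \<open>x\<close> modulo \<open>s + r\<close> in the interval
  \<open>[-s, r)\<close>.\<close>

definition wrap :: "real \<Rightarrow> real \<Rightarrow> real \<Rightarrow> real" where
  "wrap s r x = x - (s + r) * of_int \<lfloor>(x + s) / (s + r)\<rfloor>"

lemma wrap_unique:
  assumes "0 < s" "0 < r" "- s \<le> y" "y < r" "x = y + (s + r) * of_int k"
  shows "wrap s r x = y"
proof -
  have "(x + s) / (s + r) = (y + s) / (s + r) + of_int k"
    using assms by (simp add: field_simps)
  moreover have "\<lfloor>(y + s) / (s + r)\<rfloor> = 0"
    using assms by (intro floor_unique) (auto simp: field_simps)
  ultimately show ?thesis using assms by (simp add: wrap_def)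
qed

lemma wrap_bounds:
  assumes "0 < s" "0 < r"
  shows "- s \<le> wrap s r x" "wrap s r x < r"
  using floor_divide_lower[of "s + r" "x + s"] floor_divide_upper[of "s + r" "x + s"] assms
  by (auto simp: wrap_def algebra_simps)

lemma wrap_eq: "x = wrap s r x + (s + r) * of_int \<lfloor>(x + s) / (s + r)\<rfloor>"
  by (simp add: wrap_def)

text \<open>On \<open>[-s, r)\<close> the moves \<open>x \<mapsto> x - s\<close> for \<open>x \<ge> 0\<close> and \<open>x \<mapsto> x + r\<close> for \<open>x < 0\<close> form a rotation of a circle of length
  \<open>s + r\<close>, so invariance under them makes the periodic extension \<open>s\<close>- and \<open>r\<close>-periodic.\<close>

lemma wrap_periods:
  assumes s: "0 < s" "s \<in> lattice_set u" and r: "0 < r" "r \<in> lattice_set u"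
    and pos: "AE x in lattice_haar u. 0 \<le> x \<and> x < r \<longrightarrow> h (x - s) = h x"
    and neg: "AE x in lattice_haar u. - s \<le> x \<and> x < 0 \<longrightarrow> h (x + r) = h x"
  shows "AE x in lattice_haar u. h (wrap s r (x - s)) = h (wrap s r x)"
    and "AE x in lattice_haar u. h (wrap s r (x + r)) = h (wrap s r x)"
proof -
  have w: "s + r \<in> lattice_set u" using s r by (intro lattice_add)
  show 1: "AE x in lattice_haar u. h (wrap s r (x - s)) = h (wrap s r x)"
    using AE_countable_shifts[OF pos w] AE_countable_shifts[OF neg w]
  proof eventually_elim
    fix x
    define k where "k = \<lfloor>(x + s) / (s + r)\<rfloor>"
    define y where "y = wrap s r x"
    have y: "y = x + of_int (- k) * (s + r)" "- s \<le> y" "y < r" "x = y + (s + r) * of_int k"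
      using wrap_bounds[OF s(1) r(1), of x] wrap_eq[of x s r] by (auto simp: y_def k_def wrap_def)
    assume "\<forall>k::int. 0 \<le> x + of_int k * (s + r) \<and> x + of_int k * (s + r) < r \<longrightarrow> h (x + of_int k * (s + r) - s) = h (x + of_int k * (s + r))"
      "\<forall>k::int. - s \<le> x + of_int k * (s + r) \<and> x + of_int k * (s + r) < 0 \<longrightarrow> h (x + of_int k * (s + r) + r) = h (x + of_int k * (s + r))"
    then have h: "0 \<le> y \<Longrightarrow> h (y - s) = h y" "y < 0 \<Longrightarrow> h (y + r) = h y"
      unfolding y(1) using y(2,3)[unfolded y(1)] by blast+
    show "h (wrap s r (x - s)) = h (wrap s r x)"
    proof (cases "0 \<le> y")
      case True
      have "wrap s r (x - s) = y - s"
        by (rule wrap_unique[where k=k]) (use s r y True in auto)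
      then show ?thesis using h True by (simp add: y_def)
    next
      case False
      have "wrap s r (x - s) = y + r"
        by (rule wrap_unique[where k="k - 1"]) (use s r y False in \<open>auto simp: algebra_simps\<close>)
      then show ?thesis using h False by (simp add: y_def)
    qed
  qed
  \<comment> \<open>Modulo \<open>s + r\<close>, adding \<open>r\<close> is the same as subtracting
    \<open>s\<close>, so the second period follows from the first.\<close>
  have per: "wrap s r (x + (s + r)) = wrap s r x" for x
    by (rule wrap_unique[where k="\<lfloor>(x + s) / (s + r)\<rfloor> + 1"])
      (use s r wrap_bounds[OF s(1) r(1), of x] wrap_eq[of x s r] in \<open>auto simp: algebra_simps\<close>)
  show "AE x in lattice_haar u. h (wrap s r (x + r)) = h (wrap s r x)"
    using AE_lattice_haar_shift[OF 1 w]
  proof eventually_elim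
    fix x assume "h (wrap s r (x + (s + r) - s)) = h (wrap s r (x + (s + r)))"
    then show "h (wrap s r (x + r)) = h (wrap s r x)" unfolding per by simp
  qed
qed

lemma AE_eq_of_common_period:
  assumes q: "0 < q" "q \<in> lattice_set u"
    and f: "AE x in lattice_haar u. f (x + q) = f x" and g: "AE x in lattice_haar u. g (x + q) = g x"
    and eq: "AE x in lattice_haar u. b \<le> x \<and> x < b + q \<longrightarrow> f x = (g x :: 'b)"
  shows "AE x in lattice_haar u. f x = g x"
proof -
  have periodic: "AE x in lattice_haar u. \<forall>k::int. p (x + of_int k * q) = p x"
    if p: "AE x in lattice_haar u. p (x + q) = p x" for p :: "real \<Rightarrow> 'b"
    using AE_countable_shifts[OF p q(2)]
  proof eventually_elim
    fix x assume *: "\<forall>k::int. p (x + of_int k * q + q) = p (x + of_int k * q)"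
    show "\<forall>k::int. p (x + of_int k * q) = p x"
    proof
      fix k :: int
      show "p (x + of_int k * q) = p x"
      proof (induction k rule: int_induct[where k=0])
        case (step1 i)
        then show ?case using *[rule_format, of i] by (simp add: algebra_simps)
      next
        case (step2 i)
        then show ?case using *[rule_format, of "i - 1"] by (simp add: algebra_simps)
      qed simp
    qed
  qed
  show ?thesis
    using periodic[OF f] periodic[OF g] AE_countable_shifts[OF eq q(2)]
  proof eventually_elim
    fix x assume *: "\<forall>k::int. f (x + of_int k * q) = f x" "\<forall>k::int. g (x + of_int k * q) = g x"
      "\<forall>k::int. b \<le> x + of_int k * q \<and> x + of_int k * q < b + q \<longrightarrow> f (x + of_int k * q) = g (x + of_int k * q)"
    define k where "k = - \<lfloor>(x - b) / q\<rfloor>"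
    have "b \<le> x + of_int k * q" "x + of_int k * q < b + q"
      using floor_divide_lower[OF q(1), of "x - b"] floor_divide_upper[OF q(1), of "x - b"]
      by (auto simp: k_def algebra_simps)
    then show "f x = g x" using * by metis
  qed
qed

lemma wrap_id: "0 < s \<Longrightarrow> 0 < r \<Longrightarrow> - s \<le> x \<Longrightarrow> x < r \<Longrightarrow> wrap s r x = x"
  by (rule wrap_unique[where k=0]) auto

text \<open>The points with a null upper tail form an up-set \<open>N\<close>. It is the half-line
  above its least element, or else a countable union of half-lines that start at rational points of
  \<open>N\<close>; in both cases it is null.\<close>

lemma AE_upper_tail_pos:
  fixes A :: "real measure"
  assumes [measurable_cong]: "sets A = sets borel"
  shows "AE r in A. 0 < emeasure A {r..}"
proof -
  have sp: "space A = UNIV" using sets_eq_imp_space_eq[OF assms] by simp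
  define N where "N = {r. emeasure A {r..} = 0}"
  have up: "y \<in> N" if "x \<in> N" "x \<le> y" for x y
    using that emeasure_mono[of "{y..}" "{x..}" A] by (auto simp: N_def assms)
  have "\<exists>C. countable C \<and> C \<subseteq> N \<and> N \<subseteq> (\<Union>x\<in>C. {x..})"
  proof (cases "\<exists>x\<in>N. \<forall>y\<in>N. x \<le> y")
    case True
    then obtain x where "x \<in> N" "\<forall>y\<in>N. x \<le> y" by blast
    then show ?thesis by (intro exI[of _ "{x}"]) auto
  next
    case False
    have "\<exists>q\<in>N \<inter> \<rat>. q \<le> y" if "y \<in> N" for y
    proof -
      from False that obtain x where x: "x \<in> N" "x < y" by (auto simp: not_le)
      then obtain q where "q \<in> \<rat>" "x < q" "q < y" using Rats_dense_in_real by blast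
      then show ?thesis using up[OF x(1), of q] by (intro bexI[of _ q]) auto
    qed
    then show ?thesis
      by (intro exI[of _ "N \<inter> \<rat>"]) (auto intro: countable_subset[OF _ countable_rat])
  qed
  then obtain C where C: "countable C" "C \<subseteq> N" "N \<subseteq> (\<Union>x\<in>C. {x..})" by blast
  have null: "(\<Union>x\<in>C. {x..}) \<in> null_sets A"
    using C by (intro null_sets_UN') (auto simp: N_def assms)
  show ?thesis
    using C(3) by (intro AE_I'[OF null]) (auto simp: sp N_def zero_less_iff_neq_zero)
qed

lemma AE_lower_tail_pos:
  fixes A :: "real measure"
  assumes [measurable_cong]: "sets A = sets borel"
  shows "AE r in A. 0 < emeasure A {..r}"
proof -
  have sp: "space A = UNIV" using sets_eq_imp_space_eq[OF assms] by simp
  have "AE r in distr A borel uminus. 0 < emeasure (distr A borel uminus) {r..}"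
    by (rule AE_upper_tail_pos) simp
  then have "AE r in A. 0 < emeasure (distr A borel uminus) {- r..}"
    by (rule AE_distrD[rotated]) measurable
  moreover have "uminus -` {- r..} = {..r}" for r :: real by auto
  ultimately show ?thesis by (simp add: emeasure_distr sp)
qed

lemma AE_exists:
  assumes "AE x in A. P x" "0 < emeasure A S"
  shows "\<exists>x\<in>S. P x"
proof (rule ccontr)
  assume np: "\<not> (\<exists>x\<in>S. P x)"
  have S: "S \<in> sets A" using assms(2) by (metis emeasure_notin_sets less_irrefl)
  from assms(1) obtain Z where Z: "{x \<in> space A. \<not> P x} \<subseteq> Z" "Z \<in> sets A" "emeasure A Z = 0"
    by (auto elim!: AE_E)
  have "S \<subseteq> Z" using np Z(1) sets.sets_into_space[OF S] by auto
  then have "emeasure A S \<le> emeasure A Z" using Z(2) by (rule emeasure_mono)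
  with Z(3) assms(2) show False by simp
qed

text \<open>The main point: the functions obtained from the different rotations extend the same function on the line,
  whose periods therefore form a group containing almost all values of both laws.\<close>

lemma ladder_invariant_constant:
  fixes D A :: "real measure" and h :: "real \<Rightarrow> real"
  assumes u: "0 \<le> u"
    and [measurable_cong, simp]: "sets D = sets borel" "sets A = sets borel"
    and finD: "finite_measure D" and finA: "finite_measure A"
    and D: "AE t in D. t \<le> 0 \<and> t \<in> lattice_set u" and A: "AE t in A. 0 \<le> t \<and> t \<in> lattice_set u"
    and Dneg: "0 < emeasure D {..<0}" and Apos: "0 < emeasure A {0<..}"
    and h [measurable]: "h \<in> borel_measurable borel" and h01: "\<And>x. 0 \<le> h x" "\<And>x. h x \<le> 1"
    and pos: "AE t in D. AE x in lattice_haar u. 0 \<le> x \<and> 0 < emeasure A {x<..} \<longrightarrow> h (x + t) = h x"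
    and neg: "AE t in A. AE x in lattice_haar u. x < 0 \<and> 0 < emeasure D {..x} \<longrightarrow> h (x + t) = h x"
    and span: "\<And>v. 0 \<le> v \<Longrightarrow> AE t in D. t \<in> lattice_set v \<Longrightarrow> AE t in A. t \<in> lattice_set v \<Longrightarrow> v \<le> u"
  obtains c where "AE x in lattice_haar u. 0 \<le> x \<and> 0 < emeasure A {x<..} \<longrightarrow> h x = c"
    "AE x in lattice_haar u. x < 0 \<and> 0 < emeasure D {..x} \<longrightarrow> h x = c"
proof -
  let ?\<Lambda> = "lattice_haar u"
  interpret D: finite_measure D by fact
  interpret A: finite_measure A by fact
  interpret \<Lambda>: sigma_finite_measure ?\<Lambda> by (rule sigma_finite_lattice_haar)
  interpret AL: pair_sigma_finite A ?\<Lambda> ..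
  interpret DL: pair_sigma_finite D ?\<Lambda> ..
  have spA: "space A = UNIV" "space D = UNIV"
    by (simp_all add: sets_eq_imp_space_eq[of _ borel])
  define goodD where "goodD s \<longleftrightarrow> 0 < s \<longrightarrow> s \<in> lattice_set u \<and>
     (AE x in ?\<Lambda>. 0 \<le> x \<and> 0 < emeasure A {x<..} \<longrightarrow> h (x - s) = h x) \<and> 0 < emeasure D {..- s}" for s
  define goodA where "goodA r \<longleftrightarrow> 0 < r \<longrightarrow> r \<in> lattice_set u \<and>
     (AE x in ?\<Lambda>. x < 0 \<and> 0 < emeasure D {..x} \<longrightarrow> h (x + r) = h x) \<and> 0 < emeasure A {r..}" for r
  have goodD: "AE t in D. goodD (- t)"
    using D pos AE_lower_tail_pos[of D, simplified]
    by eventually_elim (auto simp: goodD_def intro: lattice_uminus)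
  have goodA: "AE r in A. goodA r"
    using A neg AE_upper_tail_pos[of A, simplified]
    by eventually_elim (auto simp: goodA_def)
  have moves: "AE x in ?\<Lambda>. 0 \<le> x \<and> x < r \<longrightarrow> h (x - s) = h x" "AE x in ?\<Lambda>. - s \<le> x \<and> x < 0 \<longrightarrow> h (x + r) = h x"
    if s: "0 < s" "goodD s" and r: "0 < r" "goodA r" for s r
  proof -
    have "0 < emeasure A {x<..}" if "x < r" for x
    proof -
      have "emeasure A {r..} \<le> emeasure A {x<..}" using that by (intro emeasure_mono) auto
      then show ?thesis using r by (auto simp: goodA_def intro: order_less_le_trans)
    qed
    then show "AE x in ?\<Lambda>. 0 \<le> x \<and> x < r \<longrightarrow> h (x - s) = h x"
      using s by (auto simp: goodD_def elim!: eventually_mono)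
    have "0 < emeasure D {..x}" if "- s \<le> x" for x
    proof -
      have "emeasure D {..- s} \<le> emeasure D {..x}" using that by (intro emeasure_mono) auto
      then show ?thesis using s by (auto simp: goodD_def intro: order_less_le_trans)
    qed
    then show "AE x in ?\<Lambda>. - s \<le> x \<and> x < 0 \<longrightarrow> h (x + r) = h x"
      using r by (auto simp: goodA_def elim!: eventually_mono)
  qed
  have lat: "s \<in> lattice_set u" if "0 < s" "goodD s \<or> goodA s" for s
    using that by (auto simp: goodD_def goodA_def)
  note periods = wrap_periods[OF _ lat _ lat moves]
  obtain t0 where "t0 \<in> {..<0}" "goodD (- t0)"
    using AE_exists[OF goodD Dneg] by blast
  then obtain s0 where s0: "0 < s0" "goodD s0" by (intro that[of "- t0"]) auto
  obtain r0 where "r0 \<in> {0<..}" and r0': "goodA r0"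
    using AE_exists[OF goodA Apos] by blast
  then have r0: "0 < r0" "goodA r0" by auto
  define f where "f x = h (wrap s0 r0 x)" for x
  have [measurable]: "wrap s r \<in> borel_measurable borel" for s r
    unfolding wrap_def[abs_def] by measurable
  have [measurable]: "f \<in> borel_measurable borel" unfolding f_def by measurable
  \<comment> \<open>Replacing \<open>s0\<close> by \<open>s\<close> keeps the period
    \<open>r0\<close>, and both wraps are the identity on the full period \<open>[0, r0)\<close>;
    hence the extension does not change. In the same way \<open>r0\<close> may be replaced, with
    period \<open>s0\<close> and the interval \<open>[-s0, 0)\<close>.\<close>
  have f_s: "AE x in ?\<Lambda>. f x = h (wrap s r0 x)" if s: "0 < s" "goodD s" for s
    unfolding f_def
  proof (rule AE_eq_of_common_period[where b=0 and q=r0])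
    show "AE x in ?\<Lambda>. h (wrap s0 r0 (x + r0)) = h (wrap s0 r0 x)" "AE x in ?\<Lambda>. h (wrap s r0 (x + r0)) = h (wrap s r0 x)"
      by (rule periods(2); use s s0 r0 in simp)+
  qed (use s s0 r0 lat in \<open>auto simp: wrap_id\<close>)
  have f_r: "AE x in ?\<Lambda>. f x = h (wrap s0 r x)" if r: "0 < r" "goodA r" for r
    unfolding f_def
  proof (rule AE_eq_of_common_period[where b="- s0" and q=s0])
    have "AE x in ?\<Lambda>. h (wrap s0 r' (x + s0)) = h (wrap s0 r' x)" if r': "0 < r'" "goodA r'" for r'
    proof -
      have "AE x in ?\<Lambda>. h (wrap s0 r' (x - s0)) = h (wrap s0 r' x)"
        by (rule periods(1)) (use r' s0 in simp_all)
      from AE_lattice_haar_shift[OF this, of s0] show ?thesis using lat s0 by (auto elim!: eventually_mono)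
    qed
    then show "AE x in ?\<Lambda>. h (wrap s0 r0 (x + s0)) = h (wrap s0 r0 x)" "AE x in ?\<Lambda>. h (wrap s0 r (x + s0)) = h (wrap s0 r x)"
      using r r0 by auto
  qed (use r s0 r0 lat in \<open>auto simp: wrap_id\<close>)
  define H where "H = {t \<in> lattice_set u. AE x in ?\<Lambda>. f (x + t) = f x}"
  have sH: "s \<in> H" if s: "0 < s" "goodD s" for s
  proof -
    have l: "s \<in> lattice_set u" using lat s by auto
    have "AE x in ?\<Lambda>. h (wrap s r0 (x - s)) = h (wrap s r0 x)"
      by (rule periods(1)) (use s r0 in simp_all)
    from AE_lattice_haar_shift[OF this l] AE_lattice_haar_shift[OF f_s[OF s] l] f_s[OF s]
    have "AE x in ?\<Lambda>. f (x + s) = f x" by eventually_elim simp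
    with l show ?thesis by (simp add: H_def)
  qed
  have rH: "r \<in> H" if r: "0 < r" "goodA r" for r
  proof -
    have l: "r \<in> lattice_set u" using lat r by auto
    have "AE x in ?\<Lambda>. h (wrap s0 r (x + r)) = h (wrap s0 r x)"
      by (rule periods(2)) (use r s0 in simp_all)
    with AE_lattice_haar_shift[OF f_r[OF r] l] f_r[OF r]
    have "AE x in ?\<Lambda>. f (x + r) = f x" by eventually_elim simp
    with l show ?thesis by (simp add: H_def)
  qed
  have H_diff: "x - y \<in> H" if x: "x \<in> H" and y: "y \<in> H" for x y
  proof -
    have l: "- y \<in> lattice_set u" "x + - y \<in> lattice_set u"
      using x y by (auto simp: H_def simp del: add_uminus_conv_diff intro: lattice_add lattice_uminus)
    have "AE z in ?\<Lambda>. f (z + x) = f z" "AE z in ?\<Lambda>. f (z + y) = f z" using x y by (auto simp: H_def)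
    from AE_lattice_haar_shift[OF this(1) l(1)] AE_lattice_haar_shift[OF this(2) l(1)]
    have "AE z in ?\<Lambda>. f (z + (x - y)) = f z" by eventually_elim (simp add: algebra_simps)
    with l show ?thesis by (simp add: H_def)
  qed
  have zeroH: "0 \<in> H" by (simp add: H_def)
  consider v where "0 < v" "v \<in> H" "H \<subseteq> lattice_set v" | "\<forall>e>0. \<exists>t\<in>H. 0 < t \<and> t < e"
    by (rule real_subgroup_cases[OF sH[OF s0] s0(1)]) (use H_diff in blast)+
  then have "\<exists>c. AE x in ?\<Lambda>. f x = c"
  proof cases
    \<comment> \<open>Almost all ladder values lie in \<open>H\<close>, so \<open>span\<close>
      bounds the generator \<open>v\<close> by \<open>u\<close>; as a positive multiple of
      \<open>u\<close> it equals \<open>u\<close>.\<close>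
    case (1 v)
    have "AE t in D. t \<in> lattice_set v"
      using goodD D
    proof eventually_elim
      fix t assume "goodD (- t)" "t \<le> 0 \<and> t \<in> lattice_set u"
      then show "t \<in> lattice_set v"
        using sH[of "- t"] 1(3) lattice_uminus[of "- t" v] by (cases "t = 0") auto
    qed
    moreover have "AE t in A. t \<in> lattice_set v"
      using goodA A
    proof eventually_elim
      fix t assume "goodA t" "0 \<le> t \<and> t \<in> lattice_set u"
      then show "t \<in> lattice_set v"
        using rH[of t] 1(3) by (cases "t = 0") auto
    qed
    ultimately have vu: "v \<le> u" using span 1(1) by simp
    with 1(1) have u_pos: "0 < u" by simp
    obtain k :: int where k: "v = u * of_int k" using 1(2) u_pos by (auto simp: H_def lattice_set_iff)
    have "0 < k" using k 1(1) u_pos by (simp add: zero_less_mult_iff)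
    moreover have "real_of_int k \<le> 1" using k vu u_pos by simp
    ultimately have "v = u" using k by simp
    have step: "f (u * of_int i + u) = f (u * of_int i)" for i :: int
      using 1(2) \<open>v = u\<close> by (intro AE_lattice_haar_iff[OF u_pos, of "\<lambda>x. f (x + u) = f x"]) (auto simp: H_def lattice_set_iff)
    have "f (u * of_int j) = f 0" for j :: int
    proof (induction j rule: int_induct[where k=0])
      case (step1 i)
      then show ?case using step[of i] by (simp add: algebra_simps)
    next
      case (step2 i)
      then show ?case using step[of "i - 1"] by (simp add: algebra_simps)
    qed simp
    then have "AE x in ?\<Lambda>. f x = f 0"
      using AE_lattice_haar[of u] u_pos by (auto simp: lattice_set_iff elim!: eventually_mono)
    then show ?thesis ..
  next
    \<comment> \<open>A discrete lattice has no positive element below \<open>u\<close>, so here the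
      state space is the whole line.\<close>
    case 2
    have "u = 0"
    proof (rule ccontr)
      assume "u \<noteq> 0"
      with u have u_pos: "0 < u" by simp
      then obtain t where t: "t \<in> H" "0 < t" "t < u" using 2 by blast
      then obtain k :: int where "t = u * of_int k" using u_pos by (auto simp: H_def lattice_set_iff)
      with t u_pos have "0 < k" "k < 1" by (auto simp: zero_less_mult_iff)
      then show False by simp
    qed
    then have \<Lambda>_eq: "?\<Lambda> = lborel" by (simp add: lattice_haar_def)
    have "\<exists>t. 0 < t \<and> t < e \<and> (AE x in lborel. f (x + t) = f x)" if e: "0 < e" for e
    proof -
      obtain t where "t \<in> H" "0 < t" "t < e" using 2 e by blast
      then have "AE x in ?\<Lambda>. f (x + t) = f x" by (simp add: H_def)
      with \<open>0 < t\<close> \<open>t < e\<close> show ?thesis unfolding \<Lambda>_eq by blast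
    qed
    then obtain c where "AE x in lborel. f x = c"
      by (rule dense_periods_imp_constant[of f, rotated 3]) (auto simp: f_def h01)
    then show ?thesis unfolding \<Lambda>_eq by blast
  qed
  then obtain c where c: "AE x in ?\<Lambda>. f x = c" by blast
  have pos_c: "AE r in A. AE x in ?\<Lambda>. 0 \<le> x \<and> x < r \<longrightarrow> h x = c"
    using goodA A
  proof eventually_elim
    fix r assume r: "goodA r" "0 \<le> r \<and> r \<in> lattice_set u"
    show "AE x in ?\<Lambda>. 0 \<le> x \<and> x < r \<longrightarrow> h x = c"
    proof (cases "r = 0")
      case False
      with r have r': "0 < r" "goodA r" by auto
      show ?thesis using f_r[OF r'] c
        by eventually_elim (use s0 r' in \<open>auto simp: wrap_id\<close>)
    qed simp
  qed
  have neg_c: "AE t in D. AE x in ?\<Lambda>. t \<le> x \<and> x < 0 \<longrightarrow> h x = c"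
    using goodD D
  proof eventually_elim
    fix t assume t: "goodD (- t)" "t \<le> 0 \<and> t \<in> lattice_set u"
    show "AE x in ?\<Lambda>. t \<le> x \<and> x < 0 \<longrightarrow> h x = c"
    proof (cases "t = 0")
      case False
      with t have t': "0 < - t" "goodD (- t)" by auto
      show ?thesis using f_s[OF t'] c
        by eventually_elim (use r0 t' in \<open>auto simp: wrap_id\<close>)
    qed simp
  qed
  have "{z \<in> space (A \<Otimes>\<^sub>M ?\<Lambda>). 0 \<le> snd z \<and> snd z < fst z \<longrightarrow> h (snd z) = c} \<in> sets (A \<Otimes>\<^sub>M ?\<Lambda>)"
    by measurable
  \<comment> \<open>The quantifiers are exchanged: for almost every \<open>x\<close> the statement
    holds for almost every \<open>r\<close>, and a positive tail beyond \<open>x\<close> supplies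
    one such \<open>r > x\<close>.\<close>
  from AL.AE_commute[OF this, THEN iffD1, OF pos_c]
  have 1: "AE x in ?\<Lambda>. 0 \<le> x \<and> 0 < emeasure A {x<..} \<longrightarrow> h x = c"
  proof eventually_elim
    fix x assume x: "AE r in A. 0 \<le> x \<and> x < r \<longrightarrow> h x = c"
    show "0 \<le> x \<and> 0 < emeasure A {x<..} \<longrightarrow> h x = c"
      using AE_exists[OF x, of "{x<..}"] by auto
  qed
  have "{z \<in> space (D \<Otimes>\<^sub>M ?\<Lambda>). fst z \<le> snd z \<and> snd z < 0 \<longrightarrow> h (snd z) = c} \<in> sets (D \<Otimes>\<^sub>M ?\<Lambda>)"
    by measurable
  from DL.AE_commute[OF this, THEN iffD1, OF neg_c]
  have 2: "AE x in ?\<Lambda>. x < 0 \<and> 0 < emeasure D {..x} \<longrightarrow> h x = c"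
  proof eventually_elim
    fix x assume x: "AE t in D. t \<le> x \<and> x < 0 \<longrightarrow> h x = c"
    show "x < 0 \<and> 0 < emeasure D {..x} \<longrightarrow> h x = c"
      using AE_exists[OF x, of "{..x}"] by auto
  qed
  show thesis using that[OF 1 2] .
qed

section \<open>Invariance of the measure \<open>\<mu>\<close>\<close>

lemma (in prob_space) indep_vars_compose_inj:
  assumes ind: "indep_vars M' X (f ` I)" and inj: "inj_on f I"
  shows "indep_vars (\<lambda>i. M' (f i)) (\<lambda>i. X (f i)) I"
  unfolding indep_vars_def2
proof (intro conjI ballI indep_setsI)
  show "random_variable (M' (f i)) (X (f i))" if "i \<in> I" for i
    using ind that by (auto simp: indep_vars_def2)
  show "{X (f i) -` A \<inter> space M |A. A \<in> sets (M' (f i))} \<subseteq> events" if "i \<in> I" for i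
    using ind that by (auto simp: indep_vars_def2 intro!: measurable_sets)
next
  fix A J
  assume J: "J \<noteq> {}" "J \<subseteq> I" "finite J" and A: "\<forall>j\<in>J. A j \<in> {X (f j) -` A \<inter> space M |A. A \<in> sets (M' (f j))}"
  define B where "B j = A (the_inv_into I f j)" for j
  have B: "B (f j) = A j" if "j \<in> J" for j
    using that J(2) by (auto simp: B_def the_inv_into_f_f[OF inj])
  have injJ: "inj_on f J" using inj J(2) by (rule inj_on_subset)
  have "prob (\<Inter>j\<in>f ` J. B j) = (\<Prod>j\<in>f ` J. prob (B j))"
    using ind J A B unfolding indep_vars_def2 by (intro indep_setsD[of _ "f ` I"]) auto
  moreover have "(\<Inter>j\<in>f ` J. B j) = (\<Inter>j\<in>J. A j)" using B by auto
  moreover have "(\<Prod>j\<in>f ` J. prob (B j)) = (\<Prod>j\<in>J. prob (A j))"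
    using B by (simp add: prod.reindex[OF injJ])
  ultimately show "prob (\<Inter>j\<in>J. A j) = (\<Prod>j\<in>J. prob (A j))" by simp
qed

context step_law
begin

lemma AE_stay_Suc_I:
  assumes [measurable]: "C \<in> sets borel" "Measurable.pred borel P"
    and "AE x in stay C k. AE y in F. x + y \<in> C \<longrightarrow> P (x + y)"
  shows "AE x in stay C (Suc k). P x"
proof -
  have "(\<integral>\<^sup>+x. indicator {x. \<not> P x} x \<partial>stay C (Suc k)) = (\<integral>\<^sup>+x. \<integral>\<^sup>+y. indicator {x. \<not> P x} (x + y) * indicator C (x + y) \<partial>F \<partial>stay C k)"
    by (rule nn_integral_stay_Suc) measurable
  also have "\<dots> = (\<integral>\<^sup>+x. 0 \<partial>stay C k)"
  proof (rule nn_integral_cong_AE)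
    show "AE x in stay C k. (\<integral>\<^sup>+y. indicator {x. \<not> P x} (x + y) * indicator C (x + y) \<partial>F) = 0"
      using assms(3)
    proof eventually_elim
      fix x assume "AE y in F. x + y \<in> C \<longrightarrow> P (x + y)"
      then have "AE y in F. indicator {x. \<not> P x} (x + y) * indicator C (x + y) = (0 :: ennreal)"
        by eventually_elim (auto split: split_indicator)
      then show "(\<integral>\<^sup>+y. indicator {x. \<not> P x} (x + y) * indicator C (x + y) \<partial>F) = 0"
        by (subst nn_integral_0_iff_AE) auto
    qed
  qed
  finally have "(\<integral>\<^sup>+x. indicator {x. \<not> P x} x \<partial>stay C (Suc k)) = 0" by simp
  then show ?thesis by (subst (asm) nn_integral_0_iff_AE) (auto split: split_indicator_asm elim!: eventually_mono)
qed

lemma AE_exit_I: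
  assumes [measurable]: "C \<in> sets borel" "Measurable.pred borel P"
    and "AE x in stay C k. AE y in F. P (x + y)"
  shows "AE x in exit_law C k. P x"
proof -
  have "(\<integral>\<^sup>+x. indicator {x. \<not> P x} x \<partial>exit_law C k) = (\<integral>\<^sup>+x. \<integral>\<^sup>+y. indicator {x. \<not> P x} (x + y) * indicator (-C) (x + y) \<partial>F \<partial>stay C k)"
    by (rule nn_integral_exit_law) measurable
  also have "\<dots> = (\<integral>\<^sup>+x. 0 \<partial>stay C k)"
  proof (rule nn_integral_cong_AE)
    show "AE x in stay C k. (\<integral>\<^sup>+y. indicator {x. \<not> P x} (x + y) * indicator (-C) (x + y) \<partial>F) = 0"
      using assms(3)
    proof eventually_elim
      fix x assume "AE y in F. P (x + y)"
      then have "AE y in F. indicator {x. \<not> P x} (x + y) * indicator (-C) (x + y) = (0 :: ennreal)"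
        by eventually_elim (auto split: split_indicator)
      then show "(\<integral>\<^sup>+y. indicator {x. \<not> P x} (x + y) * indicator (-C) (x + y) \<partial>F) = 0"
        by (subst nn_integral_0_iff_AE) auto
    qed
  qed
  finally have "(\<integral>\<^sup>+x. indicator {x. \<not> P x} x \<partial>exit_law C k) = 0" by simp
  then show ?thesis by (subst (asm) nn_integral_0_iff_AE) (auto split: split_indicator_asm elim!: eventually_mono)
qed

end

context half_line_step
begin

lemma AE_laws_I:
  assumes P [measurable]: "Measurable.pred borel P" and P0: "P 0"
    and step: "\<And>k. AE x in stay C k. P x \<longrightarrow> (AE y in F. P (x + y))"
  shows "AE x in stay C k. P x" "AE x in occupation. P x" "AE x in leave_law. P x"
proof -
  have stay: "AE x in stay C k. P x" for k
  proof (induction k)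
    case 0
    show ?case using P0 unfolding stay.simps(1) by (subst AE_return) auto
  next
    case (Suc k)
    show ?case
      by (rule AE_stay_Suc_I[OF C_borel P]) (use Suc step[of k] in eventually_elim, auto elim!: eventually_mono)
  qed
  then show "AE x in stay C k. P x" .
  show "AE x in occupation. P x"
    unfolding occupation_def by (rule AE_series_measure[OF _ stay P]) simp
  have "AE x in exit_law C k. P x" for k
    by (rule AE_exit_I[OF C_borel P]) (use stay[of k] step[of k] in eventually_elim, simp)
  then show "AE x in leave_law. P x"
    unfolding leave_law_def by (intro AE_series_measure P) simp_all
qed

lemma AE_laws_closed:
  assumes [measurable]: "H \<in> sets borel" and "0 \<in> H" "\<And>x y. x \<in> H \<Longrightarrow> y \<in> H \<Longrightarrow> x + y \<in> H" and "AE x in F. x \<in> H"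
  shows "AE x in stay C k. x \<in> H" "AE x in occupation. x \<in> H" "AE x in leave_law. x \<in> H"
proof -
  have P: "Measurable.pred borel (\<lambda>x. x \<in> H)" by measurable
  have step: "AE x in stay C k. x \<in> H \<longrightarrow> (AE y in F. x + y \<in> H)" for k
  proof (rule AE_I2, rule impI)
    fix x assume "x \<in> H"
    show "AE y in F. x + y \<in> H" using assms(4) by eventually_elim (rule assms(3)[OF \<open>x \<in> H\<close>])
  qed
  show "AE x in stay C k. x \<in> H" "AE x in occupation. x \<in> H" "AE x in leave_law. x \<in> H"
    by (rule AE_laws_I[OF P assms(2) step])+
qed

lemma nn_integral_occupation_split:
  assumes [measurable]: "f \<in> borel_measurable borel"
  shows "(\<integral>\<^sup>+x. f x \<partial>occupation) = f 0 + (\<Sum>k. \<integral>\<^sup>+x. f x \<partial>stay C (Suc k))"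
  unfolding nn_integral_laws(3)[OF assms]
  by (subst suminf_offset[where i=1]) (simp_all add: add.commute del: stay.simps(1))

text \<open>The balance of \<open>occupation_step\<close>, averaged over starting points from
  \<open>\<rho>\<close>. The excursion ends when the displacement, not the position, leaves
  \<open>C\<close>.\<close>

lemma excursion_step:
  assumes \<rho>: "sigma_finite_measure \<rho>" and [measurable_cong]: "sets \<rho> = sets borel"
    and [measurable]: "f \<in> borel_measurable borel"
  shows "(\<integral>\<^sup>+x. \<integral>\<^sup>+y. f (x + y) \<partial>F \<partial>(occupation \<star> \<rho>)) + (\<integral>\<^sup>+x. f x \<partial>\<rho>) =
     (\<integral>\<^sup>+x. f x \<partial>(occupation \<star> \<rho>)) + (\<integral>\<^sup>+t. \<integral>\<^sup>+x. f (x + t) \<partial>\<rho> \<partial>leave_law)"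
proof -
  interpret \<rho>: sigma_finite_measure \<rho> by fact
  interpret P: pair_sigma_finite F \<rho> ..
  define \<phi> where "\<phi> y = (\<integral>\<^sup>+x. f (y + x) \<partial>\<rho>)" for y
  have [measurable]: "\<phi> \<in> borel_measurable borel" unfolding \<phi>_def by measurable
  have "(\<integral>\<^sup>+z. \<phi> (y + z) \<partial>F) = (\<integral>\<^sup>+x. \<integral>\<^sup>+z. f (y + x + z) \<partial>F \<partial>\<rho>)" for y
    unfolding \<phi>_def by (subst P.Fubini'[symmetric]) (simp_all add: ac_simps)
  then have "(\<integral>\<^sup>+x. \<integral>\<^sup>+y. f (x + y) \<partial>F \<partial>(occupation \<star> \<rho>)) = (\<integral>\<^sup>+y. \<integral>\<^sup>+z. \<phi> (y + z) \<partial>F \<partial>occupation)"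
    by (subst nn_integral_convolution_sigma_finite[OF \<rho>]) (simp_all add: assms)
  moreover have "(\<integral>\<^sup>+x. f x \<partial>(occupation \<star> \<rho>)) = (\<integral>\<^sup>+y. \<phi> y \<partial>occupation)"
    unfolding \<phi>_def by (rule nn_integral_convolution_sigma_finite[OF \<rho>]) (simp_all add: assms)
  moreover have "\<phi> 0 = (\<integral>\<^sup>+x. f x \<partial>\<rho>)" "(\<integral>\<^sup>+t. \<phi> t \<partial>leave_law) = (\<integral>\<^sup>+t. \<integral>\<^sup>+x. f (x + t) \<partial>\<rho> \<partial>leave_law)"
    by (simp_all add: \<phi>_def add.commute)
  ultimately show ?thesis using occupation_step[of \<phi>] by simp
qed

end

context switching_random_walk
begin

section \<open>The ladder laws and renewal measures of the two walks\<close>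

lemma indep_walks: "indep_vars (\<lambda>_. borel) X {1..}" "indep_vars (\<lambda>_. borel) X' {1..}"
proof -
  have "indep_vars (\<lambda>_. borel) (case_sum X X') (Inl ` {1..})"
    using indep by (rule indep_vars_subset) auto
  from indep_vars_compose_inj[OF this] show "indep_vars (\<lambda>_. borel) X {1..}" by simp
  have "indep_vars (\<lambda>_. borel) (case_sum X X') (Inr ` {1..})"
    using indep by (rule indep_vars_subset) auto
  from indep_vars_compose_inj[OF this] show "indep_vars (\<lambda>_. borel) X' {1..}" by simp
qed

sublocale W: iid_walk M X
  by (intro iid_walk.intro iid_walk_axioms.intro prob_space_axioms indep_walks(1) ident)

sublocale W': iid_walk M X'
  by (intro iid_walk.intro iid_walk_axioms.intro prob_space_axioms indep_walks(2) ident')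

text \<open>\<open>E\<close> describes excursions of \<open>S\<close> above their start, ended by
  the ladder height \<open>D\<close>; \<open>E'\<close> describes excursions of \<open>S'\<close>
  below their start, ended by \<open>A'\<close>.\<close>

sublocale E: half_line_step W.F "{0<..}"
  by unfold_locales auto

sublocale E': half_line_step W'.F "{..<0}"
  by unfold_locales auto

lemma law_D_eq: "law_D = E.leave_law"
proof -
  have "- {..0::real} = {0<..}" by auto
  then show ?thesis unfolding law_D_def E.leave_law_def by (subst W.ladder_law_eq) simp_all
qed

lemma law_A'_eq: "law_A' = E'.leave_law"
proof -
  have "- {0..} = {..<0::real}" by auto
  then show ?thesis unfolding law_A'_def E'.leave_law_def by (subst W'.ladder_law_eq) simp_all
qed

lemma U_pos_eq: "U_pos = E.occupation"
  unfolding U_pos_def E.occupation_eq_renewal E.entry_law_def by (subst W.ladder_law_eq) simp_all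

lemma U_neg'_eq: "U_neg' = E'.occupation"
  unfolding U_neg'_def E'.occupation_eq_renewal E'.entry_law_def by (subst W'.ladder_law_eq) simp_all

lemma AE_F_Z: "AE x in W.F. x \<in> Z" "AE x in W'.F. x \<in> Z"
  unfolding W.F_def W'.F_def using AE_Z by (auto simp: AE_distr_iff)

lemma AE_in_Z:
  "AE x in W.F.stay {0<..} k. x \<in> Z" "AE x in E.occupation. x \<in> Z" "AE x in law_D. x \<in> Z"
  "AE x in W'.F.stay {..<0} k. x \<in> Z" "AE x in E'.occupation. x \<in> Z" "AE x in law_A'. x \<in> Z"
  unfolding law_D_eq law_A'_eq
  using E.AE_laws_closed[OF Z_borel Z_0 Z_add AE_F_Z(1)] E'.AE_laws_closed[OF Z_borel Z_0 Z_add AE_F_Z(2)] by auto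

lemma sets_ladder_laws [measurable_cong, simp]: "sets law_D = sets borel" "sets law_A' = sets borel"
  by (simp_all add: law_D_eq law_A'_eq)

lemma space_ladder_laws [simp]: "space law_D = UNIV" "space law_A' = UNIV"
  by (simp_all add: law_D_eq law_A'_eq)

lemma AE_ladder_sign: "AE t in law_D. t \<le> 0" "AE t in law_A'. 0 \<le> t"
  unfolding law_D_eq law_A'_eq using E.AE_leave_law E'.AE_leave_law by (auto elim!: eventually_mono)

end

section \<open>Proper ladder laws, their span, and the density of \<open>\<nu>\<close>\<close>

locale recurrent_switching_walk = switching_random_walk +
  assumes liminf_walk: "AE \<omega> in M. liminf (\<lambda>n. ereal (walk X n \<omega>)) = -\<infinity>"
    and limsup_walk: "AE \<omega> in M. limsup (\<lambda>n. ereal (walk X' n \<omega>)) = \<infinity>"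
begin

lemma emeasure_law_D: "emeasure law_D UNIV = 1"
  unfolding law_D_def
proof (rule W.emeasure_ladder_law_UNIV)
  show "AE \<omega> in M. \<exists>k\<ge>1. walk X k \<omega> \<in> {..0}"
    using liminf_walk
  proof eventually_elim
    fix \<omega> assume l: "liminf (\<lambda>n. ereal (walk X n \<omega>)) = -\<infinity>"
    show "\<exists>k\<ge>1. walk X k \<omega> \<in> {..0}"
    proof (rule ccontr)
      assume no: "\<not> (\<exists>k\<ge>1. walk X k \<omega> \<in> {..0})"
      have "0 \<le> ereal (walk X n \<omega>)" if n: "1 \<le> n" for n
      proof -
        have "walk X n \<omega> \<notin> {..0}" using no n by blast
        then show ?thesis by simp
      qed
      then have "\<forall>\<^sub>F n in sequentially. 0 \<le> ereal (walk X n \<omega>)"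
        by (rule eventually_sequentiallyI)
      then have "0 \<le> liminf (\<lambda>n. ereal (walk X n \<omega>))" by (rule Liminf_bounded)
      with l show False by simp
    qed
  qed
qed auto

lemma emeasure_law_A': "emeasure law_A' UNIV = 1"
  unfolding law_A'_def
proof (rule W'.emeasure_ladder_law_UNIV)
  show "AE \<omega> in M. \<exists>k\<ge>1. walk X' k \<omega> \<in> {0..}"
    using limsup_walk
  proof eventually_elim
    fix \<omega> assume l: "limsup (\<lambda>n. ereal (walk X' n \<omega>)) = \<infinity>"
    show "\<exists>k\<ge>1. walk X' k \<omega> \<in> {0..}"
    proof (rule ccontr)
      assume no: "\<not> (\<exists>k\<ge>1. walk X' k \<omega> \<in> {0..})"
      have "ereal (walk X' n \<omega>) \<le> 0" if n: "1 \<le> n" for n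
      proof -
        have "walk X' n \<omega> \<notin> {0..}" using no n by blast
        then show ?thesis by simp
      qed
      then have "\<forall>\<^sub>F n in sequentially. ereal (walk X' n \<omega>) \<le> 0"
        by (rule eventually_sequentiallyI)
      then have "limsup (\<lambda>n. ereal (walk X' n \<omega>)) \<le> 0" by (rule Limsup_bounded)
      with l show False by simp
    qed
  qed
qed auto

sublocale D: prob_space law_D
  by (rule prob_spaceI) (simp add: emeasure_law_D)

sublocale A': prob_space law_A'
  by (rule prob_spaceI) (simp add: emeasure_law_A')

lemma step_in_subgroup_D:
  assumes "H \<in> sets borel" "\<And>x y. x \<in> H \<Longrightarrow> x + y \<in> H \<longleftrightarrow> y \<in> H" "AE t in law_D. t \<in> H"
  shows "AE \<omega> in M. X 1 \<omega> \<in> H"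
proof -
  have "AE x in W.F. x \<in> H"
    by (rule E.step_in_subgroup[of 1, OF _ _ assms(1,2) assms(3)[unfolded law_D_eq]])
      (use emeasure_law_D in \<open>simp_all add: law_D_eq\<close>)
  then show ?thesis unfolding W.F_def by (subst (asm) AE_distr_iff) (use assms(1) in auto)
qed

lemma step_in_subgroup_A':
  assumes "H \<in> sets borel" "\<And>x y. x \<in> H \<Longrightarrow> x + y \<in> H \<longleftrightarrow> y \<in> H" "AE t in law_A'. t \<in> H"
  shows "AE \<omega> in M. X' 1 \<omega> \<in> H"
proof -
  have "AE x in W'.F. x \<in> H"
    by (rule E'.step_in_subgroup[of "-1", OF _ _ assms(1,2) assms(3)[unfolded law_A'_eq]])
      (use emeasure_law_A' in \<open>simp_all add: law_A'_eq\<close>)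
  then show ?thesis unfolding W'.F_def by (subst (asm) AE_distr_iff) (use assms(1) in auto)
qed

text \<open>Otherwise \<open>D = 0\<close> almost surely, and \<open>step_in_subgroup_D\<close> with
  the trivial group \<open>{0}\<close> would make \<open>X_1\<close> vanish almost surely.\<close>

lemma p_pos: "0 < p"
proof (rule ccontr)
  assume "\<not> 0 < p"
  then have "D.prob {..<0} = 0" using measure_nonneg[of law_D "{..<0}"] by (simp add: p_def)
  then have "AE t in law_D. t \<notin> {..<0}" by (subst (asm) D.prob_eq_0) auto
  with AE_ladder_sign(1) have "AE t in law_D. t \<in> {0}" by eventually_elim auto
  then have "AE \<omega> in M. X 1 \<omega> \<in> {0}" by (rule step_in_subgroup_D[rotated 2]) auto
  with nonzero show False by simp
qed

lemma p'_pos: "0 < p'"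
proof (rule ccontr)
  assume "\<not> 0 < p'"
  then have "A'.prob {0<..} = 0" using measure_nonneg[of law_A' "{0<..}"] by (simp add: p'_def)
  then have "AE t in law_A'. t \<notin> {0<..}" by (subst (asm) A'.prob_eq_0) auto
  with AE_ladder_sign(2) have "AE t in law_A'. t \<in> {0}" by eventually_elim auto
  then have "AE \<omega> in M. X' 1 \<omega> \<in> {0}" by (rule step_in_subgroup_A'[rotated 2]) auto
  with nonzero' show False by simp
qed

text \<open>By the Wiener-Hopf argument a lattice that carries both ladder heights also carries the
  steps, so the maximality of \<open>max_span\<close> applies to it.\<close>

lemma ladder_span:
  assumes v: "0 \<le> v" and "AE t in law_D. t \<in> lattice_set v" "AE t in law_A'. t \<in> lattice_set v"
  shows "v \<le> max_span"
proof -
  have X: "AE \<omega> in M. X 1 \<omega> \<in> lattice_set v" "AE \<omega> in M. X' 1 \<omega> \<in> lattice_set v"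
    using step_in_subgroup_D[OF lattice_set_borel lattice_add_iff assms(2)]
      step_in_subgroup_A'[OF lattice_set_borel lattice_add_iff assms(3)] by auto
  obtain d where d: "0 \<le> d"
      "(AE \<omega> in M. X 1 \<omega> \<in> lattice_set d) \<and> (AE \<omega> in M. X' 1 \<omega> \<in> lattice_set d)"
      "\<And>u. 0 \<le> u \<and> (AE \<omega> in M. X 1 \<omega> \<in> lattice_set u) \<and> (AE \<omega> in M. X' 1 \<omega> \<in> lattice_set u) \<Longrightarrow> u \<le> d"
    using max_span_exists by blast
  have "max_span = d"
    unfolding max_span_def AE_lattice_iff by (rule Greatest_equality) (use d in blast)+
  with d X v show ?thesis by blast
qed

definition norm_const :: real where
  "norm_const = p * \<alpha> + p' * (1 - \<alpha>)"

lemma norm_const_pos: "0 < norm_const"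
proof (cases "\<alpha> = 0")
  case False
  then have "0 < p * \<alpha>" "0 \<le> p' * (1 - \<alpha>)" using p_pos p'_pos alpha by auto
  then show ?thesis by (simp add: norm_const_def)
next
  case True
  show ?thesis unfolding norm_const_def using p'_pos True by simp
qed

lemma a_eq: "a * norm_const = p * \<alpha>" "(1 - a) * norm_const = p' * (1 - \<alpha>)"
proof -
  show 1: "a * norm_const = p * \<alpha>" using norm_const_pos by (simp add: a_def norm_const_def)
  have "(1 - a) * norm_const = norm_const - a * norm_const" by (simp add: algebra_simps)
  then show "(1 - a) * norm_const = p' * (1 - \<alpha>)" unfolding 1 by (simp add: norm_const_def)
qed

lemma a_bounds: "0 \<le> a" "a \<le> 1"
proof -
  have "0 \<le> a * norm_const" "0 \<le> (1 - a) * norm_const"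
    unfolding a_eq using p_pos p'_pos alpha by auto
  then show "0 \<le> a" "a \<le> 1" using norm_const_pos by (auto simp: zero_le_mult_iff)
qed

text \<open>The density of \<open>\<nu>\<close>; it equals \<open>P(A' > x) + (1 - a) P(A' = x)\<close> to the right of the origin and
  \<open>P(D < x) + a P(D = x)\<close> to the left of it.\<close>

definition dens :: "real \<Rightarrow> real" where
  "dens x = measure law_D {..<x} + measure law_A' {x<..} - 1 + a * measure law_D {x} + (1 - a) * measure law_A' {x}"

lemma measure_D_simps:
  "0 < x \<Longrightarrow> measure law_D {..<x} = 1" "0 < x \<Longrightarrow> measure law_D {x} = 0" "measure law_D {0} = 1 - p"
proof -
  show "measure law_D {..<x} = 1" if "0 < x"
    using AE_ladder_sign(1) that by (subst D.prob_eq_1) (auto elim!: eventually_mono)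
  show "measure law_D {x} = 0" if "0 < x"
    using AE_ladder_sign(1) that by (subst D.prob_eq_0) (auto elim!: eventually_mono)
  have "D.prob {..<0} + D.prob {0} = D.prob ({..<0} \<union> {0})"
    by (rule D.finite_measure_Union[symmetric]) auto
  also have "\<dots> = 1"
    using AE_ladder_sign(1) by (subst D.prob_eq_1) (auto elim!: eventually_mono)
  finally show "measure law_D {0} = 1 - p" by (simp add: p_def)
qed

lemma measure_A'_simps:
  "x < 0 \<Longrightarrow> measure law_A' {x<..} = 1" "x < 0 \<Longrightarrow> measure law_A' {x} = 0" "measure law_A' {0} = 1 - p'"
proof -
  show "measure law_A' {x<..} = 1" if "x < 0"
    using AE_ladder_sign(2) that by (subst A'.prob_eq_1) (auto elim!: eventually_mono)
  show "measure law_A' {x} = 0" if "x < 0"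
    using AE_ladder_sign(2) that by (subst A'.prob_eq_0) (auto elim!: eventually_mono)
  have "A'.prob {0<..} + A'.prob {0} = A'.prob ({0<..} \<union> {0})"
    by (rule A'.finite_measure_Union[symmetric]) auto
  also have "\<dots> = 1"
    using AE_ladder_sign(2) by (subst A'.prob_eq_1) (auto elim!: eventually_mono)
  finally show "measure law_A' {0} = 1 - p'" by (simp add: p'_def)
qed

lemma dens_pos_eq: "0 < x \<Longrightarrow> dens x = measure law_A' {x<..} + (1 - a) * measure law_A' {x}"
  and dens_neg_eq: "x < 0 \<Longrightarrow> dens x = measure law_D {..<x} + a * measure law_D {x}"
  and dens_0: "dens 0 = p * p' / norm_const"
proof -
  show "0 < x \<Longrightarrow> dens x = measure law_A' {x<..} + (1 - a) * measure law_A' {x}"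
    by (simp add: dens_def measure_D_simps)
  show "x < 0 \<Longrightarrow> dens x = measure law_D {..<x} + a * measure law_D {x}"
    by (simp add: dens_def measure_A'_simps)
  have "dens 0 = (1 - a) * p + a * p'"
    by (simp add: dens_def measure_D_simps measure_A'_simps p_def[symmetric] p'_def[symmetric] algebra_simps)
  then have "dens 0 * norm_const = ((1 - a) * norm_const) * p + (a * norm_const) * p'"
    by algebra
  also have "\<dots> = p * p'" unfolding a_eq by (simp add: algebra_simps)
  finally show "dens 0 = p * p' / norm_const"
    using norm_const_pos by (simp add: field_simps)
qed

lemma dens_0_pos: "0 < dens 0"
  using p_pos p'_pos norm_const_pos by (simp add: dens_0)

text \<open>These equations explain the value of \<open>a\<close>: they express the two shares of
  the origin in \<open>\<nu>\<close> through the ladder laws in such a way that the atoms balance in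
  \<open>ladder_density_invariant\<close>.\<close>

lemma alpha_dens_0: "\<alpha> * dens 0 = a * p'" "(1 - \<alpha>) * dens 0 = (1 - a) * p"
proof -
  have dn: "dens 0 * norm_const = p * p'" using norm_const_pos by (simp add: dens_0)
  have "(\<alpha> * dens 0) * norm_const = (a * p') * norm_const"
    using dn a_eq(1) by algebra
  then show "\<alpha> * dens 0 = a * p'" using norm_const_pos by simp
  have "((1 - \<alpha>) * dens 0) * norm_const = ((1 - a) * p) * norm_const"
    using dn a_eq(2) by algebra
  then show "(1 - \<alpha>) * dens 0 = (1 - a) * p" using norm_const_pos by simp
qed

lemma dens_le: "dens x \<le> 2"
proof -
  have "a * measure law_D {x} \<le> a * 1" "(1 - a) * measure law_A' {x} \<le> (1 - a) * 1"
    using a_bounds by (intro mult_left_mono D.prob_le_1 A'.prob_le_1; simp)+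
  then have "dens x \<le> 1 + 1 - 1 + a * 1 + (1 - a) * 1"
    unfolding dens_def by (intro add_mono diff_mono D.prob_le_1 A'.prob_le_1) auto
  then show ?thesis by simp
qed

lemma measurable_dens [measurable]: "dens \<in> borel_measurable borel"
proof -
  have [measurable]: "(\<lambda>x. emeasure law_D {..<x}) \<in> borel_measurable borel"
    by (rule D.measurable_emeasure) (simp_all only: lessThan_iff, simp, measurable)
  have [measurable]: "(\<lambda>x. emeasure law_D {x}) \<in> borel_measurable borel"
    by (rule D.measurable_emeasure) (simp_all only: singleton_iff, simp, measurable)
  have [measurable]: "(\<lambda>x. emeasure law_A' {x<..}) \<in> borel_measurable borel"
    by (rule A'.measurable_emeasure) (simp_all only: greaterThan_iff, simp, measurable)
  have [measurable]: "(\<lambda>x. emeasure law_A' {x}) \<in> borel_measurable borel"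
    by (rule A'.measurable_emeasure) (simp_all only: singleton_iff, simp, measurable)
  show ?thesis unfolding dens_def[abs_def] measure_def by measurable
qed

lemma \<nu>_eq: "\<nu> = density (lattice_haar max_span) (\<lambda>x. ennreal (dens x))"
  by (simp add: \<nu>_def dens_def)

end

context half_line_step
begin

text \<open>Only the starting point feels the difference between \<open>u\<close> and
  \<open>v\<close>; all later visits contribute the same amount \<open>r\<close>, possibly infinite.
  This separates a start at the origin, where \<open>Y\<close> chooses between two step laws, from
  the rest of the excursion.\<close>

lemma nn_integral_occupation_convolution:
  assumes \<rho>: "sigma_finite_measure \<rho>" and [measurable_cong]: "sets \<rho> = sets borel"
    and [measurable]: "u \<in> borel_measurable borel" "v \<in> borel_measurable borel"
    and eq: "AE x in \<rho>. \<forall>y\<in>C. u (y + x) = v (y + x)"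
  obtains r where "(\<integral>\<^sup>+x. u x \<partial>(occupation \<star> \<rho>)) = (\<integral>\<^sup>+x. u x \<partial>\<rho>) + r"
    "(\<integral>\<^sup>+x. v x \<partial>(occupation \<star> \<rho>)) = (\<integral>\<^sup>+x. v x \<partial>\<rho>) + r"
proof -
  interpret \<rho>: sigma_finite_measure \<rho> by fact
  have split: "(\<integral>\<^sup>+x. w x \<partial>(occupation \<star> \<rho>)) = (\<integral>\<^sup>+x. w x \<partial>\<rho>) + (\<Sum>k. \<integral>\<^sup>+y. \<integral>\<^sup>+x. w (y + x) \<partial>\<rho> \<partial>stay C (Suc k))"
    if [measurable]: "w \<in> borel_measurable borel" for w
    by (subst nn_integral_convolution_sigma_finite[OF \<rho>]) (simp_all add: assms nn_integral_occupation_split)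
  have "(\<integral>\<^sup>+y. \<integral>\<^sup>+x. u (y + x) \<partial>\<rho> \<partial>stay C (Suc k)) = (\<integral>\<^sup>+y. \<integral>\<^sup>+x. v (y + x) \<partial>\<rho> \<partial>stay C (Suc k))" for k
  proof (rule nn_integral_cong_AE)
    show "AE y in stay C (Suc k). (\<integral>\<^sup>+x. u (y + x) \<partial>\<rho>) = (\<integral>\<^sup>+x. v (y + x) \<partial>\<rho>)"
      using AE_stay_Suc[OF C_borel]
    proof eventually_elim
      fix y assume "y \<in> C"
      show "(\<integral>\<^sup>+x. u (y + x) \<partial>\<rho>) = (\<integral>\<^sup>+x. v (y + x) \<partial>\<rho>)"
        using eq by (intro nn_integral_cong_AE, eventually_elim) (simp add: \<open>y \<in> C\<close>)
    qed
  qed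
  then show thesis
    using split[of u] split[of v] by (intro that[of "\<Sum>k. \<integral>\<^sup>+y. \<integral>\<^sup>+x. v (y + x) \<partial>\<rho> \<partial>stay C (Suc k)"]) simp_all
qed

text \<open>A property holds almost everywhere for the occupation measure if and only if it holds
  along almost every excursion. Treating each \<open>stay C k\<close> separately allows Fubini with
  a finite measure.\<close>

lemma AE_occupation_convolution_iff:
  assumes \<rho>: "sigma_finite_measure \<rho>" and [measurable_cong]: "sets \<rho> = sets borel"
    and P [measurable]: "Measurable.pred borel P"
  shows "(AE z in occupation \<star> \<rho>. P z) \<longleftrightarrow> (AE x in \<rho>. \<forall>k. AE y in stay C k. P (x + y))"
proof -
  interpret \<rho>: sigma_finite_measure \<rho> by fact
  have sp: "space \<rho> = UNIV" using sets_eq_imp_space_eq[OF assms(2)] by simp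
  have "(AE z in occupation \<star> \<rho>. P z) \<longleftrightarrow> (\<integral>\<^sup>+z. indicator {z. \<not> P z} z \<partial>(occupation \<star> \<rho>)) = 0"
    by (subst nn_integral_0_iff_AE) (auto split: split_indicator intro!: arg_cong2[where f=eventually])
  also have "(\<integral>\<^sup>+z. indicator {z. \<not> P z} z \<partial>(occupation \<star> \<rho>)) = (\<Sum>k. \<integral>\<^sup>+y. \<integral>\<^sup>+x. indicator {z. \<not> P z} (y + x) \<partial>\<rho> \<partial>stay C k)"
    by (subst nn_integral_convolution_sigma_finite[OF \<rho>]) (simp_all add: assms nn_integral_laws)
  also have "\<dots> = 0 \<longleftrightarrow> (\<forall>k. (\<integral>\<^sup>+y. \<integral>\<^sup>+x. indicator {z. \<not> P z} (y + x) \<partial>\<rho> \<partial>stay C k) = 0)"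
    by (simp add: suminf_eq_zero_iff)
  also have "\<dots> \<longleftrightarrow> (\<forall>k. AE x in \<rho>. AE y in stay C k. P (x + y))"
  proof (intro arg_cong[where f=All] ext)
    fix k
    interpret S: finite_measure "stay C k" by simp
    interpret P: pair_sigma_finite "stay C k" \<rho> ..
    have "(\<integral>\<^sup>+y. \<integral>\<^sup>+x. indicator {z. \<not> P z} (y + x) \<partial>\<rho> \<partial>stay C k) = (\<integral>\<^sup>+x. \<integral>\<^sup>+y. indicator {z. \<not> P z} (y + x) \<partial>stay C k \<partial>\<rho>)"
      by (rule P.Fubini'[symmetric]) measurable
    also have "\<dots> = 0 \<longleftrightarrow> (AE x in \<rho>. (\<integral>\<^sup>+y. indicator {z. \<not> P z} (y + x) \<partial>stay C k) = 0)"
      by (rule nn_integral_0_iff_AE) measurable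
    also have "(\<lambda>x. (\<integral>\<^sup>+y. indicator {z. \<not> P z} (y + x) \<partial>stay C k) = 0) = (\<lambda>x. AE y in stay C k. P (x + y))"
    proof
      fix x
      have "(\<integral>\<^sup>+y. indicator {z. \<not> P z} (y + x) \<partial>stay C k) = 0 \<longleftrightarrow> (AE y in stay C k. indicator {z. \<not> P z} (y + x) = (0 :: ennreal))"
        by (rule nn_integral_0_iff_AE) measurable
      also have "(\<lambda>y. indicator {z. \<not> P z} (y + x) = (0 :: ennreal)) = (\<lambda>y. P (x + y))"
        by (auto simp: fun_eq_iff add.commute split: split_indicator)
      finally show "((\<integral>\<^sup>+y. indicator {z. \<not> P z} (y + x) \<partial>stay C k) = 0) = (AE y in stay C k. P (x + y))" .
    qed
    finally show "((\<integral>\<^sup>+y. \<integral>\<^sup>+x. indicator {z. \<not> P z} (y + x) \<partial>\<rho> \<partial>stay C k) = 0) = (AE x in \<rho>. AE y in stay C k. P (x + y))" .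
  qed
  also have "\<dots> \<longleftrightarrow> (AE x in \<rho>. \<forall>k. AE y in stay C k. P (x + y))"
    by (rule AE_all_countable[symmetric])
  finally show ?thesis .
qed

end

context recurrent_switching_walk
begin

section \<open>Invariance of \<open>\<nu>\<close> for the ladder chain\<close>

definition wpos :: "real \<Rightarrow> ennreal" where
  "wpos x = ennreal (indicator {0<..} x + \<alpha> * indicator {0} x)"

definition wneg :: "real \<Rightarrow> ennreal" where
  "wneg x = ennreal (indicator {..<0} x + (1 - \<alpha>) * indicator {0} x)"

lemma measurable_weights [measurable]: "wpos \<in> borel_measurable borel" "wneg \<in> borel_measurable borel"
  unfolding wpos_def[abs_def] wneg_def[abs_def] by measurable

lemma weights_sum: "wpos x + wneg x = 1"
  using alpha by (cases x "0 :: real" rule: linorder_cases)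
    (auto simp: wpos_def wneg_def ennreal_plus[symmetric] simp del: ennreal_plus)

lemma weight_simps:
  "0 < x \<Longrightarrow> wpos x = 1" "x < 0 \<Longrightarrow> wpos x = 0" "wpos 0 = ennreal \<alpha>"
  "x < 0 \<Longrightarrow> wneg x = 1" "0 < x \<Longrightarrow> wneg x = 0" "wneg 0 = ennreal (1 - \<alpha>)"
  by (auto simp: wpos_def wneg_def)

abbreviation \<Lambda> :: "real measure" where
  "\<Lambda> \<equiv> lattice_haar max_span"

abbreviation \<nu>pos :: "real measure" where
  "\<nu>pos \<equiv> part_pos \<alpha> \<nu>"

abbreviation \<nu>neg :: "real measure" where
  "\<nu>neg \<equiv> part_neg \<alpha> \<nu>"

lemma part_eq: "\<nu>pos = density \<nu> wpos" "\<nu>neg = density \<nu> wneg"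
  by (auto simp: part_pos_def part_neg_def wpos_def[abs_def] wneg_def[abs_def])

lemma sets_\<nu> [measurable_cong, simp]: "sets \<nu> = sets borel" "sets \<nu>pos = sets borel" "sets \<nu>neg = sets borel"
  unfolding part_eq by (simp_all add: \<nu>_eq)

lemma sigma_finite_\<nu>: "sigma_finite_measure \<nu>" "sigma_finite_measure \<nu>pos" "sigma_finite_measure \<nu>neg"
proof -
  interpret L: sigma_finite_measure \<Lambda> by (rule sigma_finite_lattice_haar)
  show \<nu>: "sigma_finite_measure \<nu>"
    unfolding \<nu>_eq by (subst L.sigma_finite_iff_density_finite) auto
  then interpret \<nu>: sigma_finite_measure \<nu> .
  show "sigma_finite_measure \<nu>pos" "sigma_finite_measure \<nu>neg"
    unfolding part_eq by (subst \<nu>.sigma_finite_iff_density_finite; auto simp: wpos_def wneg_def)+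
qed

lemma nn_integral_\<nu>:
  assumes [measurable]: "f \<in> borel_measurable borel"
  shows "(\<integral>\<^sup>+x. f x \<partial>\<nu>) = (\<integral>\<^sup>+x. ennreal (dens x) * f x \<partial>\<Lambda>)"
  unfolding \<nu>_eq by (rule nn_integral_density) auto

lemma nn_integral_parts:
  assumes [measurable]: "f \<in> borel_measurable borel"
  shows "(\<integral>\<^sup>+x. f x \<partial>\<nu>pos) = (\<integral>\<^sup>+x. wpos x * f x \<partial>\<nu>)" "(\<integral>\<^sup>+x. f x \<partial>\<nu>neg) = (\<integral>\<^sup>+x. wneg x * f x \<partial>\<nu>)"
  unfolding part_eq by (rule nn_integral_density; measurable)+

lemma nn_integral_parts_add:
  assumes [measurable]: "f \<in> borel_measurable borel"
  shows "(\<integral>\<^sup>+x. f x \<partial>\<nu>pos) + (\<integral>\<^sup>+x. f x \<partial>\<nu>neg) = (\<integral>\<^sup>+x. f x \<partial>\<nu>)"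
  unfolding nn_integral_parts[OF assms]
  by (subst nn_integral_add[symmetric]) (auto simp: distrib_right[symmetric] weights_sum)

definition dpos :: "real \<Rightarrow> ennreal" where "dpos x = ennreal (dens x) * wpos x"
definition dneg :: "real \<Rightarrow> ennreal" where "dneg x = ennreal (dens x) * wneg x"

lemma measurable_dparts [measurable]: "dpos \<in> borel_measurable borel" "dneg \<in> borel_measurable borel"
  unfolding dpos_def[abs_def] dneg_def[abs_def] by measurable

lemma emeasure_D: "emeasure law_D A = ennreal (measure law_D A)" and emeasure_A': "emeasure law_A' A = ennreal (measure law_A' A)"
  by (rule D.emeasure_eq_measure A'.emeasure_eq_measure)+

text \<open>For \<open>t < x\<close> this is \<open>dens_pos_eq\<close> written as an integral over
  \<open>A'\<close>; at \<open>t = x\<close> it is the share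
  \<open>\<alpha> * dens 0 = a * p'\<close> of the origin. The integral form lets both sides of the
  walk be compared under the product of the two ladder laws.\<close>

lemma dpos_shift:
  "dpos (x - t) = (\<integral>\<^sup>+s. indicator {..<x} t * (indicator {x - t<..} s + ennreal (1 - a) * indicator {x - t} s) \<partial>law_A') +
     ennreal (a * p') * indicator {x} t"
proof -
  have "(\<integral>\<^sup>+s. indicator {..<x} t * (indicator {x - t<..} s + ennreal (1 - a) * indicator {x - t} s) \<partial>law_A') =
     indicator {..<x} t * (emeasure law_A' {x - t<..} + ennreal (1 - a) * emeasure law_A' {x - t})"
    by (simp add: nn_integral_cmult nn_integral_add)
  also have "\<dots> = indicator {..<x} t * ennreal (measure law_A' {x - t<..} + (1 - a) * measure law_A' {x - t})"
    using a_bounds by (simp add: emeasure_A' ennreal_mult)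
  finally show ?thesis
    using alpha_dens_0(1) dens_0_pos alpha
    by (cases t x rule: linorder_cases)
      (auto simp: dpos_def weight_simps dens_pos_eq ennreal_mult[symmetric] mult.commute)
qed

lemma dneg_shift:
  "dneg (x - s) = (\<integral>\<^sup>+t. indicator {x<..} s * (indicator {..<x - s} t + ennreal a * indicator {x - s} t) \<partial>law_D) +
     ennreal ((1 - a) * p) * indicator {x} s"
proof -
  have "(\<integral>\<^sup>+t. indicator {x<..} s * (indicator {..<x - s} t + ennreal a * indicator {x - s} t) \<partial>law_D) =
     indicator {x<..} s * (emeasure law_D {..<x - s} + ennreal a * emeasure law_D {x - s})"
    by (simp add: nn_integral_cmult nn_integral_add)
  also have "\<dots> = indicator {x<..} s * ennreal (measure law_D {..<x - s} + a * measure law_D {x - s})"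
    using a_bounds by (simp add: emeasure_D ennreal_mult)
  finally show ?thesis
    using alpha_dens_0(2) dens_0_pos alpha
    by (cases s x rule: linorder_cases)
      (auto simp: dneg_def weight_simps dens_neg_eq ennreal_mult[symmetric] mult.commute)
qed

text \<open>With independent \<open>D\<close> and \<open>A'\<close>, the two integrands below are the indicators of \<open>D < x\<close> and \<open>D + A' > x\<close>, and
  of \<open>A' > x\<close> and \<open>D + A' < x\<close>, up to the treatment of the ties \<open>D + A' = x\<close>.\<close>

lemma ladder_density_invariant:
  "(\<integral>\<^sup>+t. dpos (x - t) \<partial>law_D) + (\<integral>\<^sup>+s. dneg (x - s) \<partial>law_A') = ennreal (dens x)"
proof -
  interpret P: pair_sigma_finite law_A' law_D ..
  define u where "u t s = (indicator {..<x} t * (indicator {x - t<..} s + ennreal (1 - a) * indicator {x - t} s) :: ennreal)" for t s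
  define v where "v t s = (indicator {x<..} s * (indicator {..<x - s} t + ennreal a * indicator {x - s} t) :: ennreal)" for t s
  have u_alt: "u t s = (if t < x then (if x < t + s then 1 else if x = t + s then ennreal (1 - a) else 0) else 0)" for t s
    by (auto simp: u_def split: split_indicator)
  have v_alt: "v t s = (if x < s then (if t + s < x then 1 else if x = t + s then ennreal a else 0) else 0)" for t s
    by (auto simp: v_def split: split_indicator)
  have [measurable]: "(\<lambda>(t, s). u t s) \<in> borel_measurable (borel \<Otimes>\<^sub>M borel)" "(\<lambda>(s, t). v t s) \<in> borel_measurable (borel \<Otimes>\<^sub>M borel)"
    "(\<lambda>(t, s). v t s) \<in> borel_measurable (borel \<Otimes>\<^sub>M borel)"
    unfolding u_alt v_alt by measurable
  have [measurable]: "u t \<in> borel_measurable borel" "v t \<in> borel_measurable borel" "(\<lambda>t. v t s) \<in> borel_measurable borel" for t s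
    unfolding u_alt[abs_def] v_alt[abs_def] by measurable
  have aa: "ennreal (1 - a) + ennreal a = 1"
    using a_bounds by (simp add: ennreal_plus[symmetric] del: ennreal_plus)
  have e1: "(\<integral>\<^sup>+t. dpos (x - t) \<partial>law_D) = (\<integral>\<^sup>+t. \<integral>\<^sup>+s. u t s \<partial>law_A' \<partial>law_D) + ennreal (a * p') * emeasure law_D {x}"
    unfolding dpos_shift u_def[symmetric] by (subst nn_integral_add) (auto simp: nn_integral_cmult)
  have e2: "(\<integral>\<^sup>+s. dneg (x - s) \<partial>law_A') = (\<integral>\<^sup>+s. \<integral>\<^sup>+t. v t s \<partial>law_D \<partial>law_A') + ennreal ((1 - a) * p) * emeasure law_A' {x}"
    unfolding dneg_shift v_def[symmetric] by (subst nn_integral_add) (auto simp: nn_integral_cmult)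
  have e3: "(\<integral>\<^sup>+s. \<integral>\<^sup>+t. v t s \<partial>law_D \<partial>law_A') = (\<integral>\<^sup>+t. \<integral>\<^sup>+s. v t s \<partial>law_A' \<partial>law_D)"
    by (rule P.Fubini'[symmetric]) measurable
  have e4: "(\<integral>\<^sup>+t. \<integral>\<^sup>+s. u t s \<partial>law_A' \<partial>law_D) + (\<integral>\<^sup>+t. \<integral>\<^sup>+s. v t s \<partial>law_A' \<partial>law_D) = (\<integral>\<^sup>+t. \<integral>\<^sup>+s. u t s + v t s \<partial>law_A' \<partial>law_D)"
    by (simp add: nn_integral_add)
  have sum: "(\<integral>\<^sup>+t. dpos (x - t) \<partial>law_D) + (\<integral>\<^sup>+s. dneg (x - s) \<partial>law_A') =
     (\<integral>\<^sup>+t. \<integral>\<^sup>+s. u t s + v t s \<partial>law_A' \<partial>law_D) + (ennreal (a * p') * emeasure law_D {x} + ennreal ((1 - a) * p) * emeasure law_A' {x})"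
    unfolding e1 e2 e3 e4[symmetric] by (simp only: ac_simps)
  have cong: "(\<integral>\<^sup>+t. \<integral>\<^sup>+s. u t s + v t s \<partial>law_A' \<partial>law_D) = (\<integral>\<^sup>+t. \<integral>\<^sup>+s. w t s \<partial>law_A' \<partial>law_D)"
    if w: "\<And>t s. t \<le> 0 \<Longrightarrow> 0 \<le> s \<Longrightarrow> u t s + v t s = w t s" for w
  proof (rule nn_integral_cong_AE)
    show "AE t in law_D. (\<integral>\<^sup>+s. u t s + v t s \<partial>law_A') = (\<integral>\<^sup>+s. w t s \<partial>law_A')"
      using AE_ladder_sign(1)
    proof eventually_elim
      fix t :: real assume "t \<le> 0"
      show "(\<integral>\<^sup>+s. u t s + v t s \<partial>law_A') = (\<integral>\<^sup>+s. w t s \<partial>law_A')"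
        using AE_ladder_sign(2) by (intro nn_integral_cong_AE, eventually_elim) (rule w[OF \<open>t \<le> 0\<close>])
    qed
  qed
  consider "0 < x" | "x < 0" | "x = 0" by linarith
  then show ?thesis
  proof cases
    \<comment> \<open>For \<open>s > x\<close> exactly one of \<open>t + s > x\<close>,
      \<open>t + s < x\<close> and the tie occurs, and the two tie weights \<open>1 - a\<close> and
      \<open>a\<close> add up to 1. The tie \<open>t = 0\<close>, \<open>s = x\<close> is left with
      the factor \<open>(1 - a) * (1 - p)\<close>, which the term \<open>(1 - a) * p\<close> from
      \<open>dneg\<close> completes to \<open>1 - a\<close>.\<close>
    case 1
    have "(\<integral>\<^sup>+t. \<integral>\<^sup>+s. u t s + v t s \<partial>law_A' \<partial>law_D) =
      (\<integral>\<^sup>+t. \<integral>\<^sup>+s. indicator {x<..} s + ennreal (1 - a) * indicator {0} t * indicator {x} s \<partial>law_A' \<partial>law_D)"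
      by (rule cong) (use 1 aa in \<open>auto simp: u_alt v_alt split: split_indicator\<close>)
    also have "\<dots> = ennreal (measure law_A' {x<..}) + ennreal (1 - a) * ennreal (1 - p) * ennreal (measure law_A' {x})"
      by (simp add: nn_integral_add nn_integral_cmult nn_integral_multc emeasure_D emeasure_A' measure_D_simps D.prob_space[simplified])
    finally have "(\<integral>\<^sup>+t. dpos (x - t) \<partial>law_D) + (\<integral>\<^sup>+s. dneg (x - s) \<partial>law_A') =
      ennreal (measure law_A' {x<..} + (1 - a) * (1 - p) * measure law_A' {x} + (1 - a) * p * measure law_A' {x})"
      unfolding sum using 1 a_bounds p_pos D.prob_le_1[of "{..<0}"]
      by (simp add: emeasure_D emeasure_A' measure_D_simps ennreal_mult p_def[symmetric] add.assoc)
    also have "\<dots> = ennreal (dens x)"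
      using 1 by (intro arg_cong[where f=ennreal]) (simp add: dens_pos_eq algebra_simps)
    finally show ?thesis .
  next
    case 2
    have "(\<integral>\<^sup>+t. \<integral>\<^sup>+s. u t s + v t s \<partial>law_A' \<partial>law_D) =
      (\<integral>\<^sup>+t. \<integral>\<^sup>+s. indicator {..<x} t + ennreal a * indicator {x} t * indicator {0} s \<partial>law_A' \<partial>law_D)"
      by (rule cong) (use 2 aa in \<open>auto simp: u_alt v_alt split: split_indicator\<close>)
    also have "\<dots> = ennreal (measure law_D {..<x}) + ennreal a * ennreal (measure law_D {x}) * ennreal (1 - p')"
      by (simp add: nn_integral_add nn_integral_cmult nn_integral_multc emeasure_D emeasure_A' measure_A'_simps A'.prob_space[simplified])
    finally have "(\<integral>\<^sup>+t. dpos (x - t) \<partial>law_D) + (\<integral>\<^sup>+s. dneg (x - s) \<partial>law_A') =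
      ennreal (measure law_D {..<x} + a * measure law_D {x} * (1 - p') + a * p' * measure law_D {x})"
      unfolding sum using 2 a_bounds p'_pos A'.prob_le_1[of "{0<..}"]
      by (simp add: emeasure_D emeasure_A' measure_A'_simps ennreal_mult p'_def[symmetric] add.assoc)
    also have "\<dots> = ennreal (dens x)"
      using 2 by (intro arg_cong[where f=ennreal]) (simp add: dens_neg_eq algebra_simps)
    finally show ?thesis .
  next
    case 3
    have "(\<integral>\<^sup>+t. \<integral>\<^sup>+s. u t s + v t s \<partial>law_A' \<partial>law_D) = (\<integral>\<^sup>+t. \<integral>\<^sup>+s. indicator {..<0} t * indicator {0<..} s \<partial>law_A' \<partial>law_D)"
      by (rule cong) (use 3 aa in \<open>auto simp: u_alt v_alt split: split_indicator\<close>)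
    also have "\<dots> = ennreal p * ennreal p'"
      by (simp add: nn_integral_cmult nn_integral_multc emeasure_D emeasure_A' p_def p'_def)
    finally have "(\<integral>\<^sup>+t. dpos (x - t) \<partial>law_D) + (\<integral>\<^sup>+s. dneg (x - s) \<partial>law_A') =
      ennreal (p * p' + a * p' * (1 - p) + (1 - a) * p * (1 - p'))"
      unfolding sum using 3 a_bounds p_pos p'_pos A'.prob_le_1[of "{0<..}"] D.prob_le_1[of "{..<0}"]
      by (simp add: emeasure_D emeasure_A' measure_A'_simps measure_D_simps ennreal_mult p_def[symmetric] p'_def[symmetric] add.assoc)
    also have "p * p' + a * p' * (1 - p) + (1 - a) * p * (1 - p') = dens 0"
    proof -
      have "dens 0 = \<alpha> * dens 0 + (1 - \<alpha>) * dens 0" by (simp add: algebra_simps)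
      then show ?thesis unfolding alpha_dens_0 by (simp add: algebra_simps)
    qed
    finally show ?thesis using 3 by simp
  qed
qed

text \<open>Translation invariance of the Haar measure moves the shift by a ladder value onto the
  densities, where \<open>ladder_density_invariant\<close> applies pointwise.\<close>

lemma ladder_chain_invariant:
  assumes [measurable]: "f \<in> borel_measurable borel"
  shows "(\<integral>\<^sup>+t. \<integral>\<^sup>+x. f (x + t) \<partial>\<nu>pos \<partial>law_D) + (\<integral>\<^sup>+s. \<integral>\<^sup>+x. f (x + s) \<partial>\<nu>neg \<partial>law_A') = (\<integral>\<^sup>+x. f x \<partial>\<nu>)"
proof -
  interpret L: sigma_finite_measure \<Lambda> by (rule sigma_finite_lattice_haar)
  interpret DL: pair_sigma_finite law_D \<Lambda> ..
  interpret AL: pair_sigma_finite law_A' \<Lambda> ..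
  have shift: "(\<integral>\<^sup>+x. d x * f (x + t) \<partial>\<Lambda>) = (\<integral>\<^sup>+x. d (x - t) * f x \<partial>\<Lambda>)"
    if "t \<in> Z" and [measurable]: "d \<in> borel_measurable borel" for d t
    using nn_integral_lattice_haar_shift[of t max_span "\<lambda>x. d (x - t) * f x"] that by (simp add: Z_def)
  have pos: "(\<integral>\<^sup>+x. f (x + t) \<partial>\<nu>pos) = (\<integral>\<^sup>+x. dpos x * f (x + t) \<partial>\<Lambda>)" and neg: "(\<integral>\<^sup>+x. f (x + t) \<partial>\<nu>neg) = (\<integral>\<^sup>+x. dneg x * f (x + t) \<partial>\<Lambda>)" for t
    by (simp_all add: nn_integral_parts nn_integral_\<nu> dpos_def dneg_def mult.assoc)
  have "(\<integral>\<^sup>+t. \<integral>\<^sup>+x. f (x + t) \<partial>\<nu>pos \<partial>law_D) = (\<integral>\<^sup>+t. \<integral>\<^sup>+x. dpos (x - t) * f x \<partial>\<Lambda> \<partial>law_D)"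
    unfolding pos using AE_in_Z(3) by (intro nn_integral_cong_AE, eventually_elim) (simp add: shift)
  also have "\<dots> = (\<integral>\<^sup>+x. \<integral>\<^sup>+t. dpos (x - t) * f x \<partial>law_D \<partial>\<Lambda>)"
    by (rule DL.Fubini'[symmetric]) measurable
  also have "\<dots> = (\<integral>\<^sup>+x. (\<integral>\<^sup>+t. dpos (x - t) \<partial>law_D) * f x \<partial>\<Lambda>)"
    by (simp add: nn_integral_multc)
  finally have 1: "(\<integral>\<^sup>+t. \<integral>\<^sup>+x. f (x + t) \<partial>\<nu>pos \<partial>law_D) = (\<integral>\<^sup>+x. (\<integral>\<^sup>+t. dpos (x - t) \<partial>law_D) * f x \<partial>\<Lambda>)" .
  have "(\<integral>\<^sup>+t. \<integral>\<^sup>+x. f (x + t) \<partial>\<nu>neg \<partial>law_A') = (\<integral>\<^sup>+t. \<integral>\<^sup>+x. dneg (x - t) * f x \<partial>\<Lambda> \<partial>law_A')"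
    unfolding neg using AE_in_Z(6) by (intro nn_integral_cong_AE, eventually_elim) (simp add: shift)
  also have "\<dots> = (\<integral>\<^sup>+x. \<integral>\<^sup>+t. dneg (x - t) * f x \<partial>law_A' \<partial>\<Lambda>)"
    by (rule AL.Fubini'[symmetric]) measurable
  also have "\<dots> = (\<integral>\<^sup>+x. (\<integral>\<^sup>+t. dneg (x - t) \<partial>law_A') * f x \<partial>\<Lambda>)"
    by (simp add: nn_integral_multc)
  finally have 2: "(\<integral>\<^sup>+t. \<integral>\<^sup>+x. f (x + t) \<partial>\<nu>neg \<partial>law_A') = (\<integral>\<^sup>+x. (\<integral>\<^sup>+t. dneg (x - t) \<partial>law_A') * f x \<partial>\<Lambda>)" .
  show ?thesis
    unfolding 1 2 nn_integral_\<nu>[OF assms]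
    by (subst nn_integral_add[symmetric]) (simp_all add: distrib_right[symmetric] ladder_density_invariant)
qed

section \<open>Invariance and local finiteness of \<open>\<mu>\<close>\<close>

text \<open>The measure \<open>\<mu>\<close> on the whole line, where sums of positions and steps
  need no check of membership in \<open>Z\<close>.\<close>

definition mu_line :: "real measure" where
  "mu_line = plus_measure (U_pos \<star> \<nu>pos) (U_neg' \<star> \<nu>neg)"

lemma sets_mu_line [measurable_cong, simp]: "sets mu_line = sets borel"
  by (simp add: mu_line_def)

lemma space_mu_line [simp]: "space mu_line = UNIV"
  by (simp add: mu_line_def)

lemma nn_integral_mu_line:
  assumes "f \<in> borel_measurable borel"
  shows "(\<integral>\<^sup>+x. f x \<partial>mu_line) = (\<integral>\<^sup>+x. f x \<partial>(E.occupation \<star> \<nu>pos)) + (\<integral>\<^sup>+x. f x \<partial>(E'.occupation \<star> \<nu>neg))"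
  unfolding mu_line_def U_pos_eq U_neg'_eq by (rule nn_integral_plus_measure) (use assms in simp_all)

lemma nn_integral_W_F:
  assumes "f \<in> borel_measurable borel"
  shows "(\<integral>\<^sup>+z. f z \<partial>W.F) = (\<integral>\<^sup>+\<omega>. f (X 1 \<omega>) \<partial>M)" "(\<integral>\<^sup>+z. f z \<partial>W'.F) = (\<integral>\<^sup>+\<omega>. f (X' 1 \<omega>) \<partial>M)"
  unfolding W.F_def W'.F_def by (rule nn_integral_distr; use assms in simp)+

lemma nn_integral_jump:
  assumes [measurable]: "f \<in> borel_measurable borel"
  shows "(\<integral>\<^sup>+y. f y \<partial>jump x) = wpos x * (\<integral>\<^sup>+z. f (x + z) \<partial>W.F) + wneg x * (\<integral>\<^sup>+z. f (x + z) \<partial>W'.F)"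
proof (cases x "0 :: real" rule: linorder_cases)
  case equal
  have "(\<integral>\<^sup>+y. f y \<partial>jump 0) = ennreal \<alpha> * (\<integral>\<^sup>+\<omega>. f (X 1 \<omega>) \<partial>M) + ennreal (1 - \<alpha>) * (\<integral>\<^sup>+\<omega>. f (X' 1 \<omega>) \<partial>M)"
    unfolding jump_def
    by (simp add: nn_integral_plus_measure nn_integral_scale_measure nn_integral_distr)
  then show ?thesis using equal by (simp add: weight_simps nn_integral_W_F)
qed (simp_all add: jump_def weight_simps nn_integral_W_F nn_integral_distr)

lemma AE_parts_sign: "AE x in \<nu>pos. 0 \<le> x \<and> (x = 0 \<longrightarrow> 0 < \<alpha>)" "AE x in \<nu>neg. x \<le> 0 \<and> (x = 0 \<longrightarrow> \<alpha> < 1)"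
proof -
  have "0 < wpos x \<Longrightarrow> 0 \<le> x \<and> (x = 0 \<longrightarrow> 0 < \<alpha>)" "0 < wneg x \<Longrightarrow> x \<le> 0 \<and> (x = 0 \<longrightarrow> \<alpha> < 1)" for x
    by (cases x "0 :: real" rule: linorder_cases; simp add: weight_simps)+
  then show "AE x in \<nu>pos. 0 \<le> x \<and> (x = 0 \<longrightarrow> 0 < \<alpha>)" "AE x in \<nu>neg. x \<le> 0 \<and> (x = 0 \<longrightarrow> \<alpha> < 1)"
    unfolding part_eq by (subst AE_density; simp)+
qed

text \<open>Add \<open>excursion_step\<close> for both sides: the starts contribute
  \<open>\<nu>\<close>, and by \<open>ladder_chain_invariant\<close> the ends contribute
  \<open>\<nu>\<close> again. The integral against \<open>\<nu>\<close> stays on both sides because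
  it may be infinite.\<close>

lemma mu_line_step:
  assumes [measurable]: "f \<in> borel_measurable borel"
  shows "(\<integral>\<^sup>+x. \<integral>\<^sup>+y. f y \<partial>jump x \<partial>mu_line) + (\<integral>\<^sup>+x. f x \<partial>\<nu>) = (\<integral>\<^sup>+x. f x \<partial>mu_line) + (\<integral>\<^sup>+x. f x \<partial>\<nu>)"
proof -
  define J where "J x = (\<integral>\<^sup>+y. f y \<partial>jump x)" for x
  define T where "T x = (\<integral>\<^sup>+z. f (x + z) \<partial>W.F)" for x
  define T' where "T' x = (\<integral>\<^sup>+z. f (x + z) \<partial>W'.F)" for x
  have [measurable]: "T \<in> borel_measurable borel" "T' \<in> borel_measurable borel"
    unfolding T_def T'_def by measurable
  have J: "J x = wpos x * T x + wneg x * T' x" for x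
    unfolding J_def T_def T'_def by (rule nn_integral_jump) measurable
  have [measurable]: "J \<in> borel_measurable borel" unfolding J[abs_def] by measurable
  have mJ: "J \<in> borel_measurable borel" and mT: "T \<in> borel_measurable borel" "T' \<in> borel_measurable borel" by measurable
  have eq: "AE x in \<nu>pos. \<forall>y\<in>{0<..}. J (y + x) = T (y + x)"
    using AE_parts_sign(1) by eventually_elim (simp add: J weight_simps)
  obtain r where r: "(\<integral>\<^sup>+x. J x \<partial>(E.occupation \<star> \<nu>pos)) = (\<integral>\<^sup>+x. J x \<partial>\<nu>pos) + r"
    "(\<integral>\<^sup>+x. T x \<partial>(E.occupation \<star> \<nu>pos)) = (\<integral>\<^sup>+x. T x \<partial>\<nu>pos) + r"
    by (rule E.nn_integral_occupation_convolution[OF sigma_finite_\<nu>(2) sets_\<nu>(2) mJ mT(1) eq])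
  have eq': "AE x in \<nu>neg. \<forall>y\<in>{..<0}. J (y + x) = T' (y + x)"
    using AE_parts_sign(2) by eventually_elim (simp add: J weight_simps)
  obtain r' where r': "(\<integral>\<^sup>+x. J x \<partial>(E'.occupation \<star> \<nu>neg)) = (\<integral>\<^sup>+x. J x \<partial>\<nu>neg) + r'"
    "(\<integral>\<^sup>+x. T' x \<partial>(E'.occupation \<star> \<nu>neg)) = (\<integral>\<^sup>+x. T' x \<partial>\<nu>neg) + r'"
    by (rule E'.nn_integral_occupation_convolution[OF sigma_finite_\<nu>(3) sets_\<nu>(3) mJ mT(2) eq'])
  \<comment> \<open>At the origin the jump law mixes the two step laws with weights
    \<open>\<alpha>\<close> and \<open>1 - \<alpha>\<close>, and \<open>\<nu>\<close> is shared
    between the two sides in the same proportion. So the first steps agree in total, though in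
    general not on each side.\<close>
  have start: "(\<integral>\<^sup>+x. J x \<partial>\<nu>pos) + (\<integral>\<^sup>+x. J x \<partial>\<nu>neg) = (\<integral>\<^sup>+x. T x \<partial>\<nu>pos) + (\<integral>\<^sup>+x. T' x \<partial>\<nu>neg)"
    unfolding nn_integral_parts_add[OF \<open>J \<in> _\<close>] nn_integral_parts[OF \<open>T \<in> _\<close>] nn_integral_parts[OF \<open>T' \<in> _\<close>]
    by (subst nn_integral_add[symmetric]) (simp_all add: J[abs_def])
  have arith: "(a + r + (b + r')) + n = m + n"
    if "a + b = c + d" "(c + r) + e = g + k" "(d + r') + e' = g' + k'" "e + e' = n" "k + k' = n" "g + g' = m"
    for a b c d e e' g g' k k' m n r r' :: ennreal
  proof -
    have "(a + r + (b + r')) + n = (a + b) + (r + r') + n" by (simp only: ac_simps)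
    also have "\<dots> = (c + d) + (r + r') + (e + e')" by (simp only: that(1,4))
    also have "\<dots> = ((c + r) + e) + ((d + r') + e')" by (simp only: ac_simps)
    also have "\<dots> = (g + k) + (g' + k')" by (simp only: that(2,3))
    also have "\<dots> = (g + g') + (k + k')" by (simp only: ac_simps)
    finally show ?thesis by (simp only: that(5,6))
  qed
  show ?thesis
    unfolding J_def[symmetric] nn_integral_mu_line[OF \<open>J \<in> _\<close>] r(1) r'(1)
  proof (rule arith[OF start])
    show "(\<integral>\<^sup>+x. T x \<partial>\<nu>pos) + r + (\<integral>\<^sup>+x. f x \<partial>\<nu>pos) = (\<integral>\<^sup>+x. f x \<partial>(E.occupation \<star> \<nu>pos)) + (\<integral>\<^sup>+t. \<integral>\<^sup>+x. f (x + t) \<partial>\<nu>pos \<partial>law_D)"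
      unfolding r(2)[symmetric] unfolding T_def law_D_eq by (rule E.excursion_step) (simp_all add: sigma_finite_\<nu>)
    show "(\<integral>\<^sup>+x. T' x \<partial>\<nu>neg) + r' + (\<integral>\<^sup>+x. f x \<partial>\<nu>neg) = (\<integral>\<^sup>+x. f x \<partial>(E'.occupation \<star> \<nu>neg)) + (\<integral>\<^sup>+t. \<integral>\<^sup>+x. f (x + t) \<partial>\<nu>neg \<partial>law_A')"
      unfolding r'(2)[symmetric] unfolding T'_def law_A'_eq by (rule E'.excursion_step) (simp_all add: sigma_finite_\<nu>)
    show "(\<integral>\<^sup>+x. f x \<partial>\<nu>pos) + (\<integral>\<^sup>+x. f x \<partial>\<nu>neg) = (\<integral>\<^sup>+x. f x \<partial>\<nu>)"
      by (rule nn_integral_parts_add) measurable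
    show "(\<integral>\<^sup>+t. \<integral>\<^sup>+x. f (x + t) \<partial>\<nu>pos \<partial>law_D) + (\<integral>\<^sup>+t. \<integral>\<^sup>+x. f (x + t) \<partial>\<nu>neg \<partial>law_A') = (\<integral>\<^sup>+x. f x \<partial>\<nu>)"
      by (rule ladder_chain_invariant) measurable
    show "(\<integral>\<^sup>+x. f x \<partial>(E.occupation \<star> \<nu>pos)) + (\<integral>\<^sup>+x. f x \<partial>(E'.occupation \<star> \<nu>neg)) = (\<integral>\<^sup>+x. f x \<partial>mu_line)"
      by (rule nn_integral_mu_line[symmetric]) measurable
  qed
qed

lemma emeasure_\<nu>_bounded: "emeasure \<nu> {-r..r} < \<infinity>" "emeasure \<nu>pos {-r..r} < \<infinity>" "emeasure \<nu>neg {-r..r} < \<infinity>"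
proof -
  have "emeasure \<nu> {-r..r} = (\<integral>\<^sup>+x. ennreal (dens x) * indicator {-r..r} x \<partial>\<Lambda>)"
    using nn_integral_\<nu>[of "indicator {-r..r}"] by simp
  also have "\<dots> \<le> (\<integral>\<^sup>+x. 2 * indicator {-r..r} x \<partial>\<Lambda>)"
    using dens_le by (intro nn_integral_mono mult_right_mono) (auto simp flip: ennreal_numeral intro!: ennreal_leI)
  also have "\<dots> = 2 * emeasure \<Lambda> {-r..r}" by (simp add: nn_integral_cmult)
  also have "\<dots> < \<infinity>" using emeasure_lattice_haar_bounded by (simp add: ennreal_mult_less_top)
  finally show \<nu>: "emeasure \<nu> {-r..r} < \<infinity>" .
  have "emeasure \<nu>pos {-r..r} + emeasure \<nu>neg {-r..r} = emeasure \<nu> {-r..r}"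
    using nn_integral_parts_add[of "indicator {-r..r}"] by simp
  with \<nu> show "emeasure \<nu>pos {-r..r} < \<infinity>" "emeasure \<nu>neg {-r..r} < \<infinity>"
    by (metis ennreal_add_eq_top infinity_ennreal_def less_top)+
qed

text \<open>On bounded sets \<open>\<nu>\<close> is finite and cancels in
  \<open>mu_line_step\<close>; monotone convergence removes the bound.\<close>

lemma mu_line_invariant:
  assumes B [measurable]: "B \<in> sets borel"
  shows "(\<integral>\<^sup>+x. emeasure (jump x) B \<partial>mu_line) = emeasure mu_line B"
proof -
  define I where "I n = {- real n..real n}" for n
  have [measurable]: "I n \<in> sets borel" for n by (simp add: I_def)
  have bounded: "(\<integral>\<^sup>+x. emeasure (jump x) (B \<inter> I n) \<partial>mu_line) = emeasure mu_line (B \<inter> I n)" for n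
  proof -
    have "emeasure \<nu> (B \<inter> I n) \<le> emeasure \<nu> (I n)" by (intro emeasure_mono) auto
    then have "emeasure \<nu> (B \<inter> I n) \<noteq> \<infinity>" using emeasure_\<nu>_bounded(1)[of "real n"] by (auto simp: I_def top_unique)
    then show ?thesis
      using mu_line_step[of "indicator (B \<inter> I n)"] by (simp add: add.commute[of _ "emeasure \<nu> (B \<inter> I n)"] ennreal_add_left_cancel)
  qed
  have inc: "incseq (\<lambda>n. B \<inter> I n)" by (auto simp: incseq_def I_def)
  have un: "(\<Union>n. B \<inter> I n) = B"
  proof -
    have "\<exists>n. x \<in> I n" for x
    proof -
      obtain n :: nat where "\<bar>x\<bar> \<le> real n" using real_arch_simple by blast
      then show ?thesis by (auto simp: I_def abs_le_iff intro!: exI[of _ n])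
    qed
    then show ?thesis by auto
  qed
  have SUP: "(SUP n. emeasure N (B \<inter> I n)) = emeasure N B" if "sets N = sets borel" for N :: "real measure"
  proof -
    have "range (\<lambda>n. B \<inter> I n) \<subseteq> sets N" unfolding that by (intro image_subsetI sets.Int) simp_all
    from SUP_emeasure_incseq[OF this inc] show ?thesis unfolding un .
  qed
  have [measurable]: "(\<lambda>x. emeasure (jump x) A) \<in> borel_measurable borel" if "A \<in> sets borel" for A
    by (rule measurable_emeasure_kernel[OF measurable_jump that])
  have "(\<integral>\<^sup>+x. emeasure (jump x) B \<partial>mu_line) = (\<integral>\<^sup>+x. (SUP n. emeasure (jump x) (B \<inter> I n)) \<partial>mu_line)"
    by (simp add: SUP)
  also have "\<dots> = (SUP n. \<integral>\<^sup>+x. emeasure (jump x) (B \<inter> I n) \<partial>mu_line)"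
    using inc by (intro nn_integral_monotone_convergence_SUP)
      (auto simp: incseq_def le_fun_def intro!: emeasure_mono)
  also have "\<dots> = emeasure mu_line B"
    by (simp add: bounded SUP)
  finally show ?thesis .
qed

text \<open>Start and displacement of an excursion do not have opposite signs, so a position in
  \<open>[-r, r]\<close> bounds both by \<open>r\<close> in absolute value, and there
  \<open>\<nu>\<close> and the renewal measures are finite.\<close>

lemma emeasure_mu_line_bounded: "emeasure mu_line {-r..r} < \<infinity>"
proof -
  have bound: "(\<integral>\<^sup>+y. \<integral>\<^sup>+x. indicator {-r..r} (y + x) \<partial>\<rho> \<partial>G) \<le> emeasure G S * emeasure \<rho> {-r..r}"
    if "sigma_finite_measure \<rho>" and [measurable_cong]: "sets \<rho> = sets borel" "sets G = sets borel" and [measurable]: "S \<in> sets borel"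
      and G: "AE y in G. P y" and \<rho>: "AE x in \<rho>. R x"
      and PR: "\<And>x y. P y \<Longrightarrow> R x \<Longrightarrow> y + x \<in> {-r..r} \<Longrightarrow> y \<in> S \<and> x \<in> {-r..r}" for \<rho> G :: "real measure" and S P R
  proof -
    interpret \<rho>: sigma_finite_measure \<rho> by fact
    have "(\<integral>\<^sup>+y. \<integral>\<^sup>+x. indicator {-r..r} (y + x) \<partial>\<rho> \<partial>G) \<le> (\<integral>\<^sup>+y. \<integral>\<^sup>+x. indicator S y * indicator {-r..r} x \<partial>\<rho> \<partial>G)"
    proof (rule nn_integral_mono_AE)
      show "AE y in G. (\<integral>\<^sup>+x. indicator {-r..r} (y + x) \<partial>\<rho>) \<le> (\<integral>\<^sup>+x. indicator S y * indicator {-r..r} x \<partial>\<rho>)"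
        using G
      proof eventually_elim
        fix y assume y: "P y"
        show "(\<integral>\<^sup>+x. indicator {-r..r} (y + x) \<partial>\<rho>) \<le> (\<integral>\<^sup>+x. indicator S y * indicator {-r..r} x \<partial>\<rho>)"
        proof (rule nn_integral_mono_AE)
          show "AE x in \<rho>. indicator {-r..r} (y + x) \<le> (indicator S y * indicator {-r..r} x :: ennreal)"
            using \<rho>
          proof eventually_elim
            fix x assume "R x"
            then show "indicator {-r..r} (y + x) \<le> (indicator S y * indicator {-r..r} x :: ennreal)"
              using PR[OF y, of x] by (cases "y + x \<in> {-r..r}") simp_all
          qed
        qed
      qed
    qed
    also have "\<dots> = emeasure G S * emeasure \<rho> {-r..r}"
      by (simp add: nn_integral_cmult nn_integral_multc)
    finally show ?thesis .
  qed
  have "emeasure mu_line {-r..r} = (\<integral>\<^sup>+x. indicator {-r..r} x \<partial>mu_line)" by simp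
  also have "\<dots> = (\<integral>\<^sup>+y. \<integral>\<^sup>+x. indicator {-r..r} (y + x) \<partial>\<nu>pos \<partial>E.occupation) + (\<integral>\<^sup>+y. \<integral>\<^sup>+x. indicator {-r..r} (y + x) \<partial>\<nu>neg \<partial>E'.occupation)"
  proof -
    have m: "indicator {-r..r} \<in> borel_measurable (borel :: real measure)" by simp
    show ?thesis
      unfolding nn_integral_mu_line[OF m]
        nn_integral_convolution_sigma_finite[OF sigma_finite_\<nu>(2) sets_\<nu>(2) E.sets_laws(3) m]
        nn_integral_convolution_sigma_finite[OF sigma_finite_\<nu>(3) sets_\<nu>(3) E'.sets_laws(3) m] ..
  qed
  also have "\<dots> \<le> emeasure E.occupation {y. 1 * y \<le> r} * emeasure \<nu>pos {-r..r} + emeasure E'.occupation {y. (-1) * y \<le> r} * emeasure \<nu>neg {-r..r}"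
  proof (intro add_mono)
    show "(\<integral>\<^sup>+y. \<integral>\<^sup>+x. indicator {-r..r} (y + x) \<partial>\<nu>pos \<partial>E.occupation) \<le> emeasure E.occupation {y. 1 * y \<le> r} * emeasure \<nu>pos {-r..r}"
      by (rule bound[OF _ _ _ _ E.AE_occupation AE_parts_sign(1)]) (auto simp: sigma_finite_\<nu>)
    show "(\<integral>\<^sup>+y. \<integral>\<^sup>+x. indicator {-r..r} (y + x) \<partial>\<nu>neg \<partial>E'.occupation) \<le> emeasure E'.occupation {y. (-1) * y \<le> r} * emeasure \<nu>neg {-r..r}"
      by (rule bound[OF _ _ _ _ E'.AE_occupation AE_parts_sign(2)]) (auto simp: sigma_finite_\<nu>)
  qed
  also have "\<dots> < \<infinity>"
    using E.occupation_locally_finite[of 1 r] E'.occupation_locally_finite[of "-1" r] emeasure_\<nu>_bounded(2,3)[of r]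
    by (simp add: ennreal_mult_less_top)
  finally show ?thesis .
qed

lemma \<mu>_eq: "\<mu> = restrict_space mu_line Z"
  by (simp add: \<mu>_def mu_line_def)

lemma sets_\<mu>: "sets \<mu> = sets borel_Z"
  unfolding \<mu>_eq borel_Z_def by (rule sets_restrict_space_cong) simp

text \<open>Almost all steps lie in the group \<open>Z\<close>, which therefore cannot be entered
  from outside. Hence restricting the starting points to \<open>Z\<close> loses nothing in the
  invariance equation.\<close>

lemma emeasure_jump_outside:
  assumes "x \<notin> Z" "B \<subseteq> Z" and [measurable]: "B \<in> sets borel"
  shows "emeasure (jump x) B = 0"
proof -
  have "x + z \<notin> B" if "z \<in> Z" for z
    using that assms lattice_add_iff[of z max_span x] by (auto simp: Z_def add.commute)
  then have "AE z in W.F. indicator B (x + z) = (0::ennreal)" "AE z in W'.F. indicator B (x + z) = (0::ennreal)"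
    using AE_F_Z by (auto elim!: eventually_mono)
  then have "(\<integral>\<^sup>+z. indicator B (x + z) \<partial>W.F) = 0" "(\<integral>\<^sup>+z. indicator B (x + z) \<partial>W'.F) = 0"
    by (auto simp: nn_integral_0_iff_AE)
  then show ?thesis
    using nn_integral_jump[of "indicator B" x] by simp
qed

lemma sets_borel_Z_iff: "B \<in> sets borel_Z \<longleftrightarrow> B \<in> sets borel \<and> B \<subseteq> Z"
  unfolding borel_Z_def by (simp add: sets_restrict_space_iff conj_commute)

lemma emeasure_kernel: "B \<in> sets borel_Z \<Longrightarrow> emeasure (kernel x) B = emeasure (jump x) B"
  unfolding kernel_def by (subst emeasure_restrict_space) (auto simp: sets_borel_Z_iff)

lemma invariant_\<mu>: "invariant \<mu>"
  unfolding invariant_def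
proof (intro conjI ballI)
  show "sets \<mu> = sets borel_Z" by (rule sets_\<mu>)
  fix B assume BZ: "B \<in> sets borel_Z"
  then have B [measurable]: "B \<in> sets borel" and sub: "B \<subseteq> Z" by (auto simp: sets_borel_Z_iff)
  have "(\<integral>\<^sup>+x. emeasure (kernel x) B \<partial>\<mu>) = (\<integral>\<^sup>+x. emeasure (jump x) B * indicator Z x \<partial>mu_line)"
    unfolding \<mu>_eq emeasure_kernel[OF BZ] by (subst nn_integral_restrict_space) auto
  also have "\<dots> = (\<integral>\<^sup>+x. emeasure (jump x) B \<partial>mu_line)"
    using emeasure_jump_outside[OF _ sub B] by (intro nn_integral_cong) (auto split: split_indicator)
  also have "\<dots> = emeasure mu_line B" by (rule mu_line_invariant) measurable
  also have "\<dots> = emeasure \<mu> B"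
    unfolding \<mu>_eq by (subst emeasure_restrict_space) (use sub in auto)
  finally show "(\<integral>\<^sup>+x. emeasure (kernel x) B \<partial>\<mu>) = emeasure \<mu> B" .
qed

sublocale Y: invariant_measure borel_Z kernel \<mu>
proof (intro invariant_measure.intro markov_kernel.intro invariant_measure_axioms.intro)
  show "kernel \<in> borel_Z \<rightarrow>\<^sub>M subprob_algebra borel_Z" by (rule measurable_kernel)
  show "\<And>x. x \<in> space borel_Z \<Longrightarrow> prob_space (kernel x)"
    by (simp add: prob_space_kernel)
  show "sets \<mu> = sets borel_Z" by (rule sets_\<mu>)
  show "\<And>B. B \<in> sets borel_Z \<Longrightarrow> (\<integral>\<^sup>+x. emeasure (kernel x) B \<partial>\<mu>) = emeasure \<mu> B"
    using invariant_\<mu> by (simp add: invariant_def)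
qed

lemma path_law_eq: "path_law x = Y.law x"
proof -
  have "step_kernel x = Y.step x"
    by (simp add: fun_eq_iff step_kernel_def Y.step_def)
  then show ?thesis by (simp add: path_law_def Y.law_def)
qed

text \<open>By the Lindelof property countably many null open sets cover the complement of the
  support.\<close>

lemma AE_topological_support: "AE x in \<mu>. x \<in> topological_support \<mu>"
proof -
  define \<U> where "\<U> = {G. openin (top_of_set Z) G \<and> emeasure \<mu> G = 0}"
  have meas: "G \<in> sets \<mu>" if "openin (top_of_set Z) G" for G
    using that unfolding sets_\<mu> sets_borel_Z_iff by (auto simp: openin_open)
  obtain \<V> where V: "\<V> \<subseteq> \<U>" "countable \<V>" "\<Union>\<V> = \<Union>\<U>"
    by (rule Lindelof_openin[of \<U> Z]) (auto simp: \<U>_def)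
  have "emeasure \<mu> (\<Union>\<V>) = 0" and Vm: "\<Union>\<V> \<in> sets \<mu>"
  proof -
    have "(\<Union>G\<in>\<V>. G) \<in> null_sets \<mu>"
    proof (rule null_sets_UN'[OF V(2)])
      fix G assume "G \<in> \<V>"
      then have "openin (top_of_set Z) G" "emeasure \<mu> G = 0" using V(1) by (auto simp: \<U>_def)
      then show "G \<in> null_sets \<mu>" using meas by (intro null_setsI)
    qed
    then show "emeasure \<mu> (\<Union>\<V>) = 0" "\<Union>\<V> \<in> sets \<mu>" by auto
  qed
  moreover have "{x \<in> space \<mu>. x \<notin> topological_support \<mu>} \<subseteq> \<Union>\<V>"
  proof
    fix x assume x: "x \<in> {x \<in> space \<mu>. x \<notin> topological_support \<mu>}"
    then have "x \<in> Z" using sets_eq_imp_space_eq[OF sets_\<mu>] by simp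
    with x obtain G where "openin (top_of_set Z) G" "x \<in> G" "\<not> 0 < emeasure \<mu> G"
      by (auto simp: topological_support_def)
    then show "x \<in> \<Union>\<V>" unfolding V(3) by (auto simp: \<U>_def)
  qed
  ultimately show ?thesis by (intro AE_I[of _ _ "\<Union>\<V>"])
qed

end

section \<open>Ergodicity\<close>

context half_line_step
begin

lemma AE_constant_along_walk:
  fixes h :: "real \<Rightarrow> 'b :: t1_space"
  assumes [measurable]: "h \<in> borel_measurable borel" and pred: "Measurable.pred borel (\<lambda>y. h (x + y) = h x)"
    and good: "\<And>k. AE y in stay C k. AE z in F. h (x + y + z) = h (x + y)"
  shows "AE y in stay C k. h (x + y) = h x" "AE t in leave_law. h (x + t) = h x"
proof -
  have "AE y in stay C k. h (x + y) = h x \<longrightarrow> (AE z in F. h (x + (y + z)) = h x)" for k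
    using good[of k]
  proof eventually_elim
    fix y assume y: "AE z in F. h (x + y + z) = h (x + y)"
    show "h (x + y) = h x \<longrightarrow> (AE z in F. h (x + (y + z)) = h x)"
      using y by (auto simp: add.assoc elim!: eventually_mono)
  qed
  from AE_laws_I[OF pred _ this] show "AE y in stay C k. h (x + y) = h x" "AE t in leave_law. h (x + t) = h x"
    by simp_all
qed

end

section \<open>Reflection at the origin\<close>

lemma distr_lattice_haar_uminus: "distr (lattice_haar u) borel uminus = lattice_haar u"
proof (cases "u = 0")
  case True
  then show ?thesis using lborel_distr_uminus by (simp add: lattice_haar_def)
next
  case False
  show ?thesis
  proof (rule measure_eqI)
    fix A assume "A \<in> sets (distr (lattice_haar u) borel uminus)"
    then have A [measurable]: "A \<in> sets borel" by simp
    have "emeasure (distr (lattice_haar u) borel uminus) A = (\<integral>\<^sup>+x. indicator A x \<partial>distr (lattice_haar u) borel uminus)"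
      by simp
    also have "\<dots> = (\<integral>\<^sup>+x. indicator A (- x) \<partial>lattice_haar u)"
      by (rule nn_integral_distr) measurable
    also have "\<dots> = ennreal u * (\<integral>\<^sup>+k. indicator A (u * of_int (- k)) \<partial>count_space UNIV)"
      by (subst nn_integral_lattice_haar[OF False]) simp_all
    also have "(\<integral>\<^sup>+k. indicator A (u * of_int (- k)) \<partial>count_space UNIV) = (\<integral>\<^sup>+k. indicator A (u * of_int k) \<partial>count_space UNIV)"
      by (rule nn_integral_bij_count_space) (rule bij_uminus)
    also have "ennreal u * \<dots> = (\<integral>\<^sup>+x. indicator A x \<partial>lattice_haar u)"
      by (rule nn_integral_lattice_haar[OF False, symmetric]) measurable
    finally show "emeasure (distr (lattice_haar u) borel uminus) A = emeasure (lattice_haar u) A" by simp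
  qed simp
qed

lemma AE_lattice_haar_uminus: "AE x in lattice_haar u. P x \<Longrightarrow> AE x in lattice_haar u. P (- x)"
  by (subst (asm) distr_lattice_haar_uminus[symmetric]) (rule AE_distrD[rotated], auto)

text \<open>Reflection is a bijection, so the exceptional null set can be transported explicitly and
  \<open>P\<close> need not be measurable.\<close>

lemma AE_distr_reflect:
  fixes N :: "real measure"
  assumes P: "AE t in N. P (- t)" and [measurable_cong]: "sets N = sets borel"
  shows "AE t in distr N borel uminus. P t"
proof -
  have sp: "space N = UNIV" using sets_eq_imp_space_eq[OF assms(2)] by simp
  from P obtain S where S: "{t \<in> space N. \<not> P (- t)} \<subseteq> S" "S \<in> sets N" "emeasure N S = 0"
    by (auto elim!: AE_E)
  have [measurable]: "S \<in> sets borel" using S(2) by (simp add: assms(2))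
  have vim: "uminus -` (uminus -` S) = S" for S :: "real set" by (auto simp: vimage_def)
  have m: "uminus -` S \<in> sets (borel :: real measure)"
    using measurable_sets[of uminus borel borel S] by simp
  then have "emeasure (distr N borel uminus) (uminus -` S) = 0"
    using S(3) by (subst emeasure_distr) (simp_all add: sp vim)
  moreover have "{t \<in> space (distr N borel uminus). \<not> P t} \<subseteq> uminus -` S"
    using S(1) by (auto simp: sp) (metis minus_minus mem_Collect_eq subsetD)
  ultimately show ?thesis using m by (intro AE_I[of _ _ "uminus -` S"]) simp_all
qed

context recurrent_switching_walk
begin

section \<open>Constancy of functions preserved by almost all jumps\<close>

lemma AE_parts_Z: "AE x in \<nu>pos. x \<in> Z" "AE x in \<nu>neg. x \<in> Z"
proof -
  have "AE x in \<nu>. x \<in> Z"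
    unfolding \<nu>_eq using AE_lattice_haar[of max_span] by (subst AE_density) (auto simp: Z_def)
  then show "AE x in \<nu>pos. x \<in> Z" "AE x in \<nu>neg. x \<in> Z"
    unfolding part_eq by (subst AE_density; auto)+
qed

lemma AE_mu_line_iff:
  assumes [measurable]: "Measurable.pred borel P"
  shows "(AE x in mu_line. P x) \<longleftrightarrow> (AE x in E.occupation \<star> \<nu>pos. P x) \<and> (AE x in E'.occupation \<star> \<nu>neg. P x)"
proof -
  have iff: "(AE x in N. P x) \<longleftrightarrow> (\<integral>\<^sup>+x. indicator {x. \<not> P x} x \<partial>N) = 0" if "sets N = sets borel" for N :: "real measure"
    using that by (subst nn_integral_0_iff_AE)
      (auto split: split_indicator intro!: arg_cong2[where f=eventually] cong: measurable_cong_sets)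
  show ?thesis
    unfolding iff[OF sets_mu_line] iff[OF sets_convolution] by (subst nn_integral_mu_line) auto
qed

text \<open>As \<open>mu_line\<close> is the occupation measure of excursions from
  \<open>\<nu>\<close>, the hypothesis holds along almost every excursion. The value of
  \<open>h\<close> is then handed on from step to step, up to and including the exit, which is the
  ladder move.\<close>

lemma harmonic_moves:
  fixes h :: "real \<Rightarrow> real"
  assumes h [measurable]: "h \<in> borel_measurable borel"
    and inv: "AE x in mu_line. x \<in> Z \<longrightarrow> (AE y in jump x. y \<in> Z \<longrightarrow> h y = h x)"
  shows "AE x in \<nu>pos. (\<forall>k. AE y in W.F.stay {0<..} k. h (x + y) = h x) \<and> (AE t in law_D. h (x + t) = h x)"
    and "AE x in \<nu>neg. (\<forall>k. AE y in W'.F.stay {..<0} k. h (x + y) = h x) \<and> (AE t in law_A'. h (x + t) = h x)"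
proof -
  \<comment> \<open>The event that a step within \<open>Z\<close> changes \<open>h\<close> enters
    through its probability, a measurable function of \<open>x\<close>, so that the exceptional
    points can be passed through the convolution.\<close>
  define g where "g x = (\<integral>\<^sup>+z. indicator {z. x + z \<in> Z \<and> h (x + z) \<noteq> h x} z \<partial>W.F)" for x
  define g' where "g' x = (\<integral>\<^sup>+z. indicator {z. x + z \<in> Z \<and> h (x + z) \<noteq> h x} z \<partial>W'.F)" for x
  have [measurable]: "g \<in> borel_measurable borel" "g' \<in> borel_measurable borel"
    unfolding g_def g'_def by measurable
  have g0: "AE z in W.F. h (x + z) = h x" if "x \<in> Z" "g x = 0" for x
  proof -
    have "AE z in W.F. indicator {z. x + z \<in> Z \<and> h (x + z) \<noteq> h x} z = (0 :: ennreal)"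
      using that(2) unfolding g_def by (subst (asm) nn_integral_0_iff_AE) auto
    with AE_F_Z(1) show ?thesis
      by eventually_elim (use Z_add[OF that(1)] in \<open>auto split: split_indicator_asm\<close>)
  qed
  have g'0: "AE z in W'.F. h (x + z) = h x" if "x \<in> Z" "g' x = 0" for x
  proof -
    have "AE z in W'.F. indicator {z. x + z \<in> Z \<and> h (x + z) \<noteq> h x} z = (0 :: ennreal)"
      using that(2) unfolding g'_def by (subst (asm) nn_integral_0_iff_AE) auto
    with AE_F_Z(2) show ?thesis
      by eventually_elim (use Z_add[OF that(1)] in \<open>auto split: split_indicator_asm\<close>)
  qed
  have ae: "AE x in mu_line. x \<in> Z \<longrightarrow> wpos x * g x = 0 \<and> wneg x * g' x = 0"
    using inv
  proof eventually_elim
    fix x assume x: "x \<in> Z \<longrightarrow> (AE y in jump x. y \<in> Z \<longrightarrow> h y = h x)"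
    show "x \<in> Z \<longrightarrow> wpos x * g x = 0 \<and> wneg x * g' x = 0"
    proof
      assume "x \<in> Z"
      have m: "indicator {y \<in> Z. h y \<noteq> h x} \<in> borel_measurable (borel :: real measure)" by measurable
      have "(\<integral>\<^sup>+y. indicator {y \<in> Z. h y \<noteq> h x} y \<partial>jump x) = 0"
        using x \<open>x \<in> Z\<close> m by (subst nn_integral_0_iff_AE) (auto split: split_indicator elim!: eventually_mono cong: measurable_cong_sets)
      moreover have "(indicator {y \<in> Z. h y \<noteq> h x} (x + z) :: ennreal) = indicator {z. x + z \<in> Z \<and> h (x + z) \<noteq> h x} z" for z
        by (simp add: indicator_def)
      ultimately show "wpos x * g x = 0 \<and> wneg x * g' x = 0"
        unfolding nn_integral_jump[OF m] by (simp add: g_def g'_def)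
    qed
  qed
  have "Measurable.pred borel (\<lambda>x. x \<in> Z \<longrightarrow> wpos x * g x = 0 \<and> wneg x * g' x = 0)" by measurable
  note parts = ae[unfolded AE_mu_line_iff[OF this]]
    E.AE_occupation_convolution_iff[OF sigma_finite_\<nu>(2) sets_\<nu>(2) this]
    E'.AE_occupation_convolution_iff[OF sigma_finite_\<nu>(3) sets_\<nu>(3) this]
  have "AE x in \<nu>pos. \<forall>k. AE y in W.F.stay {0<..} k. x + y \<in> Z \<longrightarrow> wpos (x + y) * g (x + y) = 0 \<and> wneg (x + y) * g' (x + y) = 0"
    using parts by simp
  then show "AE x in \<nu>pos. (\<forall>k. AE y in W.F.stay {0<..} k. h (x + y) = h x) \<and> (AE t in law_D. h (x + t) = h x)"
    using AE_parts_sign(1) AE_parts_Z(1)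
  proof eventually_elim
    fix x assume *: "\<forall>k. AE y in W.F.stay {0<..} k. x + y \<in> Z \<longrightarrow> wpos (x + y) * g (x + y) = 0 \<and> wneg (x + y) * g' (x + y) = 0"
      and x: "0 \<le> x \<and> (x = 0 \<longrightarrow> 0 < \<alpha>)" "x \<in> Z"
    have good: "AE y in W.F.stay {0<..} k. AE z in W.F. h (x + y + z) = h (x + y)" for k
      using *[rule_format, of k] E.AE_stay[of k] AE_in_Z(1)[of k]
    proof eventually_elim
      fix y assume y: "x + y \<in> Z \<longrightarrow> wpos (x + y) * g (x + y) = 0 \<and> wneg (x + y) * g' (x + y) = 0"
        "y = 0 \<or> y \<in> {0<..}" "y \<in> Z"
      have "x + y \<in> Z" using x y by (intro Z_add)
      \<comment> \<open>The equation \<open>x + y = 0\<close> forces \<open>x = 0\<close>, which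
        occurs under \<open>\<nu>pos\<close> only if \<open>\<alpha> > 0\<close>.\<close>
      moreover have "wpos (x + y) \<noteq> 0"
        using x y by (cases "x + y = 0") (auto simp: weight_simps ennreal_eq_0_iff not_le)
      ultimately show "AE z in W.F. h (x + y + z) = h (x + y)"
        using y by (intro g0) auto
    qed
    have pred: "Measurable.pred borel (\<lambda>y. h (x + y) = h x)" by measurable
    show "(\<forall>k. AE y in W.F.stay {0<..} k. h (x + y) = h x) \<and> (AE t in law_D. h (x + t) = h x)"
      unfolding law_D_eq using E.AE_constant_along_walk[OF h pred good] by blast
  qed
  have "AE x in \<nu>neg. \<forall>k. AE y in W'.F.stay {..<0} k. x + y \<in> Z \<longrightarrow> wpos (x + y) * g (x + y) = 0 \<and> wneg (x + y) * g' (x + y) = 0"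
    using parts by simp
  then show "AE x in \<nu>neg. (\<forall>k. AE y in W'.F.stay {..<0} k. h (x + y) = h x) \<and> (AE t in law_A'. h (x + t) = h x)"
    using AE_parts_sign(2) AE_parts_Z(2)
  proof eventually_elim
    fix x assume *: "\<forall>k. AE y in W'.F.stay {..<0} k. x + y \<in> Z \<longrightarrow> wpos (x + y) * g (x + y) = 0 \<and> wneg (x + y) * g' (x + y) = 0"
      and x: "x \<le> 0 \<and> (x = 0 \<longrightarrow> \<alpha> < 1)" "x \<in> Z"
    have good: "AE y in W'.F.stay {..<0} k. AE z in W'.F. h (x + y + z) = h (x + y)" for k
      using *[rule_format, of k] E'.AE_stay[of k] AE_in_Z(4)[of k]
    proof eventually_elim
      fix y assume y: "x + y \<in> Z \<longrightarrow> wpos (x + y) * g (x + y) = 0 \<and> wneg (x + y) * g' (x + y) = 0"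
        "y = 0 \<or> y \<in> {..<0}" "y \<in> Z"
      have "x + y \<in> Z" using x y by (intro Z_add)
      moreover have "wneg (x + y) \<noteq> 0"
        using x y by (cases "x + y = 0") (auto simp: weight_simps ennreal_eq_0_iff not_le)
      ultimately show "AE z in W'.F. h (x + y + z) = h (x + y)"
        using y by (intro g'0) auto
    qed
    have pred: "Measurable.pred borel (\<lambda>y. h (x + y) = h x)" by measurable
    show "(\<forall>k. AE y in W'.F.stay {..<0} k. h (x + y) = h x) \<and> (AE t in law_A'. h (x + t) = h x)"
      unfolding law_A'_eq using E'.AE_constant_along_walk[OF h pred good] by blast
  qed
qed

lemma emeasure_tails_pos:
  "0 < x \<Longrightarrow> 0 < dens x \<Longrightarrow> 0 < emeasure law_A' {x..}" "x < 0 \<Longrightarrow> 0 < dens x \<Longrightarrow> 0 < emeasure law_D {..x}"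
proof -
  assume x: "0 < x" "0 < dens x"
  have "measure law_A' {x<..} + (1 - a) * measure law_A' {x} \<le> measure law_A' {x..} + (1 - a) * measure law_A' {x..}"
    using a_bounds by (intro add_mono mult_left_mono A'.finite_measure_mono) auto
  then have "measure law_A' {x..} \<noteq> 0" using x dens_pos_eq[of x] by auto
  then show "0 < emeasure law_A' {x..}" by (simp add: emeasure_A' zero_less_measure_iff)
next
  assume x: "x < 0" "0 < dens x"
  have "measure law_D {..<x} + a * measure law_D {x} \<le> measure law_D {..x} + a * measure law_D {..x}"
    using a_bounds by (intro add_mono mult_left_mono D.finite_measure_mono) auto
  then have "measure law_D {..x} \<noteq> 0" using x dens_neg_eq[of x] by auto
  then show "0 < emeasure law_D {..x}" by (simp add: emeasure_D zero_less_measure_iff)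
qed

text \<open>The sets where the densities are positive can differ from the tail sets of
  \<open>ladder_invariant_constant\<close> at extreme atoms and at the origin. That lemma lets the
  origin move to the left by \<open>D\<close>, which fits \<open>\<alpha> > 0\<close>; for
  \<open>\<alpha> = 0\<close> the picture is reflected.\<close>

lemma \<nu>_constant:
  fixes h :: "real \<Rightarrow> real"
  assumes h [measurable]: "h \<in> borel_measurable borel" and h01: "\<And>x. 0 \<le> h x" "\<And>x. h x \<le> 1"
    and movD: "AE x in \<nu>pos. AE t in law_D. h (x + t) = h x" and movA: "AE x in \<nu>neg. AE t in law_A'. h (x + t) = h x"
  obtains c where "AE x in \<nu>. h x = c"
proof -
  interpret L: sigma_finite_measure \<Lambda> by (rule sigma_finite_lattice_haar)
  interpret LD: pair_sigma_finite \<Lambda> law_D ..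
  interpret LA: pair_sigma_finite \<Lambda> law_A' ..
  have dparts: "\<nu>pos = density \<Lambda> dpos" "\<nu>neg = density \<Lambda> dneg"
    unfolding part_eq unfolding \<nu>_eq dpos_def[abs_def] dneg_def[abs_def] by (simp_all add: density_density_eq)
  have D: "AE t in law_D. AE x in \<Lambda>. 0 < dpos x \<longrightarrow> h (x + t) = h x"
  proof (rule LD.AE_commute[THEN iffD1])
    show "AE x in \<Lambda>. AE t in law_D. 0 < dpos x \<longrightarrow> h (x + t) = h x"
      using movD unfolding dparts by (subst (asm) AE_density) (auto elim!: eventually_mono)
  qed measurable
  have A: "AE t in law_A'. AE x in \<Lambda>. 0 < dneg x \<longrightarrow> h (x + t) = h x"
  proof (rule LA.AE_commute[THEN iffD1])
    show "AE x in \<Lambda>. AE t in law_A'. 0 < dneg x \<longrightarrow> h (x + t) = h x"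
      using movA unfolding dparts by (subst (asm) AE_density) (auto elim!: eventually_mono)
  qed measurable
  have dens_dpos: "0 < x \<Longrightarrow> dpos x = ennreal (dens x)" and dens_dneg: "x < 0 \<Longrightarrow> dneg x = ennreal (dens x)" for x
    by (simp_all add: dpos_def dneg_def weight_simps)
  have em_pos: "0 < emeasure law_D S \<longleftrightarrow> 0 < measure law_D S" "0 < emeasure law_A' S \<longleftrightarrow> 0 < measure law_A' S" for S
    by (simp_all add: emeasure_D emeasure_A')
  have signs: "AE t in law_D. t \<le> 0 \<and> t \<in> lattice_set max_span" "AE t in law_A'. 0 \<le> t \<and> t \<in> lattice_set max_span"
    using AE_ladder_sign AE_in_Z(3,6) by (auto simp: Z_def)
  have Dneg: "0 < emeasure law_D {..<0}" and Apos: "0 < emeasure law_A' {0<..}"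
    using p_pos p'_pos by (simp_all add: em_pos p_def p'_def)
  have "\<exists>c. AE x in \<Lambda>. 0 < dens x \<longrightarrow> h x = c"
  proof (cases "\<alpha> = 0")
    case False
    then have \<alpha>: "0 < \<alpha>" using alpha by simp
    have a: "0 < a"
    proof -
      have "0 < a * norm_const" unfolding a_eq using \<alpha> p_pos by simp
      then show ?thesis using norm_const_pos by (simp add: zero_less_mult_iff)
    qed
    have dpos: "0 < dpos x" if "0 \<le> x" "0 < emeasure law_A' {x<..}" for x
    proof (cases "x = 0")
      case True
      then show ?thesis using dens_0_pos \<alpha> by (simp add: dpos_def weight_simps ennreal_zero_less_mult_iff)
    next
      case False
      have "0 < dens x" using that False a_bounds by (auto simp: dens_pos_eq em_pos add_pos_nonneg)
      then show ?thesis using that False by (simp add: dens_dpos)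
    qed
    have dneg: "0 < dneg x" if "x < 0" "0 < emeasure law_D {..x}" for x
    proof -
      have "measure law_D {..x} = measure law_D {..<x} + measure law_D {x}"
        by (subst D.finite_measure_Union[symmetric]) (auto intro!: arg_cong[where f="measure law_D"])
      then have "measure law_D {..<x} \<noteq> 0 \<or> measure law_D {x} \<noteq> 0" using that by (auto simp: em_pos)
      then have "0 < dens x"
        using that a unfolding dens_neg_eq[OF that(1)]
        by (auto simp: zero_less_measure_iff intro: add_pos_nonneg add_nonneg_pos)
      then show ?thesis using that by (simp add: dens_dneg)
    qed
    obtain c where c: "AE x in \<Lambda>. 0 \<le> x \<and> 0 < emeasure law_A' {x<..} \<longrightarrow> h x = c"
      "AE x in \<Lambda>. x < 0 \<and> 0 < emeasure law_D {..x} \<longrightarrow> h x = c"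
    proof (rule ladder_invariant_constant[OF max_span_nonneg sets_ladder_laws(1,2) _ _ signs Dneg Apos h h01])
      show "AE t in law_D. AE x in \<Lambda>. 0 \<le> x \<and> 0 < emeasure law_A' {x<..} \<longrightarrow> h (x + t) = h x"
        using D by (auto elim!: eventually_mono dest: dpos)
      show "AE t in law_A'. AE x in \<Lambda>. x < 0 \<and> 0 < emeasure law_D {..x} \<longrightarrow> h (x + t) = h x"
        using A by (auto elim!: eventually_mono dest: dneg)
    qed (auto intro: ladder_span D.finite_measure_axioms A'.finite_measure_axioms)
    \<comment> \<open>A positive point beyond which \<open>A'\<close> has no mass can still have
      positive density, through an atom of \<open>A'\<close> at the point itself. One typical move
      \<open>t < 0\<close> takes it to where \<open>h = c\<close> is known.\<close>
    have "AE t in law_D. (AE x in \<Lambda>. 0 < dpos x \<longrightarrow> h (x + t) = h x) \<and> t \<in> lattice_set max_span \<and> 0 < emeasure law_D {..t}"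
      using D signs(1) AE_lower_tail_pos[OF sets_ladder_laws(1)] by eventually_elim simp
    from AE_exists[OF this Dneg] obtain t where t: "t < 0" "AE x in \<Lambda>. 0 < dpos x \<longrightarrow> h (x + t) = h x"
      "t \<in> lattice_set max_span" "0 < emeasure law_D {..t}" by auto
    have "AE x in \<Lambda>. 0 < dens x \<longrightarrow> h x = c"
      using c t(2) AE_lattice_haar_shift[OF c(1) t(3)] AE_lattice_haar_shift[OF c(2) t(3)]
    proof eventually_elim
      fix x assume x: "0 \<le> x \<and> 0 < emeasure law_A' {x<..} \<longrightarrow> h x = c" "x < 0 \<and> 0 < emeasure law_D {..x} \<longrightarrow> h x = c"
        "0 < dpos x \<longrightarrow> h (x + t) = h x" "0 \<le> x + t \<and> 0 < emeasure law_A' {x + t<..} \<longrightarrow> h (x + t) = c"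
        "x + t < 0 \<and> 0 < emeasure law_D {..x + t} \<longrightarrow> h (x + t) = c"
      show "0 < dens x \<longrightarrow> h x = c"
      proof
        assume dx: "0 < dens x"
        consider "x < 0" | "x = 0" | "0 < x" by linarith
        then show "h x = c"
        proof cases
          case 1
          then show ?thesis using x(2) emeasure_tails_pos(2)[OF _ dx] by simp
        next
          case 2
          then show ?thesis using x(1) Apos by simp
        next
          case 3
          have "h x = h (x + t)" using x(3) dx 3 by (simp add: dens_dpos)
          also have "\<dots> = c"
          proof (cases "0 \<le> x + t")
            case True
            have "emeasure law_A' {x..} \<le> emeasure law_A' {x + t<..}" using t(1) by (intro emeasure_mono) auto
            then show ?thesis using x(4) True emeasure_tails_pos(1)[OF 3 dx] by (auto intro: order_less_le_trans)
          next
            case False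
            have "emeasure law_D {..t} \<le> emeasure law_D {..x + t}" using 3 by (intro emeasure_mono) auto
            then show ?thesis using x(5) False t(4) by (auto intro: order_less_le_trans)
          qed
          finally show ?thesis .
        qed
      qed
    qed
    then show ?thesis ..
  next
    case True
    \<comment> \<open>Now the origin moves with \<open>A'\<close>, and \<open>a = 0\<close> removes
      the atom \<open>D = x\<close> from the density at \<open>x < 0\<close>, so the rotations act
      on \<open>(-s, r]\<close>. Reflection restores the half-open form required, with
      \<open>- A'\<close> in the role of \<open>D\<close> and \<open>- D\<close> in that of
      \<open>A'\<close>.\<close>
    have a0: "a = 0" using a_eq(1) True norm_const_pos by simp
    let ?D = "distr law_A' borel uminus" and ?A = "distr law_D borel uminus"
    have vim: "uminus -` {x<..} = {..<- x}" "uminus -` {..x} = {- x..}" "uminus -` {..<x} = {- x<..}" for x :: real by auto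
    have em: "emeasure ?A {x<..} = emeasure law_D {..<- x}" "emeasure ?D {..x} = emeasure law_A' {- x..}"
       "emeasure ?D {..<x} = emeasure law_A' {- x<..}" for x
      by (simp_all add: emeasure_distr vim)
    have lawA: "AE t in law_A'. AE x in \<Lambda>. 0 \<le> x \<and> 0 < emeasure law_D {..<- x} \<longrightarrow> h (- (x - t)) = h (- x)"
      using A
    proof eventually_elim
      fix t assume "AE x in \<Lambda>. 0 < dneg x \<longrightarrow> h (x + t) = h x"
      from AE_lattice_haar_uminus[OF this]
      show "AE x in \<Lambda>. 0 \<le> x \<and> 0 < emeasure law_D {..<- x} \<longrightarrow> h (- (x - t)) = h (- x)"
      proof eventually_elim
        fix x assume x: "0 < dneg (- x) \<longrightarrow> h (- x + t) = h (- x)"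
        show "0 \<le> x \<and> 0 < emeasure law_D {..<- x} \<longrightarrow> h (- (x - t)) = h (- x)"
        proof
          assume x': "0 \<le> x \<and> 0 < emeasure law_D {..<- x}"
          have "0 < dneg (- x)"
          proof (cases "x = 0")
            case True
            have "0 < 1 - \<alpha>" using \<open>\<alpha> = 0\<close> by linarith
            then show ?thesis using True dens_0_pos by (simp add: dneg_def weight_simps ennreal_zero_less_mult_iff)
          next
            case False
            then show ?thesis using x' a0 by (simp add: dens_dneg dens_neg_eq em_pos)
          qed
          with x show "h (- (x - t)) = h (- x)" by (simp add: algebra_simps)
        qed
      qed
    qed
    have lawD: "AE t in law_D. AE x in \<Lambda>. x < 0 \<and> 0 < emeasure law_A' {- x..} \<longrightarrow> h (- (x - t)) = h (- x)"
      using D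
    proof eventually_elim
      fix t assume "AE x in \<Lambda>. 0 < dpos x \<longrightarrow> h (x + t) = h x"
      from AE_lattice_haar_uminus[OF this]
      show "AE x in \<Lambda>. x < 0 \<and> 0 < emeasure law_A' {- x..} \<longrightarrow> h (- (x - t)) = h (- x)"
      proof eventually_elim
        fix x assume x: "0 < dpos (- x) \<longrightarrow> h (- x + t) = h (- x)"
        show "x < 0 \<and> 0 < emeasure law_A' {- x..} \<longrightarrow> h (- (x - t)) = h (- x)"
        proof
          assume x': "x < 0 \<and> 0 < emeasure law_A' {- x..}"
          have "{- x..} = {- x<..} \<union> {- x}" by auto
          then have "measure law_A' {- x..} = measure law_A' {- x<..} + measure law_A' {- x}"
            by (simp add: A'.finite_measure_Union[symmetric])
          then have "0 < dpos (- x)" using x' a0 by (simp add: dens_dpos dens_pos_eq em_pos flip: ennreal_plus)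
          with x show "h (- (x - t)) = h (- x)" by (simp add: algebra_simps)
        qed
      qed
    qed
    obtain c where c: "AE x in \<Lambda>. 0 \<le> x \<and> 0 < emeasure ?A {x<..} \<longrightarrow> h (- x) = c"
      "AE x in \<Lambda>. x < 0 \<and> 0 < emeasure ?D {..x} \<longrightarrow> h (- x) = c"
    proof (rule ladder_invariant_constant[of max_span ?D ?A "\<lambda>x. h (- x)"])
      show "0 \<le> max_span" by (rule max_span_nonneg)
      show "AE t in ?D. t \<le> 0 \<and> t \<in> lattice_set max_span"
        proof (rule AE_distr_reflect)
        show "AE t in law_A'. - t \<le> 0 \<and> - t \<in> lattice_set max_span"
          using signs(2) by eventually_elim (simp add: lattice_uminus)
      qed simp
      show "AE t in ?A. 0 \<le> t \<and> t \<in> lattice_set max_span"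
        proof (rule AE_distr_reflect)
        show "AE t in law_D. 0 \<le> - t \<and> - t \<in> lattice_set max_span"
          using signs(1) by eventually_elim (simp add: lattice_uminus)
      qed simp
      show "0 < emeasure ?D {..<0}" "0 < emeasure ?A {0<..}" using Dneg Apos by (simp_all add: em)
      show "AE t in ?D. AE x in \<Lambda>. 0 \<le> x \<and> 0 < emeasure ?A {x<..} \<longrightarrow> h (- (x + t)) = h (- x)"
        unfolding em using lawA by (intro AE_distr_reflect) simp_all
      show "AE t in ?A. AE x in \<Lambda>. x < 0 \<and> 0 < emeasure ?D {..x} \<longrightarrow> h (- (x + t)) = h (- x)"
        unfolding em using lawD by (intro AE_distr_reflect) simp_all
      fix v :: real assume v: "0 \<le> v" "AE t in ?D. t \<in> lattice_set v" "AE t in ?A. t \<in> lattice_set v"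
      have "AE t in law_D. - t \<in> lattice_set v" "AE t in law_A'. - t \<in> lattice_set v"
        using v(2,3) by (auto dest!: AE_distrD[rotated])
      then have "AE t in law_D. t \<in> lattice_set v" "AE t in law_A'. t \<in> lattice_set v"
        by (auto elim!: eventually_mono dest: lattice_uminus)
      then show "v \<le> max_span" by (rule ladder_span[OF v(1)])
    qed (auto simp: h01 intro!: D.finite_measure_distr A'.finite_measure_distr)
    have "AE x in \<Lambda>. 0 < dens x \<longrightarrow> h x = c"
      using AE_lattice_haar_uminus[OF c(1)] AE_lattice_haar_uminus[OF c(2)]
    proof eventually_elim
      fix x assume x: "0 \<le> - x \<and> 0 < emeasure ?A {- x<..} \<longrightarrow> h (- (- x)) = c"
        "- x < 0 \<and> 0 < emeasure ?D {..- x} \<longrightarrow> h (- (- x)) = c"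
      show "0 < dens x \<longrightarrow> h x = c"
      proof
        assume dx: "0 < dens x"
        consider "x < 0" | "x = 0" | "0 < x" by linarith
        then show "h x = c"
        proof cases
          case 1
          then show ?thesis using x(1) dx a0 by (simp add: em em_pos dens_neg_eq)
        next
          case 2
          then show ?thesis using x(1) Dneg by (simp add: em)
        next
          case 3
          then show ?thesis using x(2) emeasure_tails_pos(1)[OF 3 dx] by (simp add: em)
        qed
      qed
    qed
    then show ?thesis ..
  qed
  then show thesis
    using that unfolding \<nu>_eq by (auto simp: AE_density)
qed

text \<open>The value \<open>c\<close> at the starts spreads from \<open>\<nu>\<close> to all of
  \<open>\<mu>\<close>, because \<open>h\<close> does not change within an excursion.\<close>

lemma \<mu>_constant:
  fixes h :: "real \<Rightarrow> real"
  assumes h [measurable]: "h \<in> borel_measurable borel" and h01: "\<And>x. 0 \<le> h x" "\<And>x. h x \<le> 1"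
    and inv: "AE x in mu_line. x \<in> Z \<longrightarrow> (AE y in jump x. y \<in> Z \<longrightarrow> h y = h x)"
  obtains c where "AE x in mu_line. h x = c"
proof -
  note moves = harmonic_moves[OF h inv]
  obtain c where c: "AE x in \<nu>. h x = c"
    by (rule \<nu>_constant[OF h h01]) (use moves in \<open>auto elim!: eventually_mono\<close>)
  then have parts: "AE x in \<nu>pos. h x = c" "AE x in \<nu>neg. h x = c"
    unfolding part_eq by (subst AE_density; auto elim!: eventually_mono)+
  have pred: "Measurable.pred borel (\<lambda>x. h x = c)" by measurable
  have "AE x in \<nu>pos. \<forall>k. AE y in W.F.stay {0<..} k. h (x + y) = c"
    using parts(1) moves(1) by eventually_elim simp
  moreover have "AE x in \<nu>neg. \<forall>k. AE y in W'.F.stay {..<0} k. h (x + y) = c"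
    using parts(2) moves(2) by eventually_elim simp
  ultimately have "AE x in mu_line. h x = c"
    unfolding AE_mu_line_iff[OF pred] E.AE_occupation_convolution_iff[OF sigma_finite_\<nu>(2) sets_\<nu>(2) pred]
      E'.AE_occupation_convolution_iff[OF sigma_finite_\<nu>(3) sets_\<nu>(3) pred] by simp
  then show thesis by (rule that)
qed

lemma ergodic_\<mu>:
  assumes rec: "\<forall>x \<in> topological_support \<mu>. topologically_recurrent x"
  shows "ergodic \<mu>"
  unfolding ergodic_def
proof (intro conjI ballI impI)
  show "invariant \<mu>" by (rule invariant_\<mu>)
  fix B assume B: "B \<in> sets paths" and shift: "B = {y \<in> space paths. (\<lambda>n. y (Suc n)) \<in> B}"
  note B' = B[unfolded paths_def] and shift' = shift[unfolded paths_def]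
  \<comment> \<open>The value 0 off \<open>Z\<close> only extends \<open>h\<close> to a Borel
    function on the line; it is compared along jumps within \<open>Z\<close>.\<close>
  define h where "h x = (if x \<in> Z then enn2real (emeasure (Y.law x) B) else 0)" for x
  have hZ: "ennreal (h x) = emeasure (Y.law x) B" if "x \<in> Z" for x
  proof -
    have "emeasure (Y.law x) B \<le> 1"
      using prob_space.measure_le_1[OF Y.prob_space_law] that by simp
    then have "emeasure (Y.law x) B < \<top>" by (rule order_le_less_trans) simp
    then show ?thesis using that by (simp add: h_def)
  qed
  have h01: "0 \<le> h x" "h x \<le> 1" for x
  proof -
    show "0 \<le> h x" by (simp add: h_def)
    show "h x \<le> 1"
    proof (cases "x \<in> Z")
      case True
      then have "ennreal (h x) \<le> 1"
        unfolding hZ[OF True] using prob_space.measure_le_1[OF Y.prob_space_law] by simp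
      then show ?thesis by (simp add: ennreal_le_1)
    qed (simp add: h_def)
  qed
  have "(\<lambda>x. enn2real (emeasure (Y.law x) B)) \<in> borel_measurable borel_Z"
    using Y.measurable_emeasure_law[OF B'] by measurable
  then have h_borel: "h \<in> borel_measurable borel"
    unfolding h_def[abs_def] borel_Z_def by (subst (asm) measurable_restrict_space_iff) auto
  then have h_Z: "h \<in> borel_measurable borel_Z"
    unfolding borel_Z_def by (rule measurable_restrict_space1)
  have harm: "(\<integral>\<^sup>+y. ennreal (h y) \<partial>kernel x) = ennreal (h x)" if "x \<in> space borel_Z" for x
  proof -
    have "(\<integral>\<^sup>+y. ennreal (h y) \<partial>kernel x) = (\<integral>\<^sup>+y. emeasure (Y.law y) B \<partial>kernel x)"
      using Y.space_K[OF that] by (intro nn_integral_cong) (simp add: hZ)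
    also have "\<dots> = ennreal (h x)"
      using Y.law_shift_invariant[OF that B' shift'] that by (simp add: hZ)
    finally show ?thesis .
  qed
  \<comment> \<open>Bounded open pieces that exhaust \<open>Z\<close>: openness makes topological
    recurrence applicable to every point of the support that they contain, and boundedness makes
    their \<open>\<mu>\<close>-measure finite.\<close>
  define G where "G n = Z \<inter> {- (real n + 1)<..<real n + 1}" for n
  have "AE x in \<mu>. x \<in> G n \<longrightarrow> (AE y in kernel x. h y = h x)" for n
  proof (rule Y.harmonic_constant_on_recurrent[OF h_Z h01 harm])
    show "G n \<in> sets borel_Z" by (auto simp: sets_borel_Z_iff G_def)
    have "emeasure \<mu> (G n) = emeasure mu_line (G n)"
      unfolding \<mu>_eq by (rule emeasure_restrict_space) (auto simp: G_def)
    also have "\<dots> \<le> emeasure mu_line {- (real n + 1)..real n + 1}"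
      by (rule emeasure_mono) (auto simp: G_def)
    also have "\<dots> < \<infinity>" by (rule emeasure_mu_line_bounded)
    finally show "emeasure \<mu> (G n) < \<infinity>" .
    show "AE x in \<mu>. x \<in> G n \<longrightarrow> emeasure (Y.law x) {y \<in> space Y.trajectories. \<exists>k\<ge>1. y k \<in> G n} = 1"
      using AE_topological_support
    proof eventually_elim
      fix x assume "x \<in> topological_support \<mu>"
      then have r: "topologically_recurrent x" using rec by blast
      then have x: "x \<in> space borel_Z" by (simp add: topologically_recurrent_def)
      have "openin (top_of_set Z) (G n)" unfolding G_def by (rule openin_open_Int) simp
      with r show "x \<in> G n \<longrightarrow> emeasure (Y.law x) {y \<in> space Y.trajectories. \<exists>k\<ge>1. y k \<in> G n} = 1"
        unfolding topologically_recurrent_def path_law_eq Y.space_law[OF x] by blast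
    qed
  qed
  then have "AE x in \<mu>. \<forall>n. x \<in> G n \<longrightarrow> (AE y in kernel x. h y = h x)"
    unfolding AE_all_countable by blast
  then have "AE x in mu_line. x \<in> Z \<longrightarrow> (\<forall>n. x \<in> G n \<longrightarrow> (AE y in kernel x. h y = h x))"
    unfolding \<mu>_eq by (subst (asm) AE_restrict_space_iff) auto
  then have inv: "AE x in mu_line. x \<in> Z \<longrightarrow> (AE y in jump x. y \<in> Z \<longrightarrow> h y = h x)"
  proof eventually_elim
    fix x assume x: "x \<in> Z \<longrightarrow> (\<forall>n. x \<in> G n \<longrightarrow> (AE y in kernel x. h y = h x))"
    show "x \<in> Z \<longrightarrow> (AE y in jump x. y \<in> Z \<longrightarrow> h y = h x)"
    proof
      assume "x \<in> Z"
      obtain n :: nat where "\<bar>x\<bar> \<le> real n" using real_arch_simple by blast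
      then have "x \<in> G n" using \<open>x \<in> Z\<close> by (auto simp: G_def)
      with x \<open>x \<in> Z\<close> have "AE y in kernel x. h y = h x" by blast
      then show "AE y in jump x. y \<in> Z \<longrightarrow> h y = h x"
        unfolding kernel_def by (subst (asm) AE_restrict_space_iff) auto
    qed
  qed
  obtain c where "AE x in mu_line. h x = c"
    by (rule \<mu>_constant[OF h_borel h01 inv])
  then have "AE x in \<mu>. h x = c"
    unfolding \<mu>_eq by (subst AE_restrict_space_iff) auto
  then have "AE x in \<mu>. emeasure (Y.law x) B = ennreal c"
    using AE_space[of \<mu>] by eventually_elim (use hZ in force)
  from Y.shift_invariant_zero_one[OF B' shift' this]
  show "(AE x in \<mu>. emeasure (path_law x) B = 0) \<or> (AE x in \<mu>. emeasure (path_law x) (space paths - B) = 0)"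
    unfolding path_law_eq paths_def .
qed

end

theorem corollary1:
  fixes M :: "'a measure" and X X' :: "nat \<Rightarrow> 'a \<Rightarrow> real" and \<alpha> :: real
  assumes "switching_random_walk M X X' \<alpha>"
    and "AE \<omega> in M. liminf (\<lambda>n. ereal (walk X n \<omega>)) = -\<infinity>"
    and "AE \<omega> in M. limsup (\<lambda>n. ereal (walk X' n \<omega>)) = \<infinity>"
    and "\<forall>x \<in> switching_random_walk.topological_support M X X'
                (switching_random_walk.\<mu> M X X' \<alpha>).
           switching_random_walk.topologically_recurrent M X X' \<alpha> x"
  shows "switching_random_walk.ergodic M X X' \<alpha> (switching_random_walk.\<mu> M X X' \<alpha>)"
proof -
  interpret recurrent_switching_walk M X X' \<alpha>
    by (intro recurrent_switching_walk.intro recurrent_switching_walk_axioms.intro assms(1-3))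
  show ?thesis
    using assms(4) by (rule ergodic_\<mu>)
qed

end
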